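(* Let $\mathbb K$ be $\mathbb R$, $\mathbb C$, or a field of characteristic $p>0$, and let $\mathfrak n=\bigoplus_{k=-d}^{-1}\mathfrak n_k$ be an $n$-dimensional $\mathbb Z$-graded Lie algebra (or Lie superalgebra) over $\mathbb K$ of depth $d>1$ generated by $\mathfrak n_{-1}$, with basis $e_1,\dots,e_n$ compatible with the grading and structure constants $[e_i,e_j]=\sum_k c_{ij}^k e_k$. Let $I_s$ be the set of indices $i$ with $e_i\in\mathfrak n_{-s}$, let $n_1=\dim\mathfrak n_{-1}$ (so $I_1=\{1,\dots,n_1\}$), and let $\mathfrak v=\bigoplus_{k\ge-d}\mathfrak v_k$ be $\mathfrak{vect}(n)$ graded by $\deg x_i=s$ for $i\in I_s$, with $\mathfrak v_-=\bigoplus_{k<0}\mathfrak v_k$. Let $e_i\mapsto X_i$ be an embedding of $\mathfrak n$ into $\mathfrak{vect}(n)$ with $X_i\in\mathfrak v_{-s}$ for $i\in I_s$ and $X_i(0)=\partial_i$ for all $i$, and let $\mathfrak g_-=\operatorname{Span}(X_1,\dots,X_n)$. Then: (1) The centralizer of $\mathfrak g_-$ in $\mathfrak v_-$ has a unique basis $Y_1,\dots,Y_n$ with $Y_i(0)=\partial_i$ for all $i$; it satisfies $[Y_i,Y_j]=-\sum_k c_{ij}^kY_k$, so that this centralizer is isomorphic to $\mathfrak n$. (2) Let $\theta^1,\dots,\theta^n$ be the $1$-forms dual to the $Y_i$, i.e. $\theta^i(Y_j)=\delta^i_j$, and let $\mathcal D$ be the distribution given by the equations $\theta^k(X)=0$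 for all $k>n_1$. Then the complete algebraic prolong $(\mathfrak g_-)_*$, i.e. the maximal graded subalgebra of $\mathfrak v$ whose negative part is $\mathfrak g_-$, is equal to the subalgebra of all $X\in\mathfrak v$ preserving $\mathcal D$, i.e. of all $X$ such that $\theta^k([X,Y_i])=0$ for all $i=1,\dots,n_1$ and all $k>n_1$. Equivalently, $X\in(\mathfrak g_-)_*$ if and only if $$Y_i(\theta^k(X))-\sum_j(-1)^{p(Y_i)p(\theta^j(X))}c_{ij}^k\,\theta^j(X)=0\quad\text{for all } i=1,\dots,n_1,\ k=n_1+1,\dots,n .$$
   Context: Functions and vector fields: let $x_1,\dots,x_n$ be coordinates determined by the basis $e_1,\dots,e_n$ (in the super case $x_i$ has the parity of $e_i$). If $\mathbb K=\mathbb R$ or $\mathbb C$, let $\mathcal O$ be the algebra of polynomials in the $x_i$ (in the super case, the free supercommutative algebra on the $x_i$). If $\operatorname{char}\mathbb K=p>0$, $\mathcal O$ is the algebra of divided powers in the even $x_i$ (spanned by products of $x_i^{(k)}$, $k\ge 0$, with $x_i^{(k)}x_i^{(l)}=\binom{k+l}{k}x_i^{(k+l)}$ and $\partial_i x_i^{(k)}=x_i^{(k-1)}$), tensored in the super case with the Grassmann algebra of the odd $x_i$. $\mathfrak{vect}(n)$ is the Lie (super)algebra of vector fields $\sum_i f_i\partial_i$ with $f_i\in\mathcal O$, $\partial_i=\partial/\partial x_i$; $\partial_i$ has degree $-\deg x_i$, and $x_i^{(k)}$ has degree $k\deg x_i$. $X(0)$ denotes the value of a vector field at the origin. A basis is compatible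 with the grading if it is a union of bases of the $\mathfrak n_{-s}$, listed in order $s=1,2,\dots,d$. Depth $d$ means $\mathfrak n_{-d}\ne0$ and $\mathfrak n_k=0$ for $k<-d$. Every $X\in\mathfrak{vect}(n)$ is uniquely written $X=\sum_i\theta^i(X)Y_i$ with $\theta^i(X)\in\mathcal O$. In exponents of $-1$, $p(\cdot)$ denotes parity ($p=0$ everywhere in the non-super case), and sign formulas are extended from homogeneous elements by linearity. The complete algebraic prolong is $(\mathfrak g_-)_*=\bigoplus_{k\ge-d}\mathfrak g_k$, where the negative components are those of $\mathfrak g_-$ and, recursively for $k\ge0$, $\mathfrak g_k=\{X\in\mathfrak v_k\mid[X,\mathfrak g_{-1}]\subset\mathfrak g_{k-1}\}$. For Lie superalgebras the usual definitions are used; in characteristic $3$ this includes $[x,[x,x]]=0$ for odd $x$, and in characteristic $2$ it includes the squaring $x\mapsto x^2$ on odd elements (homomorphisms, subalgebras and generation respect squaring). *)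

theory Defs
  imports Complex_Main "HOL-Library.Poly_Mapping" "HOL-Library.FuncSet"
begin

section \<open>Lie superalgebras over a field of arbitrary characteristic\<close>

text \<open>
  Parities are booleans (\<open>False\<close> even, \<open>True\<close> odd), so the sum of parities \<open>a\<close>, \<open>b\<close> is \<open>a \<noteq> b\<close>.
  An ordinary Lie algebra is a Lie superalgebra whose odd part is zero.  The squaring is part of
  the structure only in characteristic 2 and is ignored in all other characteristics.
\<close>

record ('k, 'v) lsa =
  lsa_scale :: "'k \<Rightarrow> 'v \<Rightarrow> 'v"
  lsa_part :: "bool \<Rightarrow> 'v set"
  lsa_bracket :: "'v \<Rightarrow> 'v \<Rightarrow> 'v"
  lsa_square :: "'v \<Rightarrow> 'v"

definition lsa_carrier :: "('k, 'v::ab_group_add) lsa \<Rightarrow> 'v set" where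
  "lsa_carrier L = {x + y | x y. x \<in> lsa_part L False \<and> y \<in> lsa_part L True}"

definition koszul :: "bool \<Rightarrow> bool \<Rightarrow> 'a::ring_1" where
  "koszul a b = (if a \<and> b then - 1 else 1)"

definition lie_superalgebra :: "('k::field, 'v::ab_group_add) lsa \<Rightarrow> bool" where
  "lie_superalgebra L \<longleftrightarrow>
     vector_space (lsa_scale L) \<and>
     (\<forall>a. module.subspace (lsa_scale L) (lsa_part L a)) \<and>
     lsa_part L False \<inter> lsa_part L True = {0} \<and>
     (\<forall>a b. \<forall>x\<in>lsa_part L a. \<forall>y\<in>lsa_part L b. lsa_bracket L x y \<in> lsa_part L (a \<noteq> b)) \<and>
     (\<forall>x\<in>lsa_carrier L. \<forall>y\<in>lsa_carrier L. \<forall>z\<in>lsa_carrier L. \<forall>c.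
        lsa_bracket L (x + y) z = lsa_bracket L x z + lsa_bracket L y z \<and>
        lsa_bracket L x (y + z) = lsa_bracket L x y + lsa_bracket L x z \<and>
        lsa_bracket L (lsa_scale L c x) y = lsa_scale L c (lsa_bracket L x y) \<and>
        lsa_bracket L x (lsa_scale L c y) = lsa_scale L c (lsa_bracket L x y)) \<and>
     (\<forall>x\<in>lsa_part L False. lsa_bracket L x x = 0) \<and>
     (\<forall>a b. \<forall>x\<in>lsa_part L a. \<forall>y\<in>lsa_part L b.
        lsa_bracket L x y = lsa_scale L (- koszul a b) (lsa_bracket L y x)) \<and>
     (\<forall>a b c. \<forall>x\<in>lsa_part L a. \<forall>y\<in>lsa_part L b. \<forall>z\<in>lsa_part L c.
        lsa_bracket L x (lsa_bracket L y z) =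
          lsa_bracket L (lsa_bracket L x y) z +
          lsa_scale L (koszul a b) (lsa_bracket L y (lsa_bracket L x z))) \<and>
     (CHAR('k) = 3 \<longrightarrow>
        (\<forall>x\<in>lsa_part L True. lsa_bracket L x (lsa_bracket L x x) = 0)) \<and>
     (CHAR('k) = 2 \<longrightarrow>
        (\<forall>x\<in>lsa_part L True. lsa_square L x \<in> lsa_part L False) \<and>
        (\<forall>x\<in>lsa_part L True. \<forall>c.
           lsa_square L (lsa_scale L c x) = lsa_scale L (c ^ 2) (lsa_square L x)) \<and>
        (\<forall>x\<in>lsa_part L True. \<forall>y\<in>lsa_part L True.
           lsa_square L (x + y) = lsa_square L x + lsa_square L y + lsa_bracket L x y) \<and>
        (\<forall>x\<in>lsa_part L True. \<forall>y\<in>lsa_carrier L.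
           lsa_bracket L (lsa_square L x) y = lsa_bracket L x (lsa_bracket L x y)))"

definition super_subspace :: "('k::field, 'v::ab_group_add) lsa \<Rightarrow> 'v set \<Rightarrow> bool" where
  "super_subspace L h \<longleftrightarrow>
     module.subspace (lsa_scale L) h \<and>
     h = {x + y | x y. x \<in> h \<inter> lsa_part L False \<and> y \<in> h \<inter> lsa_part L True}"

definition lsa_subalgebra :: "('k::field, 'v::ab_group_add) lsa \<Rightarrow> 'v set \<Rightarrow> bool" where
  "lsa_subalgebra L h \<longleftrightarrow>
     super_subspace L h \<and>
     (\<forall>x\<in>h. \<forall>y\<in>h. lsa_bracket L x y \<in> h) \<and>
     (CHAR('k) = 2 \<longrightarrow> (\<forall>x\<in>h \<inter> lsa_part L True. lsa_square L x \<in> h))"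

definition lsa_restrict :: "('k, 'v) lsa \<Rightarrow> 'v set \<Rightarrow> ('k, 'v) lsa" where
  "lsa_restrict L h = L\<lparr>lsa_part := \<lambda>a. lsa_part L a \<inter> h\<rparr>"

definition lsa_generated_by :: "('k::field, 'v::ab_group_add) lsa \<Rightarrow> 'v set \<Rightarrow> bool" where
  "lsa_generated_by L S \<longleftrightarrow> (\<forall>h. lsa_subalgebra L h \<and> S \<subseteq> h \<longrightarrow> lsa_carrier L \<subseteq> h)"

definition lsa_hom ::
  "('k::field, 'v::ab_group_add) lsa \<Rightarrow> ('k, 'w::ab_group_add) lsa \<Rightarrow> ('v \<Rightarrow> 'w) \<Rightarrow> bool" where
  "lsa_hom L M \<phi> \<longleftrightarrow>
     (\<forall>a. \<forall>x\<in>lsa_part L a. \<phi> x \<in> lsa_part M a) \<and>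
     (\<forall>x\<in>lsa_carrier L. \<forall>y\<in>lsa_carrier L.
        \<phi> (x + y) = \<phi> x + \<phi> y \<and> \<phi> (lsa_bracket L x y) = lsa_bracket M (\<phi> x) (\<phi> y)) \<and>
     (\<forall>x\<in>lsa_carrier L. \<forall>c. \<phi> (lsa_scale L c x) = lsa_scale M c (\<phi> x)) \<and>
     (CHAR('k) = 2 \<longrightarrow> (\<forall>x\<in>lsa_part L True. \<phi> (lsa_square L x) = lsa_square M (\<phi> x)))"

definition lsa_embedding ::
  "('k::field, 'v::ab_group_add) lsa \<Rightarrow> ('k, 'w::ab_group_add) lsa \<Rightarrow> ('v \<Rightarrow> 'w) \<Rightarrow> bool" where
  "lsa_embedding L M \<phi> \<longleftrightarrow> lsa_hom L M \<phi> \<and> inj_on \<phi> (lsa_carrier L)"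

definition lsa_isomorphic ::
  "('k::field, 'v::ab_group_add) lsa \<Rightarrow> ('k, 'w::ab_group_add) lsa \<Rightarrow> bool" where
  "lsa_isomorphic L M \<longleftrightarrow>
     (\<exists>\<phi>. lsa_hom L M \<phi> \<and> bij_betw \<phi> (lsa_carrier L) (lsa_carrier M))"

definition lsa_centralizer :: "('k, 'v::zero) lsa \<Rightarrow> 'v set \<Rightarrow> 'v set \<Rightarrow> 'v set" where
  "lsa_centralizer L A B = {z \<in> A. \<forall>w\<in>B. lsa_bracket L w z = 0}"

definition lsa_grading ::
  "('k::field, 'v::ab_group_add) lsa \<Rightarrow> (int \<Rightarrow> 'v set) \<Rightarrow> bool" where
  "lsa_grading L G \<longleftrightarrow>
     (\<forall>k. super_subspace L (G k)) \<and>
     (\<forall>x\<in>lsa_carrier L.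
        \<exists>!f. (\<forall>k. f k \<in> G k) \<and> finite {k. f k \<noteq> 0} \<and> x = (\<Sum>k | f k \<noteq> 0. f k)) \<and>
     (\<forall>k l. \<forall>x\<in>G k. \<forall>y\<in>G l. lsa_bracket L x y \<in> G (k + l)) \<and>
     (CHAR('k) = 2 \<longrightarrow> (\<forall>k. \<forall>x\<in>G k \<inter> lsa_part L True. lsa_square L x \<in> G (2 * k)))"

definition family_basis ::
  "('k::field \<Rightarrow> 'v::ab_group_add \<Rightarrow> 'v) \<Rightarrow> nat set \<Rightarrow> (nat \<Rightarrow> 'v) \<Rightarrow> 'v set \<Rightarrow> bool" where
  "family_basis scl I b S \<longleftrightarrow>
     inj_on b I \<and> \<not> module.dependent scl (b ` I) \<and> module.span scl (b ` I) = S"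

definition field_iso :: "('a::field \<Rightarrow> 'b::field) \<Rightarrow> bool" where
  "field_iso f \<longleftrightarrow> bij f \<and> (\<forall>x y. f (x + y) = f x + f y \<and> f (x * y) = f x * f y)"


section \<open>The algebra of functions\<close>

abbreviation keys :: "('a \<Rightarrow>\<^sub>0 'b::zero) \<Rightarrow> 'a set" where
  "keys \<equiv> Poly_Mapping.keys"

abbreviation lookup :: "('a \<Rightarrow>\<^sub>0 'b::zero) \<Rightarrow> 'a \<Rightarrow> 'b" where
  "lookup \<equiv> Poly_Mapping.lookup"

text \<open>
  A function is a finitely supported family of coefficients indexed by exponent vectors.  The basis
  vector with exponent vector \<open>m\<close> stands for the ordered product over \<open>i = 1, \<dots>, n\<close> of the
  powers of \<open>x\<^sub>i\<close> with exponent \<open>m i\<close>: ordinary powers in characteristic 0, divided powers in positive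
  characteristic.  Throughout, \<open>p i\<close> is the parity of \<open>x\<^sub>i\<close> (equivalently of \<open>e\<^sub>i\<close> and of
  \<open>\<partial>\<^sub>i\<close>) and \<open>w i\<close> its degree.
\<close>

type_synonym monom = "nat \<Rightarrow>\<^sub>0 nat"
type_synonym 'k superfun = "monom \<Rightarrow>\<^sub>0 'k"
type_synonym 'k vfield = "nat \<Rightarrow>\<^sub>0 'k superfun"

definition monoms :: "nat \<Rightarrow> (nat \<Rightarrow> bool) \<Rightarrow> monom set" where
  "monoms n p = {m. keys m \<subseteq> {1..n} \<and> (\<forall>i. p i \<longrightarrow> lookup m i \<le> 1)}"

definition superfuns :: "nat \<Rightarrow> (nat \<Rightarrow> bool) \<Rightarrow> 'k::zero superfun set" where
  "superfuns n p = {f. keys f \<subseteq> monoms n p}"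

definition monom_parity :: "(nat \<Rightarrow> bool) \<Rightarrow> monom \<Rightarrow> bool" where
  "monom_parity p m \<longleftrightarrow> odd (\<Sum>i | i \<in> keys m \<and> p i. lookup m i)"

definition monom_degree :: "(nat \<Rightarrow> nat) \<Rightarrow> monom \<Rightarrow> nat" where
  "monom_degree w m = (\<Sum>i\<in>keys m. lookup m i * w i)"

text \<open>
  The product of the basis vectors with exponents \<open>a\<close> and \<open>b\<close> is \<open>mult_coeff p a b\<close> times the one
  with exponent \<open>a + b\<close>; the sign counts the transpositions of odd variables.
\<close>

definition mult_coeff :: "(nat \<Rightarrow> bool) \<Rightarrow> monom \<Rightarrow> monom \<Rightarrow> 'k::field" where
  "mult_coeff p a b =
     (if \<exists>i. p i \<and> lookup a i + lookup b i > 1 then 0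
      else (- 1) ^ card {(i, j). i \<in> keys a \<and> j \<in> keys b \<and> p i \<and> p j \<and> j < i} *
           (if CHAR('k) = 0 then 1
            else (\<Prod>i\<in>keys a. of_nat ((lookup a i + lookup b i) choose lookup a i))))"

definition fmult :: "(nat \<Rightarrow> bool) \<Rightarrow> 'k::field superfun \<Rightarrow> 'k superfun \<Rightarrow> 'k superfun" where
  "fmult p f g =
     (\<Sum>a\<in>keys f. \<Sum>b\<in>keys g.
        Poly_Mapping.single (a + b) (mult_coeff p a b * lookup f a * lookup g b))"

definition fconst :: "'k::zero \<Rightarrow> 'k superfun" where
  "fconst c = Poly_Mapping.single 0 c"

definition fscale :: "'k::field \<Rightarrow> 'k superfun \<Rightarrow> 'k superfun" where
  "fscale c f = Poly_Mapping.map (\<lambda>a. c * a) f"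

text \<open>The left derivative \<open>\<partial>\<^sub>i\<close>: even variables are skipped freely, odd ones with a sign.\<close>

definition deriv_coeff :: "(nat \<Rightarrow> bool) \<Rightarrow> nat \<Rightarrow> monom \<Rightarrow> 'k::field" where
  "deriv_coeff p i m =
     (if lookup m i = 0 then 0
      else if p i then (- 1) ^ card {j \<in> keys m. p j \<and> j < i}
      else if CHAR('k) = 0 then of_nat (lookup m i)
      else 1)"

definition pderivative :: "(nat \<Rightarrow> bool) \<Rightarrow> nat \<Rightarrow> 'k::field superfun \<Rightarrow> 'k superfun" where
  "pderivative p i f =
     (\<Sum>m\<in>keys f. Poly_Mapping.single (m - Poly_Mapping.single i 1) (deriv_coeff p i m * lookup f m))"

text \<open>The linear extension of \<open>f \<mapsto> (-1) ^ (b * p(f)) f\<close> from homogeneous \<open>f\<close>.\<close>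

definition parity_twist :: "(nat \<Rightarrow> bool) \<Rightarrow> bool \<Rightarrow> 'k::field superfun \<Rightarrow> 'k superfun" where
  "parity_twist p b f =
     (\<Sum>m\<in>keys f. Poly_Mapping.single m (koszul b (monom_parity p m) * lookup f m))"


section \<open>The Lie superalgebra of vector fields\<close>

text \<open>The component of \<open>X\<close> at \<open>i\<close> is the coefficient \<open>f\<^sub>i\<close> in \<open>X = \<Sum>\<^sub>i f\<^sub>i \<partial>\<^sub>i\<close>.\<close>

definition vfields :: "nat \<Rightarrow> (nat \<Rightarrow> bool) \<Rightarrow> 'k::zero vfield set" where
  "vfields n p = {X. keys X \<subseteq> {1..n} \<and> (\<forall>i. lookup X i \<in> superfuns n p)}"

definition vscale :: "'k::field \<Rightarrow> 'k vfield \<Rightarrow> 'k vfield" where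
  "vscale c X = Poly_Mapping.map (fscale c) X"

lemma vector_space_vscale: "vector_space (vscale :: 'k::field \<Rightarrow> 'k vfield \<Rightarrow> 'k vfield)"
proof -
  have fs: "lookup (fscale c f) m = c * lookup f m" for c :: 'k and f m
    by (simp add: fscale_def Poly_Mapping.map.rep_eq when_def)
  have vs: "lookup (vscale c X) i = fscale c (lookup X i)" for c :: 'k and X i
    by (auto simp: vscale_def Poly_Mapping.map.rep_eq when_def fs intro!: poly_mapping_eqI)
  show ?thesis
    by unfold_locales
      (auto intro!: poly_mapping_eqI simp: vs fs Poly_Mapping.lookup_add algebra_simps)
qed

definition fsmult :: "(nat \<Rightarrow> bool) \<Rightarrow> 'k::field superfun \<Rightarrow> 'k vfield \<Rightarrow> 'k vfield" where
  "fsmult p f X = Poly_Mapping.map (fmult p f) X"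

definition vpartial :: "nat \<Rightarrow> 'k::field vfield" where
  "vpartial i = Poly_Mapping.single i (fconst 1)"

definition value_at_0 :: "'k::zero vfield \<Rightarrow> 'k vfield" where
  "value_at_0 X = Poly_Mapping.map (\<lambda>f. fconst (lookup f 0)) X"

definition vact :: "(nat \<Rightarrow> bool) \<Rightarrow> 'k::field vfield \<Rightarrow> 'k superfun \<Rightarrow> 'k superfun" where
  "vact p X f = (\<Sum>i\<in>keys X. fmult p (lookup X i) (pderivative p i f))"

definition vparity_part :: "(nat \<Rightarrow> bool) \<Rightarrow> bool \<Rightarrow> 'k::field vfield \<Rightarrow> 'k vfield" where
  "vparity_part p a X =
     (\<Sum>i\<in>keys X. \<Sum>m | m \<in> keys (lookup X i) \<and> (monom_parity p m \<noteq> p i) = a.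
        Poly_Mapping.single i (Poly_Mapping.single m (lookup (lookup X i) m)))"

text \<open>The first-order part \<open>\<Sum>\<^sub>j X(Y\<^sub>j) \<partial>\<^sub>j\<close> of the composition of \<open>X\<close> with \<open>Y = \<Sum>\<^sub>j Y\<^sub>j \<partial>\<^sub>j\<close>.\<close>

definition vcomp :: "(nat \<Rightarrow> bool) \<Rightarrow> 'k::field vfield \<Rightarrow> 'k vfield \<Rightarrow> 'k vfield" where
  "vcomp p X Y = Poly_Mapping.map (vact p X) Y"

text \<open>
  The supercommutator.  In the supercommutator of homogeneous fields, and in the square of an odd
  field, the second-order parts cancel, so only \<open>vcomp\<close> contributes.
\<close>

definition vbracket :: "(nat \<Rightarrow> bool) \<Rightarrow> 'k::field vfield \<Rightarrow> 'k vfield \<Rightarrow> 'k vfield" where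
  "vbracket p X Y =
     (\<Sum>a\<in>UNIV. \<Sum>b\<in>UNIV.
        vcomp p (vparity_part p a X) (vparity_part p b Y) -
        vscale (koszul a b) (vcomp p (vparity_part p b Y) (vparity_part p a X)))"

definition vect :: "nat \<Rightarrow> (nat \<Rightarrow> bool) \<Rightarrow> ('k::field, 'k vfield) lsa" where
  "vect n p =
     \<lparr>lsa_scale = vscale,
      lsa_part = \<lambda>a. {X \<in> vfields n p.
        \<forall>i. \<forall>m\<in>keys (lookup X i). (monom_parity p m \<noteq> p i) = a},
      lsa_bracket = vbracket p,
      lsa_square = \<lambda>X. vcomp p X X\<rparr>"

definition vgrade ::
  "nat \<Rightarrow> (nat \<Rightarrow> bool) \<Rightarrow> (nat \<Rightarrow> nat) \<Rightarrow> int \<Rightarrow> 'k::zero vfield set" where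
  "vgrade n p w k =
     {X \<in> vfields n p. \<forall>i. \<forall>m\<in>keys (lookup X i). int (monom_degree w m) - int (w i) = k}"

definition vneg :: "nat \<Rightarrow> (nat \<Rightarrow> bool) \<Rightarrow> (nat \<Rightarrow> nat) \<Rightarrow> 'k::field vfield set" where
  "vneg n p w = module.span vscale (\<Union>k\<in>{..<0}. vgrade n p w k)"

definition graded_subalgebra ::
  "nat \<Rightarrow> (nat \<Rightarrow> bool) \<Rightarrow> (nat \<Rightarrow> nat) \<Rightarrow> 'k::field vfield set \<Rightarrow> bool" where
  "graded_subalgebra n p w h \<longleftrightarrow>
     lsa_subalgebra (vect n p) h \<and> h = module.span vscale (\<Union>k. h \<inter> vgrade n p w k)"


section \<open>The complete algebraic prolong\<close>

primrec prolong_nonneg ::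
  "nat \<Rightarrow> (nat \<Rightarrow> bool) \<Rightarrow> (nat \<Rightarrow> nat) \<Rightarrow> 'k::field vfield set \<Rightarrow> nat \<Rightarrow> 'k vfield set" where
  "prolong_nonneg n p w g 0 =
     {X \<in> vgrade n p w 0. \<forall>Z\<in>g \<inter> vgrade n p w (-1). vbracket p X Z \<in> g \<inter> vgrade n p w (-1)}"
| "prolong_nonneg n p w g (Suc k) =
     {X \<in> vgrade n p w (int (Suc k)).
        \<forall>Z\<in>g \<inter> vgrade n p w (-1). vbracket p X Z \<in> prolong_nonneg n p w g k}"

definition prolong_component ::
  "nat \<Rightarrow> (nat \<Rightarrow> bool) \<Rightarrow> (nat \<Rightarrow> nat) \<Rightarrow> 'k::field vfield set \<Rightarrow> int \<Rightarrow> 'k vfield set" where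
  "prolong_component n p w g k =
     (if k < 0 then g \<inter> vgrade n p w k else prolong_nonneg n p w g (nat k))"

definition complete_prolong ::
  "nat \<Rightarrow> (nat \<Rightarrow> bool) \<Rightarrow> (nat \<Rightarrow> nat) \<Rightarrow> 'k::field vfield set \<Rightarrow> 'k vfield set" where
  "complete_prolong n p w g = module.span vscale (\<Union>k. prolong_component n p w g k)"


section \<open>Forms and distributions\<close>

definition normalized_basis ::
  "nat \<Rightarrow> 'k::field vfield set \<Rightarrow> (nat \<Rightarrow> 'k vfield) \<Rightarrow> bool" where
  "normalized_basis n C Y \<longleftrightarrow>
     family_basis vscale {1..n} Y C \<and> (\<forall>i\<in>{1..n}. value_at_0 (Y i) = vpartial i)"

text \<open>
  1-forms are linear over functions acting from the left; this is the convention for which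
  \<open>X = \<Sum>\<^sub>i \<theta>\<^sup>i(X) Y\<^sub>i\<close>.
\<close>

definition one_form ::
  "nat \<Rightarrow> (nat \<Rightarrow> bool) \<Rightarrow> ('k::field vfield \<Rightarrow> 'k superfun) \<Rightarrow> bool" where
  "one_form n p \<theta> \<longleftrightarrow>
     (\<forall>X\<in>vfields n p. \<theta> X \<in> superfuns n p) \<and>
     (\<forall>X\<in>vfields n p. \<forall>Z\<in>vfields n p. \<theta> (X + Z) = \<theta> X + \<theta> Z) \<and>
     (\<forall>f\<in>superfuns n p. \<forall>X\<in>vfields n p. \<theta> (fsmult p f X) = fmult p f (\<theta> X))"

definition dual_forms ::
  "nat \<Rightarrow> (nat \<Rightarrow> bool) \<Rightarrow> (nat \<Rightarrow> 'k::field vfield) \<Rightarrow>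
     (nat \<Rightarrow> 'k vfield \<Rightarrow> 'k superfun) \<Rightarrow> bool" where
  "dual_forms n p Y \<theta> \<longleftrightarrow>
     (\<forall>i\<in>{1..n}. one_form n p (\<theta> i)) \<and>
     (\<forall>i\<in>{1..n}. \<forall>j\<in>{1..n}. \<theta> i (Y j) = fconst (if i = j then 1 else 0))"

definition distribution ::
  "nat \<Rightarrow> (nat \<Rightarrow> bool) \<Rightarrow> nat \<Rightarrow> (nat \<Rightarrow> 'k::field vfield \<Rightarrow> 'k superfun) \<Rightarrow> 'k vfield set" where
  "distribution n p n\<^sub>1 \<theta> = {Z \<in> vfields n p. \<forall>k\<in>{n\<^sub>1 + 1..n}. \<theta> k Z = 0}"

definition preserving ::
  "nat \<Rightarrow> (nat \<Rightarrow> bool) \<Rightarrow> 'k::field vfield set \<Rightarrow> 'k vfield set" where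
  "preserving n p D = {X \<in> vfields n p. \<forall>Z\<in>D. vbracket p X Z \<in> D}"

end

theory Submission
  imports Defs
begin

text \<open>
  Since the \<open>X\<^sub>i\<close> are homogeneous and equal \<open>\<partial>\<^sub>i\<close> at the origin, \<open>X\<^sub>i = \<partial>\<^sub>i\<close> plus terms
  \<open>f \<partial>\<^sub>l\<close> with \<open>l > i\<close>.  This triangularity gives an elementary Poincare lemma: a compatible
  system \<open>X\<^sub>j f = g\<^sub>j\<close> is solved by integrating in one variable at a time, starting with the last
  one; in characteristic 2 the squaring supplies the compatibility that the bracket does not.
  The \<open>Y\<^sub>i\<close> are then built component by component.  Mutually commuting fields with equal values at
  the origin satisfy \<open>(X \<circ> X')(0) = \<plusminus> (Y' \<circ> Y)(0)\<close>, whence the structure constants \<open>- c\<close>.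

  Let \<open>P\<close> be the set of fields \<open>Z\<close> with \<open>[Z, Y\<^sub>i] \<in> \<D>\<close> for \<open>i \<le> n\<^sub>1\<close>.  It is a graded subalgebra.
  For \<open>Z \<in> P\<close> of negative degree the coefficients of \<open>[Z, Y\<^sub>i]\<close> have negative degree, so \<open>Z\<close>
  commutes with the generators of the centralizer and lies in \<open>\<gg>\<^sub>-\<close>.  If \<open>Z\<close> has
  degree \<open>\<ge> 0\<close> and \<open>[Z, X\<^sub>i] \<in> P\<close> for \<open>i \<le> n\<^sub>1\<close>, then \<open>X\<^sub>i (\<theta>\<^sup>k [Z, Y\<^sub>j]) = 0\<close>; as the \<open>X\<^sub>i\<close> generate,
  \<open>\<theta>\<^sup>k [Z, Y\<^sub>j]\<close> is constant, hence zero because its degree is positive for \<open>k > n\<^sub>1\<close>.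
\<close>

section \<open>The algebra of functions\<close>

text \<open>Brackets are given by components, so identities between fields are not immediate. Fields
  act faithfully on functions, since the coordinates recover the components; Jacobi and squaring
  identities are proved for operators, once the second-order parts cancel. In characteristic 2 signs
  cannot produce this cancellation; symmetric terms are paired instead.

  In characteristic p divided powers have derivative coefficient 1, so the derivative in an even
  variable kills only functions free of it and is surjective; ordinary powers would lose both
  properties. An odd variable can be integrated only into functions free of it, an obstruction that
  the bracket or the square has to remove.

  Both X and Y are triangular frames, so frames are treated once and the results used twice. A field
  commuting with a frame is determined by its value at the origin; this rigidity gives uniqueness of
  Y, the correspondence between the two algebras and its compatibility with brackets and squares.
  Since X and Y commute, X differentiates the coefficients of a field in the frame Y without
  correction terms.\<close>

declare One_nat_def [simp del]

abbreviation single :: "'a \<Rightarrow> 'b::zero \<Rightarrow> 'a \<Rightarrow>\<^sub>0 'b" where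
  "single \<equiv> Poly_Mapping.single"

lemma lookup_single_if: "lookup (single a x) b = (if a = b then x else 0)"
  by (simp add: Poly_Mapping.lookup_single when_def)

lemma poly_mapping_sum_single: "(\<Sum>m\<in>keys f. single m (lookup f m)) = f"
  by (rule poly_mapping_eqI)
    (simp add: Poly_Mapping.lookup_sum lookup_single_if Poly_Mapping.in_keys_iff)

lemma lookup_map_zero: "f 0 = 0 \<Longrightarrow> lookup (Poly_Mapping.map f g) k = f (lookup g k)"
  by (simp add: Poly_Mapping.map.rep_eq when_def)

lemma lookup_fscale [simp]: "lookup (fscale c f) m = c * lookup f m"
  by (simp add: fscale_def lookup_map_zero)

lemma fscale_add: "fscale c (f + g) = fscale c f + fscale c g"
  by (rule poly_mapping_eqI) (simp add: lookup_add algebra_simps)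

lemma fscale_zero [simp]: "fscale c 0 = 0" "fscale 0 f = 0"
  by (auto intro!: poly_mapping_eqI)

lemma fscale_one [simp]: "fscale 1 f = f"
  by (auto intro!: poly_mapping_eqI)

lemma fscale_fscale [simp]: "fscale c (fscale d f) = fscale (c * d) f"
  by (auto intro!: poly_mapping_eqI)

lemma fscale_minus: "fscale (- c) f = - fscale c f" "fscale c (- f) = - fscale c f"
  by (auto intro!: poly_mapping_eqI)

lemma fscale_diff: "fscale c (f - g) = fscale c f - fscale c g"
  by (rule poly_mapping_eqI) (simp add: lookup_minus algebra_simps)

lemma fscale_single [simp]: "fscale c (single m x) = single m (c * x)"
  by (rule poly_mapping_eqI) (simp add: lookup_single_if)

lemma fscale_sum: "fscale c (sum f A) = (\<Sum>i\<in>A. fscale c (f i))"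
  by (induct A rule: infinite_finite_induct) (simp_all add: fscale_add)

lemma koszul_square [simp]: "koszul a b * koszul a b = (1::'a::ring_1)"
  by (simp add: koszul_def)

lemma koszul_square_left [simp]: "koszul a b * (koszul a b * x) = (x::'a::ring_1)"
  by (simp add: koszul_def)

lemma koszul_commute: "koszul a b = koszul b a"
  by (auto simp: koszul_def)

lemma koszul_False [simp]: "koszul False b = 1" "koszul b False = 1"
  by (auto simp: koszul_def)

lemma koszul_xor: "koszul a (b = (\<not> c)) = (koszul a b * koszul a c :: 'a::ring_1)"
  "koszul (b = (\<not> c)) a = (koszul b a * koszul c a :: 'a::ring_1)"
  by (auto simp: koszul_def)

lemma koszul_char_2: "CHAR('a) = 2 \<Longrightarrow> koszul a b = (1::'a::ring_1)"
  using uminus_CHAR_2[of "1::'a"] by (auto simp: koszul_def)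

lemma lookup_pderivative:
  "lookup (pderivative p i f) m = deriv_coeff p i (m + single i 1) * lookup f (m + single i 1)"
proof -
  have "lookup (pderivative p i f) m =
      (\<Sum>k\<in>keys f. if k = m + single i 1 then deriv_coeff p i k * lookup f k else 0)"
    unfolding pderivative_def Poly_Mapping.lookup_sum
  proof (rule sum.cong[OF refl])
    fix k assume "k \<in> keys f"
    show "lookup (single (k - single i 1) (deriv_coeff p i k * lookup f k)) m =
      (if k = m + single i 1 then deriv_coeff p i k * lookup f k else 0)"
    \<comment> \<open>Subtraction of exponents is truncated: a monomial without the variable
      \<open>i\<close> is left unchanged by it, but then its \<open>deriv_coeff\<close> is
      0.\<close>
    proof (cases "lookup k i = 0")
      case True
      hence "k \<noteq> m + single i 1"
        by (auto simp: lookup_add)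
      thus ?thesis using True by (simp add: deriv_coeff_def)
    next
      case False
      hence "k - single i 1 = m \<longleftrightarrow> k = m + single i 1"
        by (auto simp: poly_mapping_eq_iff fun_eq_iff lookup_add lookup_minus lookup_single_if)
      thus ?thesis by (simp add: lookup_single_if)
    qed
  qed
  also have "\<dots> = deriv_coeff p i (m + single i 1) * lookup f (m + single i 1)"
    by (simp add: Poly_Mapping.in_keys_iff)
  finally show ?thesis .
qed

lemma pderivative_add: "pderivative p i (f + g) = pderivative p i f + pderivative p i g"
  by (rule poly_mapping_eqI) (simp add: lookup_pderivative lookup_add algebra_simps)

lemma pderivative_zero [simp]: "pderivative p i 0 = 0"
  by (rule poly_mapping_eqI) (simp add: lookup_pderivative)

lemma pderivative_fscale: "pderivative p i (fscale c f) = fscale c (pderivative p i f)"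
  by (rule poly_mapping_eqI) (simp add: lookup_pderivative)

lemma pderivative_single:
  "pderivative p i (single m x) = single (m - single i 1) (deriv_coeff p i m * x)"
  by (simp add: pderivative_def)

lemma lookup_parity_twist [simp]:
  "lookup (parity_twist p b f) m = koszul b (monom_parity p m) * lookup f m"
  by (simp add: parity_twist_def Poly_Mapping.lookup_sum lookup_single_if Poly_Mapping.in_keys_iff)

lemma parity_twist_add: "parity_twist p b (f + g) = parity_twist p b f + parity_twist p b g"
  by (rule poly_mapping_eqI) (simp add: lookup_add algebra_simps)

lemma parity_twist_single:
  "parity_twist p b (single m x) = single m (koszul b (monom_parity p m) * x)"
  by (rule poly_mapping_eqI) (simp add: lookup_single_if)

section \<open>Bilinearity of the product\<close>

lemma fmult_expand:
  assumes "finite A" "keys f \<subseteq> A" "finite B" "keys g \<subseteq> B"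
  shows "fmult p f g = (\<Sum>a\<in>A. \<Sum>b\<in>B.
    single (a + b) (mult_coeff p a b * lookup f a * lookup g b))"
proof -
  have "(\<Sum>b\<in>keys g. single (a + b) (mult_coeff p a b * lookup f a * lookup g b)) =
      (\<Sum>b\<in>B. single (a + b) (mult_coeff p a b * lookup f a * lookup g b))" for a
    using assms by (intro sum.mono_neutral_left) (auto simp: Poly_Mapping.in_keys_iff)
  moreover have "(\<Sum>a\<in>keys f. \<Sum>b\<in>B. single (a + b) (mult_coeff p a b * lookup f a * lookup g b)) =
      (\<Sum>a\<in>A. \<Sum>b\<in>B. single (a + b) (mult_coeff p a b * lookup f a * lookup g b))"
    using assms by (intro sum.mono_neutral_left) (auto simp: Poly_Mapping.in_keys_iff)
  ultimately show ?thesis by (simp add: fmult_def)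
qed

lemma fmult_add_left: "fmult p (f + f') g = fmult p f g + fmult p f' g"
proof -
  have "keys (f + f') \<subseteq> keys f \<union> keys f'" by (rule Poly_Mapping.keys_add)
  thus ?thesis
    by (simp add: fmult_expand[where A = "keys f \<union> keys f'" and B = "keys g"] lookup_add
        algebra_simps single_add sum.distrib)
qed

lemma fmult_add_right: "fmult p f (g + g') = fmult p f g + fmult p f g'"
proof -
  have "keys (g + g') \<subseteq> keys g \<union> keys g'" by (rule Poly_Mapping.keys_add)
  thus ?thesis
    by (simp add: fmult_expand[where B = "keys g \<union> keys g'" and A = "keys f"] lookup_add
        algebra_simps single_add sum.distrib)
qed

lemma additive_fmult_left: "additive (\<lambda>f. fmult p f g)"
  and additive_fmult_right: "additive (\<lambda>g. fmult p f g)"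
  by (unfold_locales; simp add: fmult_add_left fmult_add_right)+

lemmas fmult_zero_left [simp] = additive.zero[OF additive_fmult_left]
  and fmult_zero_right [simp] = additive.zero[OF additive_fmult_right]
  and fmult_minus_right = additive.minus[OF additive_fmult_right]
  and fmult_diff_right = additive.diff[OF additive_fmult_right]
  and fmult_sum_left = additive.sum[OF additive_fmult_left]
  and fmult_sum_right = additive.sum[OF additive_fmult_right]

lemma fmult_single:
  "fmult p (single a x) (single b y) = single (a + b) (mult_coeff p a b * x * y)"
  by (simp add: fmult_expand[where A = "{a}" and B = "{b}"])

lemma fmult_fscale_left: "fmult p (fscale c f) g = fscale c (fmult p f g)"
  by (subst fmult_expand[where A = "keys f" and B = "keys g"])
    (auto simp: Poly_Mapping.in_keys_iff fmult_def fscale_sum algebra_simps)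

lemma fmult_fscale_right: "fmult p f (fscale c g) = fscale c (fmult p f g)"
  by (subst fmult_expand[where A = "keys f" and B = "keys g"])
    (auto simp: Poly_Mapping.in_keys_iff fmult_def fscale_sum algebra_simps)

lemma keys_fmultD:
  fixes f g :: "'k::field superfun"
  assumes "k \<in> keys (fmult p f g)"
  obtains a b where "a \<in> keys f" "b \<in> keys g" "k = a + b" "mult_coeff p a b \<noteq> (0::'k)"
proof -
  have "lookup (fmult p f g) k \<noteq> 0" using assms by (simp add: Poly_Mapping.in_keys_iff)
  hence "(\<Sum>a\<in>keys f. \<Sum>b\<in>keys g. lookup (single (a + b) (mult_coeff p a b * lookup f a * lookup g b)) k) \<noteq> 0"
    by (simp add: fmult_def Poly_Mapping.lookup_sum)
  then obtain a b where "a \<in> keys f" "b \<in> keys g"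
    "lookup (single (a + b) (mult_coeff p a b * lookup f a * lookup g b)) k \<noteq> 0"
    by (metis (mono_tags, lifting) sum.neutral)
  thus thesis using that by (auto simp: lookup_single_if split: if_splits)
qed

lemma superfuns_keys: "f \<in> superfuns n p \<longleftrightarrow> (\<forall>m\<in>keys f. m \<in> monoms n p)"
  by (auto simp: superfuns_def)

text \<open>Identities in the function algebra are checked on basis vectors and extended by this
  lemma one argument at a time. Restricting \<open>m\<close> to the support of \<open>f\<close>
  keeps facts such as membership in \<open>superfuns\<close> available.\<close>

lemma additive_ext:
  assumes F: "additive F" and H: "additive H"
    and eq: "\<And>m x. m \<in> keys f \<Longrightarrow> F (single m x) = H (single m x)"
  shows "F f = H f"
proof -
  have "F (\<Sum>m\<in>keys f. single m (lookup f m)) = H (\<Sum>m\<in>keys f. single m (lookup f m))"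
    unfolding additive.sum[OF F] additive.sum[OF H]
    by (intro sum.cong) (auto simp: eq)
  thus ?thesis by (simp add: poly_mapping_sum_single)
qed

lemma monom_parity_add: "monom_parity p (a + b) = (monom_parity p a \<noteq> monom_parity p b)"
proof -
  have E: "(\<Sum>i | i \<in> keys m \<and> p i. lookup m i) = (\<Sum>i | i \<in> keys a \<union> keys b \<and> p i. lookup m i)"
    if "keys m \<subseteq> keys a \<union> keys b" for m :: monom
    using that by (intro sum.mono_neutral_left) (auto simp: not_in_keys_iff_lookup_eq_zero[symmetric])
  show ?thesis
    unfolding monom_parity_def E[OF keys_add] E[OF Un_upper1] E[OF Un_upper2]
    by (simp add: lookup_add sum.distrib)
qed

lemma monom_degree_add: "monom_degree w (a + b) = monom_degree w a + monom_degree w b"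
proof -
  have E: "(\<Sum>i\<in>keys m. lookup m i * w i) = (\<Sum>i\<in>keys a \<union> keys b. lookup m i * w i)"
    if "keys m \<subseteq> keys a \<union> keys b" for m :: monom
    using that by (intro sum.mono_neutral_left) (auto simp: not_in_keys_iff_lookup_eq_zero[symmetric])
  show ?thesis
    unfolding monom_degree_def E[OF keys_add] E[OF Un_upper1] E[OF Un_upper2]
    by (simp add: lookup_add sum.distrib add_mult_distrib)
qed

lemma monom_parity_zero [simp]: "\<not> monom_parity p 0"
  by (simp add: monom_parity_def)

lemma monom_degree_zero [simp]: "monom_degree w 0 = 0"
  by (simp add: monom_degree_def)

lemma monom_parity_single [simp]: "monom_parity p (single i 1) = p i"
proof -
  have "{j. j = i \<and> p j} = (if p i then {i} else {})" by auto
  thus ?thesis by (simp add: monom_parity_def)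
qed

lemma monom_degree_single [simp]: "monom_degree w (single i 1) = w i"
  by (simp add: monom_degree_def)

lemma monom_minus_single:
  assumes "lookup m i \<noteq> 0"
  obtains m' :: monom where "m = m' + single i 1"
proof
  show "m = (m - single i 1) + single i 1"
    using assms by (auto intro!: poly_mapping_eqI simp: lookup_add lookup_minus lookup_single_if)
qed

lemma lookup_monom_0D:
  assumes "m \<in> monoms n p" "i \<notin> {1..n}" shows "lookup m i = 0"
  using assms unfolding monoms_def by (auto simp: Poly_Mapping.in_keys_iff)

lemma monoms_addD: "a + b \<in> monoms n p \<Longrightarrow> a \<in> monoms n p"
  "a + b \<in> monoms n p \<Longrightarrow> b \<in> monoms n p"
  unfolding monoms_def by (auto simp: Poly_Mapping.in_keys_iff lookup_add subset_iff)

lemma monoms_alt: "m \<in> monoms n p \<longleftrightarrow>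
    (\<forall>i. (i \<notin> {1..n} \<longrightarrow> lookup m i = 0) \<and> (p i \<longrightarrow> lookup m i \<le> 1))"
  unfolding monoms_def by (auto simp: Poly_Mapping.in_keys_iff)

section \<open>Signs and binomials of the product\<close>

definition clash :: "(nat \<Rightarrow> bool) \<Rightarrow> monom \<Rightarrow> monom \<Rightarrow> bool" where
  "clash p a b \<longleftrightarrow> (\<exists>i. p i \<and> lookup a i + lookup b i > 1)"

lemma clash_monoms:
  assumes "a \<in> monoms n p" "b \<in> monoms n p"
  shows "a + b \<in> monoms n p \<longleftrightarrow> \<not> clash p a b"
  using assms by (auto simp: monoms_alt clash_def lookup_add not_less)

text \<open>The number of transpositions of odd variables and the even factor of the structure constants,
  written as a sum and a product over all variables, so that both are visibly bimultiplicative.\<close>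

definition inversions :: "nat \<Rightarrow> (nat \<Rightarrow> bool) \<Rightarrow> monom \<Rightarrow> monom \<Rightarrow> nat" where
  "inversions n p a b =
    (\<Sum>i\<in>{1..n}. \<Sum>j\<in>{1..n}. if p i \<and> p j \<and> j < i then lookup a i * lookup b j else 0)"

definition even_coeff :: "nat \<Rightarrow> monom \<Rightarrow> monom \<Rightarrow> 'k::field" where
  "even_coeff n a b = (if CHAR('k) = 0 then 1
     else (\<Prod>i\<in>{1..n}. of_nat ((lookup a i + lookup b i) choose lookup a i)))"

text \<open>Modulo 2 this is the sign exponent for moving the odd variable \<open>i\<close>, or its
  derivative, past the odd variables of \<open>m\<close> that stand to its left;
  \<open>odd_above\<close> does the same for the right.\<close>

definition odd_below :: "nat \<Rightarrow> (nat \<Rightarrow> bool) \<Rightarrow> nat \<Rightarrow> monom \<Rightarrow> nat" where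
  "odd_below n p i m = (\<Sum>j\<in>{1..n}. if p j \<and> j < i then lookup m j else 0)"

definition odd_above :: "nat \<Rightarrow> (nat \<Rightarrow> bool) \<Rightarrow> nat \<Rightarrow> monom \<Rightarrow> nat" where
  "odd_above n p i m = (\<Sum>j\<in>{1..n}. if p j \<and> i < j then lookup m j else 0)"

lemma lookup_odd_monom: "m \<in> monoms n p \<Longrightarrow> p i \<Longrightarrow> lookup m i = (if i \<in> keys m then 1 else 0)"
  by (auto simp: monoms_alt Poly_Mapping.in_keys_iff le_Suc_eq)

text \<open>In \<open>monoms\<close> the odd exponents are 0 or 1, so counting pairs of odd
  variables is the same as summing products of exponents.\<close>

lemma mult_coeff_eq:
  assumes a: "a \<in> monoms n p" and b: "b \<in> monoms n p"
  shows "mult_coeff p a b =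
    (if clash p a b then 0 else (- 1) ^ inversions n p a b * (even_coeff n a b :: 'k::field))"
proof -
  let ?S = "{(i, j). i \<in> keys a \<and> j \<in> keys b \<and> p i \<and> p j \<and> j < i}"
  have ka: "keys a \<subseteq> {1..n}" and kb: "keys b \<subseteq> {1..n}" using a b by (auto simp: monoms_def)
  have "card ?S = (\<Sum>x\<in>{1..n}\<times>{1..n}. if x \<in> ?S then 1 else 0)"
    using ka kb by (subst sum.inter_restrict[symmetric]) (auto intro!: arg_cong[where f = card])
  also have "\<dots> = (\<Sum>i\<in>{1..n}. \<Sum>j\<in>{1..n}. if (i, j) \<in> ?S then 1 else 0)"
    by (subst sum.cartesian_product) (auto intro!: sum.cong)
  also have "\<dots> = inversions n p a b"
    unfolding inversions_def
    by (intro sum.cong refl) (auto simp: lookup_odd_monom[OF a] lookup_odd_monom[OF b])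
  finally have 1: "card ?S = inversions n p a b" .
  have "(\<Prod>i\<in>keys a. of_nat ((lookup a i + lookup b i) choose lookup a i) :: 'k) =
      (\<Prod>i\<in>{1..n}. of_nat ((lookup a i + lookup b i) choose lookup a i))"
    using ka by (intro prod.mono_neutral_left) (auto simp: Poly_Mapping.in_keys_iff)
  thus ?thesis unfolding mult_coeff_def clash_def even_coeff_def 1 by auto
qed

lemma deriv_coeff_eq:
  assumes m: "m \<in> monoms n p"
  shows "deriv_coeff p i m =
    (if lookup m i = 0 then 0 else if p i then (- 1) ^ odd_below n p i m
     else if CHAR('k) = 0 then of_nat (lookup m i) else (1::'k::field))"
proof -
  have km: "keys m \<subseteq> {1..n}" using m by (auto simp: monoms_def)
  let ?S = "{j \<in> keys m. p j \<and> j < i}"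
  have "card ?S = (\<Sum>x\<in>{1..n}. if x \<in> ?S then 1 else 0)"
    using km by (subst sum.inter_restrict[symmetric]) (auto intro!: arg_cong[where f = card])
  also have "\<dots> = odd_below n p i m"
    unfolding odd_below_def
    by (intro sum.cong refl) (auto simp: lookup_odd_monom[OF m])
  finally show ?thesis by (simp add: deriv_coeff_def)
qed

text \<open>This is what makes integration possible in every characteristic: a positive exponent is
  invertible in characteristic 0, and in characteristic p the divided powers have coefficient
  1.\<close>

lemma deriv_coeff_nonzero: "lookup m i \<noteq> 0 \<Longrightarrow> deriv_coeff p i m \<noteq> (0::'k::field)"
  by (auto simp: deriv_coeff_def of_nat_eq_0_iff_char_dvd)

lemma inversions_add:
  "inversions n p (a + b) c = inversions n p a c + inversions n p b c"
  "inversions n p a (b + c) = inversions n p a b + inversions n p a c"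
  unfolding inversions_def sum.distrib[symmetric]
  by (intro sum.cong refl; simp add: lookup_add algebra_simps)+

lemma odd_below_add: "odd_below n p i (a + b) = odd_below n p i a + odd_below n p i b"
  and odd_above_add: "odd_above n p i (a + b) = odd_above n p i a + odd_above n p i b"
  unfolding odd_below_def odd_above_def sum.distrib[symmetric]
  by (intro sum.cong refl; simp add: lookup_add algebra_simps)+

lemma inversions_single:
  assumes "i \<in> {1..n}" "p i"
  shows "inversions n p (single i 1) b = odd_below n p i b"
    and "inversions n p a (single i 1) = odd_above n p i a"
proof -
  have "inversions n p (single i 1) b = (\<Sum>i'\<in>{1..n}. if i' = i then odd_below n p i b else 0)"
    unfolding inversions_def odd_below_def
    using assms by (intro sum.cong refl) (auto simp: lookup_single_if intro!: sum.cong sum.neutral)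
  thus "inversions n p (single i 1) b = odd_below n p i b" using assms by simp
  have "inversions n p a (single i 1) = (\<Sum>i'\<in>{1..n}. \<Sum>j\<in>{1..n}. if j = i then
      (if p i' \<and> i < i' then lookup a i' else 0) else 0)"
    unfolding inversions_def
    using assms by (intro sum.cong refl) (auto simp: lookup_single_if)
  thus "inversions n p a (single i 1) = odd_above n p i a" using assms by (simp add: odd_above_def)
qed

lemma odd_below_single: "odd_below n p i (single j 1) = (if j \<in> {1..n} \<and> p j \<and> j < i then 1 else 0)"
proof -
  have "odd_below n p i (single j 1) = (\<Sum>k\<in>{1..n}. if k = j then (if p j \<and> j < i then 1 else 0) else 0)"
    unfolding odd_below_def by (intro sum.cong refl) (auto simp: lookup_single_if)
  thus ?thesis by simp
qed

lemma monom_parity_eq: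
  assumes "m \<in> monoms n p"
  shows "monom_parity p m = odd (\<Sum>i\<in>{1..n}. if p i then lookup m i else 0)"
proof -
  have "(\<Sum>i | i \<in> keys m \<and> p i. lookup m i) = (\<Sum>i\<in>{i\<in>{1..n}. p i}. lookup m i)"
    using assms by (intro sum.mono_neutral_left) (auto simp: Poly_Mapping.in_keys_iff monoms_alt)
  thus ?thesis by (simp add: monom_parity_def sum.If_cases Int_def)
qed

lemma monom_parity_split:
  assumes "m \<in> monoms n p" "i \<in> {1..n}" "p i"
  shows "monom_parity p m = odd (odd_below n p i m + lookup m i + odd_above n p i m)"
proof -
  have "odd_below n p i m + lookup m i + odd_above n p i m =
     (\<Sum>j\<in>{1..n}. (if p j \<and> j < i then lookup m j else 0) + (if j = i then lookup m i else 0)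
        + (if p j \<and> i < j then lookup m j else 0))"
    using assms by (simp add: odd_below_def odd_above_def sum.distrib)
  also have "\<dots> = (\<Sum>i\<in>{1..n}. if p i then lookup m i else 0)"
    using assms by (intro sum.cong) auto
  finally show ?thesis using assms(1) by (simp add: monom_parity_eq)
qed

text \<open>The two counts together run over all pairs of an odd variable of \<open>a\<close> and an
  odd variable of \<open>b\<close> with different indices. Without a clash the pairs with equal
  indices contribute nothing, so the total is the product of the two odd degrees.\<close>

lemma inversions_swap:
  assumes a: "a \<in> monoms n p" and b: "b \<in> monoms n p" and "\<not> clash p a b"
  shows "odd (inversions n p a b + inversions n p b a) \<longleftrightarrow> monom_parity p a \<and> monom_parity p b"
proof -
  have "inversions n p b a =
    (\<Sum>i\<in>{1..n}. \<Sum>j\<in>{1..n}. if p i \<and> p j \<and> i < j then lookup a i * lookup b j else 0)"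
    unfolding inversions_def by (subst sum.swap) (intro sum.cong refl, auto)
  hence "inversions n p a b + inversions n p b a = (\<Sum>i\<in>{1..n}. \<Sum>j\<in>{1..n}.
     (if p i \<and> p j \<and> j < i then lookup a i * lookup b j else 0) +
     (if p i \<and> p j \<and> i < j then lookup a i * lookup b j else 0))"
    by (simp add: inversions_def sum.distrib)
  also have "\<dots> = (\<Sum>i\<in>{1..n}. \<Sum>j\<in>{1..n}. (if p i then lookup a i else 0) * (if p j then lookup b j else 0))"
  proof (intro sum.cong refl)
    fix i j
    have "lookup a i = 0 \<or> lookup b i = 0" if "p i"
      using assms(3) that by (auto simp: clash_def not_less le_Suc_eq)
    thus "(if p i \<and> p j \<and> j < i then lookup a i * lookup b j else 0) +
      (if p i \<and> p j \<and> i < j then lookup a i * lookup b j else 0) =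
      (if p i then lookup a i else 0) * (if p j then lookup b j else 0)"
      by (cases i j rule: linorder_cases) auto
  qed
  also have "\<dots> = (\<Sum>i\<in>{1..n}. if p i then lookup a i else 0) * (\<Sum>j\<in>{1..n}. if p j then lookup b j else 0)"
    by (simp add: sum_product)
  finally show ?thesis using a b by (simp add: monom_parity_eq)
qed


lemma even_coeff_assoc:
  "even_coeff n a b * even_coeff n (a + b) c = even_coeff n b c * (even_coeff n a (b + c) :: 'k::field)"
proof -
  have "(x + y choose x) * (x + y + z choose (x + y)) = (y + z choose y) * (x + (y + z) choose x)"
    for x y z :: nat
    using choose_mult[of x "x + y" "x + y + z"] by (simp add: algebra_simps)
  hence "of_nat (x + y choose x) * of_nat (x + y + z choose (x + y)) =
      of_nat (y + z choose y) * (of_nat (x + (y + z) choose x) :: 'k)" for x y z :: nat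
    by (metis of_nat_mult)
  thus ?thesis
    by (simp add: even_coeff_def prod.distrib[symmetric] lookup_add)
qed

text \<open>If the total exponent stays in \<open>monoms\<close>, no partial product clashes; the
  signs agree by bimultiplicativity, and both products of binomials are products of trinomial
  coefficients. Otherwise a clash occurs somewhere on each side.\<close>

lemma mult_coeff_assoc:
  assumes "a \<in> monoms n p" "b \<in> monoms n p" "c \<in> monoms n p"
  shows "mult_coeff p a b * mult_coeff p (a + b) c = mult_coeff p b c * (mult_coeff p a (b + c) :: 'k::field)"
proof (cases "a + b + c \<in> monoms n p")
  case True
  hence m: "a + (b + c) \<in> monoms n p" by (simp add: add.assoc)
  note m = m monoms_addD(1)[OF True] monoms_addD(2)[OF m]
  have "\<not> clash p a b" "\<not> clash p b c" "\<not> clash p (a + b) c" "\<not> clash p a (b + c)"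
    using True m assms by (simp_all flip: clash_monoms)
  thus ?thesis
    using assms True m even_coeff_assoc[of n a b c, where 'k = 'k]
    by (simp add: mult_coeff_eq inversions_add power_add)
next
  case False
  hence "a + b \<notin> monoms n p \<or> mult_coeff p (a + b) c = (0::'k)"
    using assms False by (cases "a + b \<in> monoms n p") (auto simp: mult_coeff_eq simp flip: clash_monoms)
  moreover have "b + c \<notin> monoms n p \<or> mult_coeff p a (b + c) = (0::'k)"
    using assms False
    by (cases "b + c \<in> monoms n p") (auto simp: mult_coeff_eq add.assoc simp flip: clash_monoms)
  ultimately show ?thesis
    using assms by (auto simp: mult_coeff_eq clash_monoms)
qed

lemma fmult_assoc:
  assumes f: "f \<in> superfuns n p" and g: "g \<in> superfuns n p" and h: "h \<in> superfuns n p"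
  shows "fmult p (fmult p f g) h = fmult p f (fmult p g h)"
proof -
  have 1: "fmult p (fmult p (single a x) (single b y)) (single c z) =
      fmult p (single a x) (fmult p (single b y) (single c z))"
    if "a \<in> monoms n p" "b \<in> monoms n p" "c \<in> monoms n p" for a b c and x y z :: 'a
    using mult_coeff_assoc[OF that, where 'k = 'a]
    by (simp add: fmult_single add.assoc mult_ac)
  have 2: "fmult p (fmult p (single a x) (single b y)) h = fmult p (single a x) (fmult p (single b y) h)"
    if "a \<in> monoms n p" "b \<in> monoms n p" for a b x y
    by (rule additive_ext[of "\<lambda>h. fmult p (fmult p (single a x) (single b y)) h"])
      (use h that in \<open>auto simp: additive_def fmult_add_right superfuns_keys intro!: 1\<close>)
  have 3: "fmult p (fmult p (single a x) g) h = fmult p (single a x) (fmult p g h)"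
    if "a \<in> monoms n p" for a x
    by (rule additive_ext[of "\<lambda>g. fmult p (fmult p (single a x) g) h"])
      (use g that in \<open>auto simp: additive_def fmult_add_right fmult_add_left superfuns_keys intro!: 2\<close>)
  show ?thesis
    by (rule additive_ext[of "\<lambda>f. fmult p (fmult p f g) h"])
      (use f in \<open>auto simp: additive_def fmult_add_left superfuns_keys intro!: 3\<close>)
qed

section \<open>Parity, degree and supercommutativity\<close>

definition fparity :: "nat \<Rightarrow> (nat \<Rightarrow> bool) \<Rightarrow> bool \<Rightarrow> 'k::zero superfun set" where
  "fparity n p a = {f \<in> superfuns n p. \<forall>m\<in>keys f. monom_parity p m = a}"

definition fgrade :: "nat \<Rightarrow> (nat \<Rightarrow> bool) \<Rightarrow> (nat \<Rightarrow> nat) \<Rightarrow> int \<Rightarrow> 'k::zero superfun set" where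
  "fgrade n p w D = {f \<in> superfuns n p. \<forall>m\<in>keys f. int (monom_degree w m) = D}"

lemma parity_twist_fparity: "f \<in> fparity n p a \<Longrightarrow> parity_twist p b f = fscale (koszul b a) f"
  by (rule poly_mapping_eqI) (auto simp: fparity_def Poly_Mapping.in_keys_iff)

lemma even_coeff_commute: "even_coeff n a b = even_coeff n b a"
  by (simp add: even_coeff_def add.commute binomial_symmetric[of "lookup a i" "lookup a i + lookup b i" for i])

lemma mult_coeff_commute:
  assumes "a \<in> monoms n p" "b \<in> monoms n p"
  shows "mult_coeff p a b = koszul (monom_parity p b) (monom_parity p a) * (mult_coeff p b a :: 'k::field)"
proof (cases "clash p a b")
  case True
  hence "clash p b a" by (auto simp: clash_def add.commute)
  thus ?thesis using True assms by (simp add: mult_coeff_eq)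
next
  case False
  hence "\<not> clash p b a" by (auto simp: clash_def add.commute)
  moreover have "(- 1) ^ inversions n p a b = koszul (monom_parity p b) (monom_parity p a) * ((- 1) ^ inversions n p b a :: 'k)"
    using inversions_swap[OF assms False] by (auto simp: koszul_def minus_one_power_iff)
  ultimately show ?thesis using False assms
    by (simp add: mult_coeff_eq even_coeff_commute[of n a b])
qed

text \<open>Expressing the sign through \<open>parity_twist\<close> lets \<open>f\<close> be
  inhomogeneous; only the factor that moves past it has a definite parity.\<close>

lemma fmult_commute:
  assumes f: "f \<in> superfuns n p" and g: "g \<in> fparity n p b"
  shows "fmult p f g = fmult p g (parity_twist p b f)"
proof -
  have 1: "fmult p (single k x) (single m y) = fmult p (single m y) (parity_twist p b (single k x))"
    if "m \<in> monoms n p" "monom_parity p m = b" "k \<in> monoms n p" for m k x y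
    unfolding parity_twist_single fmult_single mult_coeff_commute[OF that(3,1)]
    using that by (simp add: add.commute mult_ac)
  have 2: "fmult p f (single m y) = fmult p (single m y) (parity_twist p b f)"
    if "m \<in> monoms n p" "monom_parity p m = b" for m y
    by (rule additive_ext[of "\<lambda>f. fmult p f (single m y)"])
      (use f that in \<open>simp_all add: additive_def fmult_add_right fmult_add_left parity_twist_add superfuns_keys 1\<close>)
  show ?thesis
    by (rule additive_ext[of "\<lambda>g. fmult p f g"])
      (use g in \<open>auto simp: additive_def fmult_add_left fmult_add_right superfuns_keys fparity_def intro!: 2\<close>)
qed

section \<open>The Leibniz rule for the left derivatives\<close>

lemma choose_pascal:
  "(if x + y = 0 then 0 else x + y choose x) =
    (if x = 0 then 0 else x - 1 + y choose (x - 1)) + (if y = 0 then 0 else x + (y - 1) choose x)"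
  by (cases x; cases y) auto

text \<open>\<open>D\<close> is the coefficient of an even derivative. In characteristic 0 it is the
  exponent and additivity of exponents suffices. In characteristic p only the binomial at
  \<open>i\<close> changes, and the claim is Pascal's rule, with missing terms where an exponent is
  0.\<close>

lemma even_coeff_leibniz:
  assumes i: "i \<in> {1..n}"
  defines "D \<equiv> \<lambda>k. if k = 0 then 0 else if CHAR('k) = 0 then of_nat k else 1"
  shows "D (lookup a i + lookup b i) * even_coeff n a b =
    D (lookup a i) * even_coeff n (a - single i 1) b +
    D (lookup b i) * (even_coeff n a (b - single i 1) :: 'k::field)"
proof (cases "CHAR('k) = 0")
  case True
  thus ?thesis by (simp add: D_def even_coeff_def)
next
  case False
  define R :: 'k where "R = (\<Prod>j\<in>{1..n} - {i}. of_nat ((lookup a j + lookup b j) choose lookup a j))"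
  have R: "even_coeff n a' b' = of_nat ((lookup a' i + lookup b' i) choose lookup a' i) * R"
    if "\<And>j. j \<noteq> i \<Longrightarrow> lookup a' j = lookup a j" "\<And>j. j \<noteq> i \<Longrightarrow> lookup b' j = lookup b j" for a' b'
  proof -
    have "(\<Prod>j\<in>{1..n} - {i}. of_nat ((lookup a' j + lookup b' j) choose lookup a' j)) = R"
      unfolding R_def by (rule prod.cong) (simp_all add: that)
    thus ?thesis using i False by (simp add: even_coeff_def prod.remove)
  qed
  have D: "D k * of_nat m = of_nat (if k = 0 then 0 else m)" for k m
    using False by (simp add: D_def)
  have R1: "even_coeff n a b = of_nat (lookup a i + lookup b i choose lookup a i) * R"
    and R2: "even_coeff n (a - single i 1) b = of_nat (lookup a i - 1 + lookup b i choose (lookup a i - 1)) * R"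
    and R3: "even_coeff n a (b - single i 1) = of_nat (lookup a i + (lookup b i - 1) choose lookup a i) * R"
    by (subst R; simp add: lookup_minus lookup_single_if)+
  show ?thesis
    unfolding R1 R2 R3 mult.assoc[symmetric] D distrib_right[symmetric] of_nat_add[symmetric]
    by (subst choose_pascal) (rule refl)
qed

text \<open>Lowering an even exponent changes neither clashes nor inversions, so the sign is a
  common factor and only the rule for \<open>even_coeff\<close> remains.\<close>

lemma mult_coeff_leibniz_even:
  assumes a: "a \<in> monoms n p" and b: "b \<in> monoms n p" and i: "i \<in> {1..n}" "\<not> p i"
  shows "deriv_coeff p i (a + b) * mult_coeff p a b =
    deriv_coeff p i a * mult_coeff p (a - single i 1) b +
    deriv_coeff p i b * (mult_coeff p a (b - single i 1) :: 'k::field)"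
proof -
  have m: "a - single i 1 \<in> monoms n p" "b - single i 1 \<in> monoms n p"
    using a b by (auto simp: monoms_alt lookup_minus le_diff_conv)
  have "lookup (k - single i 1) j = lookup k j" if "p j" for k :: monom and j
    using i that by (auto simp: lookup_minus lookup_single_if)
  hence c: "clash p (a - single i 1) b = clash p a b" "clash p a (b - single i 1) = clash p a b"
    by (simp_all add: clash_def cong: conj_cong)
  have inv: "inversions n p (a - single i 1) b = inversions n p a b"
      "inversions n p a (b - single i 1) = inversions n p a b"
    unfolding inversions_def using i
    by (intro sum.cong refl; auto simp: lookup_minus lookup_single_if)+
  have e: "mult_coeff p (a - single i 1) b = (if clash p a b then 0 else (- 1) ^ inversions n p a b) *
        (even_coeff n (a - single i 1) b :: 'k)"
    "mult_coeff p a (b - single i 1) = (if clash p a b then 0 else (- 1) ^ inversions n p a b) *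
        (even_coeff n a (b - single i 1) :: 'k)"
    "mult_coeff p a b = (if clash p a b then 0 else (- 1) ^ inversions n p a b) * (even_coeff n a b :: 'k)"
    using a b m by (simp_all add: mult_coeff_eq c inv)
  have d: "deriv_coeff p i k = (if lookup k i = 0 then 0 else
      if CHAR('k) = 0 then of_nat (lookup k i) else (1::'k))" for k
    using i by (simp add: deriv_coeff_def)
  have E: "deriv_coeff p i (a + b) * even_coeff n a b =
    deriv_coeff p i a * even_coeff n (a - single i 1) b +
    deriv_coeff p i b * (even_coeff n a (b - single i 1) :: 'k)"
    using even_coeff_leibniz[OF i(1), of a b, where 'k = 'k] by (simp only: d lookup_add)
  have "x * (c * y) = u * (c * v) + r * (c * t)" if "x * y = u * v + r * t" for x y u v r t c :: 'k
  proof -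
    have "x * (c * y) = c * (x * y)" by (simp add: mult_ac)
    thus ?thesis unfolding that by (simp add: algebra_simps)
  qed
  thus ?thesis unfolding e by this (rule E)
qed

text \<open>Without a clash the exponents of the odd variable \<open>i\<close> add up to at most 1,
  so its binomial is 1 both with and without the additional factor.\<close>

lemma even_coeff_odd_single:
  assumes "p i" "a + single i 1 \<in> monoms n p" "b \<in> monoms n p" "\<not> clash p (a + single i 1) b"
  shows "even_coeff n (a + single i 1) b = (even_coeff n a b :: 'k::field)"
    and "even_coeff n b (a + single i 1) = (even_coeff n b a :: 'k)"
proof -
  have "lookup a i + 1 \<le> 1"
    using assms(1,2) unfolding monoms_alt by (metis lookup_add lookup_single_eq)
  moreover have "lookup a i + 1 + lookup b i \<le> 1"
    using assms(1,4) unfolding clash_def by (metis lookup_add lookup_single_eq not_less)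
  ultimately have z: "lookup a i = 0" "lookup b i = 0" by auto
  show "even_coeff n (a + single i 1) b = (even_coeff n a b :: 'k)"
    unfolding even_coeff_def using z
    by (auto intro!: prod.cong simp: lookup_add lookup_single_if)
  thus "even_coeff n b (a + single i 1) = (even_coeff n b a :: 'k)"
    by (simp add: even_coeff_commute)
qed

lemma clash_single_left:
  assumes "lookup b i = 0" "a + single i 1 \<in> monoms n p"
  shows "clash p (a + single i 1) b = clash p a b"
proof -
  have "lookup (a + single i 1) j + lookup b j > 1 \<longleftrightarrow> lookup a j + lookup b j > 1" if "p j" for j
    using assms that by (cases "j = i") (auto simp: monoms_alt lookup_add lookup_single_if)
  thus ?thesis unfolding clash_def by blast
qed

lemma clash_commute: "clash p a b = clash p b a"
  by (simp add: clash_def add.commute)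

text \<open>The odd rule is split according to which factors contain the variable \<open>i\<close>.
  Here only the left one does: the variables of \<open>b\<close> below \<open>i\<close> are passed
  once by the derivative and once in forming the product, so they cancel.\<close>

lemma mult_coeff_leibniz_odd_left:
  assumes a: "a + single i 1 \<in> monoms n p" and b: "b \<in> monoms n p" "lookup b i = 0"
    and i: "i \<in> {1..n}" "p i"
  shows "deriv_coeff p i (a + single i 1 + b) * mult_coeff p (a + single i 1) b =
    deriv_coeff p i (a + single i 1) * (mult_coeff p a b :: 'k::field)"
proof -
  have c: "clash p (a + single i 1) b = clash p a b" by (rule clash_single_left) (use a b in auto)
  have a': "a \<in> monoms n p" using a by (rule monoms_addD)
  show ?thesis
  proof (cases "clash p a b")
    case False
    hence ab: "a + single i 1 + b \<in> monoms n p" using a b c by (simp add: clash_monoms)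
    have "odd_below n p i (single i 1) = 0" by (simp add: odd_below_single)
    thus ?thesis
      using False a b c a' i ab even_coeff_odd_single(1)[OF i(2) a b(1), where 'k = 'k]
      by (simp add: mult_coeff_eq deriv_coeff_eq lookup_add inversions_add inversions_single
          odd_below_add power_add)
  qed (use a b a' c in \<open>simp add: mult_coeff_eq\<close>)
qed

text \<open>The odd variables of \<open>a\<close> below \<open>i\<close> are passed by the
  derivative and those above \<open>i\<close> in forming the product. Together they make up the
  parity of \<open>a\<close>, which is the Koszul sign.\<close>

lemma mult_coeff_leibniz_odd_right:
  assumes a: "a \<in> monoms n p" "lookup a i = 0" and b: "b + single i 1 \<in> monoms n p"
    and i: "i \<in> {1..n}" "p i"
  shows "deriv_coeff p i (a + (b + single i 1)) * mult_coeff p a (b + single i 1) =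
    koszul True (monom_parity p a) * deriv_coeff p i (b + single i 1) * (mult_coeff p a b :: 'k::field)"
proof -
  have c: "clash p a (b + single i 1) = clash p a b" "clash p (b + single i 1) a = clash p a b"
    using clash_single_left[of a i b n p] a b by (auto simp: clash_commute)
  have b': "b \<in> monoms n p" using b by (rule monoms_addD)
  show ?thesis
  proof (cases "clash p a b")
    case False
    hence ab: "a + (b + single i 1) \<in> monoms n p" using a b c by (simp add: clash_monoms)
    have "odd_below n p i (single i 1) = 0" by (simp add: odd_below_single)
    moreover have "koszul True (monom_parity p a) = ((- 1) ^ (odd_below n p i a + odd_above n p i a) :: 'k)"
      using monom_parity_split[OF a(1) i] a by (auto simp: koszul_def minus_one_power_iff)
    ultimately show ?thesis
      using False a b c b' i ab even_coeff_odd_single(2)[OF i(2) b a(1), where 'k = 'k]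
      by (simp add: mult_coeff_eq deriv_coeff_eq lookup_add inversions_add inversions_single
          odd_below_add power_add)
  qed (use a b b' c in \<open>simp add: mult_coeff_eq\<close>)
qed

text \<open>The product itself is 0, as an odd variable would be squared, so the two Leibniz terms
  must cancel. The minus sign comes from the variable \<open>i\<close> inside the left factor, which
  contributes to its parity.\<close>

lemma mult_coeff_leibniz_odd_both:
  assumes a: "a + single i 1 \<in> monoms n p" and b: "b + single i 1 \<in> monoms n p"
    and i: "i \<in> {1..n}" "p i"
  shows "deriv_coeff p i (a + single i 1) * mult_coeff p a (b + single i 1) +
    koszul True (monom_parity p (a + single i 1)) * deriv_coeff p i (b + single i 1) *
      (mult_coeff p (a + single i 1) b :: 'k::field) = 0"
proof -
  have m: "a \<in> monoms n p" "b \<in> monoms n p" using a b by (auto dest: monoms_addD)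
  have e: "a + (b + single i 1) = a + single i 1 + b" by (simp add: add_ac)
  have c: "clash p a (b + single i 1) \<longleftrightarrow> clash p (a + single i 1) b"
    using clash_monoms[OF m(1) b] clash_monoms[OF a m(2)] e by simp
  show ?thesis
  proof (cases "clash p (a + single i 1) b")
    case True
    thus ?thesis using c a b m by (simp add: mult_coeff_eq)
  next
    case False
    have 0: "odd_below n p i (single i 1) = 0" "odd_above n p i (single i 1) = 0"
      by (auto simp: odd_below_single odd_above_def lookup_single_if)
    have "lookup a i = 0" using a i by (auto simp: monoms_alt lookup_add lookup_single_if)
    hence "koszul True (monom_parity p (a + single i 1)) =
        (- ((- 1) ^ (odd_below n p i a + odd_above n p i a)) :: 'k)"
      using monom_parity_split[OF a i] 0
      by (auto simp: koszul_def minus_one_power_iff odd_below_add odd_above_add lookup_add)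
    moreover have "even_coeff n a (b + single i 1) = (even_coeff n (a + single i 1) b :: 'k)"
      using even_coeff_odd_single(2)[OF i(2) b m(1), where 'k = 'k]
        even_coeff_odd_single(1)[OF i(2) a m(2), where 'k = 'k]
        False c by (simp add: clash_commute)
    ultimately show ?thesis
      using False c a b m i 0
      by (simp add: mult_coeff_eq deriv_coeff_eq lookup_add inversions_add inversions_single
          odd_below_add power_add)
  qed
qed

lemma pderivative_fmult:
  assumes i: "i \<in> {1..n}" and f: "f \<in> superfuns n p" and g: "g \<in> superfuns n p"
  shows "pderivative p i (fmult p f g) =
    fmult p (pderivative p i f) g + fmult p (parity_twist p (p i) f) (pderivative p i g)"
proof -
  have 1: "pderivative p i (fmult p (single a x) (single b y)) =
    fmult p (pderivative p i (single a x)) (single b y) +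
    fmult p (parity_twist p (p i) (single a x)) (pderivative p i (single b y))"
    if a: "a \<in> monoms n p" and b: "b \<in> monoms n p" for a b and x y :: 'a
  proof -
    let ?s = "single i 1 :: monom"
    \<comment> \<open>Because of truncated subtraction the three exponents agree only where the
      factor being differentiated contains the variable \<open>i\<close>; elsewhere the coefficient
      is 0. Hence the cases on \<open>lookup a i\<close> and \<open>lookup b i\<close> come before
      the algebra of signs.\<close>
    have A: "single (a + b - ?s) (deriv_coeff p i (a + b) * mult_coeff p a b) =
      single (a - ?s + b) (deriv_coeff p i a * mult_coeff p (a - ?s) b) +
      single (a + (b - ?s)) (koszul (p i) (monom_parity p a) * deriv_coeff p i b * (mult_coeff p a (b - ?s) :: 'a))"
    proof (cases "lookup a i = 0")
      case a0: True
      show ?thesis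
      proof (cases "lookup b i = 0")
        case True
        thus ?thesis using a0 by (simp add: deriv_coeff_def lookup_add)
      next
        case False
        then obtain b' where b': "b = b' + ?s" by (rule monom_minus_single)
        have "deriv_coeff p i (a + b) * mult_coeff p a b =
            koszul (p i) (monom_parity p a) * deriv_coeff p i b * (mult_coeff p a (b - ?s) :: 'a)"
          using mult_coeff_leibniz_odd_right[of a n p i b', where 'k = 'a]
            mult_coeff_leibniz_even[OF a b i, where 'k = 'a] a b a0 b' i
          by (cases "p i") (auto simp: deriv_coeff_def[of p i a])
        moreover have "a + b - ?s = a + b'" by (simp add: b' add.assoc[symmetric])
        ultimately show ?thesis using a0 by (simp add: b' deriv_coeff_def[of p i a])
      qed
    next
      case False
      then obtain a' where a': "a = a' + ?s" by (rule monom_minus_single)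
      have "a + b = a' + b + ?s" by (simp add: a' add_ac)
      hence e: "a + b - ?s = a' + b" by simp
      show ?thesis
      proof (cases "lookup b i = 0")
        case True
        have "deriv_coeff p i (a + b) * mult_coeff p a b =
            deriv_coeff p i a * (mult_coeff p (a - ?s) b :: 'a)"
          using mult_coeff_leibniz_odd_left[of a' i n p b, where 'k = 'a]
            mult_coeff_leibniz_even[OF a b i, where 'k = 'a] a b True a' i
          by (cases "p i") (auto simp: deriv_coeff_def[of p i b])
        thus ?thesis using True e by (simp add: a' deriv_coeff_def[of p i b])
      next
        case False
        then obtain b' where b': "b = b' + ?s" by (rule monom_minus_single)
        have e': "a + b' = a' + b" unfolding a' b' by (simp only: add_ac)
        have "deriv_coeff p i (a + b) * mult_coeff p a b =
            deriv_coeff p i a * mult_coeff p (a - ?s) b +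
            koszul (p i) (monom_parity p a) * deriv_coeff p i b * (mult_coeff p a (b - ?s) :: 'a)"
        proof (cases "p i")
          case True
          have "mult_coeff p a b = (0::'a)"
            using True a b by (auto simp: mult_coeff_def a' b' lookup_add)
          thus ?thesis
            using mult_coeff_leibniz_odd_both[of a' i n p b', where 'k = 'a] a b i True a' b' by simp
        next
          case False
          thus ?thesis using mult_coeff_leibniz_even[OF a b i, where 'k = 'a] by simp
        qed
        moreover have "b - ?s = b'" "a - ?s = a'" by (simp_all add: a' b')
        ultimately show ?thesis using e e' by (simp add: single_add)
      qed
    qed
    have "fscale (x * y) (single (a + b - ?s) (deriv_coeff p i (a + b) * mult_coeff p a b)) =
      fscale (x * y) (single (a - ?s + b) (deriv_coeff p i a * mult_coeff p (a - ?s) b) +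
      single (a + (b - ?s)) (koszul (p i) (monom_parity p a) * deriv_coeff p i b * mult_coeff p a (b - ?s)))"
      by (subst A) (rule refl)
    thus ?thesis
      by (simp add: fmult_single pderivative_single parity_twist_single fscale_add mult_ac)
  qed
  have 2: "pderivative p i (fmult p (single a x) g) =
    fmult p (pderivative p i (single a x)) g +
    fmult p (parity_twist p (p i) (single a x)) (pderivative p i g)"
    if a: "a \<in> monoms n p" for a x
    by (rule additive_ext[of "\<lambda>g. pderivative p i (fmult p (single a x) g)"])
      (use g that in \<open>auto simp: additive_def fmult_add_right pderivative_add superfuns_keys intro!: 1\<close>)
  show ?thesis
    by (rule additive_ext[of "\<lambda>f. pderivative p i (fmult p f g)"])
      (use f in \<open>auto simp: additive_def fmult_add_left parity_twist_add pderivative_add superfuns_keys intro!: 2\<close>)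
qed

text \<open>For two different odd variables, removing the one with the smaller index changes the
  sign of the other derivative and not conversely.\<close>

lemma pderivative_commute:
  assumes f: "f \<in> superfuns n p"
  shows "pderivative p i (pderivative p j f) =
    fscale (koszul (p i) (p j)) (pderivative p j (pderivative p i f))"
proof (rule poly_mapping_eqI)
  fix m
  let ?si = "single i 1 :: monom" and ?sj = "single j 1 :: monom"
  have e: "m + ?sj + ?si = m + ?si + ?sj" by (simp add: add_ac)
  have "deriv_coeff p i (m + ?si) * (deriv_coeff p j (m + ?si + ?sj)) =
    koszul (p i) (p j) * (deriv_coeff p j (m + ?sj) * (deriv_coeff p i (m + ?si + ?sj) :: 'a))"
    if k: "m + ?si + ?sj \<in> monoms n p"
  \<comment> \<open>For an odd variable and \<open>i = j\<close> the exponent at \<open>i\<close>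
    would be at least 2, contradicting membership in \<open>monoms\<close>; for an even one both
    sides coincide.\<close>
  proof (cases "i = j")
    case True
    thus ?thesis using k by (auto simp: monoms_alt lookup_add koszul_def)
  next
    case False
    have ij: "i \<in> {1..n}" "j \<in> {1..n}"
      using k lookup_monom_0D[OF k, of i] lookup_monom_0D[OF k, of j]
      by (auto simp: lookup_add lookup_single_if)
    have mi: "m + ?si \<in> monoms n p" "m + ?sj \<in> monoms n p"
      using monoms_addD(1)[OF k] monoms_addD(1)[of "m + ?sj" ?si] e k by simp_all
    consider "i < j" | "j < i" using False by linarith
    thus ?thesis
      using False k ij mi
      by cases (auto simp: deriv_coeff_eq lookup_add lookup_single_if odd_below_add
        odd_below_single koszul_def power_add)
  qed
  moreover have "lookup f (m + ?si + ?sj) = 0" if "m + ?si + ?sj \<notin> monoms n p"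
    using that f by (auto simp: superfuns_keys Poly_Mapping.in_keys_iff)
  ultimately show "lookup (pderivative p i (pderivative p j f)) m =
    lookup (fscale (koszul (p i) (p j)) (pderivative p j (pderivative p i f))) m"
    by (cases "m + ?si + ?sj \<in> monoms n p") (auto simp: lookup_pderivative e mult.assoc[symmetric])
qed

section \<open>Homogeneous functions\<close>

lemma superfuns_add [intro]: "f \<in> superfuns n p \<Longrightarrow> g \<in> superfuns n p \<Longrightarrow> f + g \<in> superfuns n p"
  unfolding superfuns_def using Poly_Mapping.keys_add[of f g] by blast

lemma superfuns_zero [simp]: "0 \<in> superfuns n p"
  by (simp add: superfuns_def)

lemma superfuns_fscale [intro]: "f \<in> superfuns n p \<Longrightarrow> fscale c f \<in> superfuns n p"
  by (auto simp: superfuns_def Poly_Mapping.in_keys_iff)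

lemma superfuns_minus [intro]: "f \<in> superfuns n p \<Longrightarrow> - f \<in> superfuns n p" for f :: "'k::ab_group_add superfun"
  by (auto simp: superfuns_def Poly_Mapping.in_keys_iff)

lemma superfuns_diff [intro]:
  "f \<in> superfuns n p \<Longrightarrow> g \<in> superfuns n p \<Longrightarrow> f - g \<in> superfuns n p" for f :: "'k::ab_group_add superfun"
  using superfuns_add[of f n p "- g"] superfuns_minus[of g n p] by simp

lemma superfuns_sum [intro]: "(\<And>i. i \<in> A \<Longrightarrow> f i \<in> superfuns n p) \<Longrightarrow> sum f A \<in> superfuns n p"
  by (induct A rule: infinite_finite_induct) auto

lemma zero_in_monoms [simp]: "0 \<in> monoms n p"
  by (simp add: monoms_def)

lemma superfuns_fconst [simp]: "fconst c \<in> superfuns n p"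
  by (auto simp: superfuns_def fconst_def)

lemma superfuns_parity_twist [intro]: "f \<in> superfuns n p \<Longrightarrow> parity_twist p b f \<in> superfuns n p"
  by (auto simp: superfuns_def Poly_Mapping.in_keys_iff)

lemma superfuns_fmult [intro]:
  fixes f g :: "'k::field superfun"
  assumes "f \<in> superfuns n p" "g \<in> superfuns n p"
  shows "fmult p f g \<in> superfuns n p"
  unfolding superfuns_keys
proof
  fix k assume "k \<in> keys (fmult p f g)"
  then obtain a b where ab: "a \<in> keys f" "b \<in> keys g" "k = a + b" "mult_coeff p a b \<noteq> (0::'k)"
    by (rule keys_fmultD)
  hence "a \<in> monoms n p" "b \<in> monoms n p" using assms by (auto simp: superfuns_def)
  thus "k \<in> monoms n p" using ab by (auto simp: mult_coeff_eq clash_monoms split: if_splits)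
qed

lemma keys_pderivativeD: "k \<in> keys (pderivative p i f) \<Longrightarrow> k + single i 1 \<in> keys f"
  by (auto simp: Poly_Mapping.in_keys_iff lookup_pderivative)

lemma superfuns_pderivative [intro]: "f \<in> superfuns n p \<Longrightarrow> pderivative p i f \<in> superfuns n p"
  unfolding superfuns_keys by (metis keys_pderivativeD monoms_addD(1))

lemma fparity_superfuns: "f \<in> fparity n p a \<Longrightarrow> f \<in> superfuns n p"
  by (simp add: fparity_def)

lemma fparity_zero [simp]: "0 \<in> fparity n p a" and fgrade_zero [simp]: "0 \<in> fgrade n p w D"
  by (auto simp: fparity_def fgrade_def)

lemma fparity_add: "f \<in> fparity n p a \<Longrightarrow> g \<in> fparity n p a \<Longrightarrow> f + g \<in> fparity n p a"
  unfolding fparity_def using Poly_Mapping.keys_add[of f g] by blast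

lemma fgrade_add: "f \<in> fgrade n p w D \<Longrightarrow> g \<in> fgrade n p w D \<Longrightarrow> f + g \<in> fgrade n p w D"
  unfolding fgrade_def using Poly_Mapping.keys_add[of f g] by blast

lemma fparity_fscale: "f \<in> fparity n p a \<Longrightarrow> fscale c f \<in> fparity n p a"
  and fgrade_fscale: "f \<in> fgrade n p w D \<Longrightarrow> fscale c f \<in> fgrade n p w D"
  by (auto simp: fparity_def fgrade_def superfuns_def Poly_Mapping.in_keys_iff)

lemma fparity_minus: "f \<in> fparity n p a \<Longrightarrow> - f \<in> fparity n p a"
  and fgrade_minus: "f \<in> fgrade n p w D \<Longrightarrow> - f \<in> fgrade n p w D" for f :: "'k::ab_group_add superfun"
  by (auto simp: fparity_def fgrade_def superfuns_def Poly_Mapping.in_keys_iff)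

lemma fparity_diff: "f \<in> fparity n p a \<Longrightarrow> g \<in> fparity n p a \<Longrightarrow> f - g \<in> fparity n p a"
  and fgrade_diff: "f \<in> fgrade n p w D \<Longrightarrow> g \<in> fgrade n p w D \<Longrightarrow> f - g \<in> fgrade n p w D"
  for f :: "'k::ab_group_add superfun"
  using fparity_add[of f n p a "- g"] fgrade_add[of f n p w D "- g"]
    fparity_minus[of g] fgrade_minus[of g] by auto

lemma fparity_sum: "(\<And>i. i \<in> A \<Longrightarrow> f i \<in> fparity n p a) \<Longrightarrow> sum f A \<in> fparity n p a"
  by (induct A rule: infinite_finite_induct) (auto intro: fparity_add)

lemma fgrade_sum: "(\<And>i. i \<in> A \<Longrightarrow> f i \<in> fgrade n p w D) \<Longrightarrow> sum f A \<in> fgrade n p w D"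
  by (induct A rule: infinite_finite_induct) (auto intro: fgrade_add)

lemma fparity_fmult:
  fixes f g :: "'k::field superfun"
  assumes "f \<in> fparity n p a" "g \<in> fparity n p b"
  shows "fmult p f g \<in> fparity n p (a \<noteq> b)"
proof -
  have "monom_parity p k = (a \<noteq> b)" if "k \<in> keys (fmult p f g)" for k
    by (rule keys_fmultD[OF that]) (use assms in \<open>simp add: fparity_def monom_parity_add\<close>)
  thus ?thesis using assms by (auto simp: fparity_def)
qed

lemma fgrade_fmult:
  fixes f g :: "'k::field superfun"
  assumes "f \<in> fgrade n p w D" "g \<in> fgrade n p w E"
  shows "fmult p f g \<in> fgrade n p w (D + E)"
proof -
  have "int (monom_degree w k) = D + E" if "k \<in> keys (fmult p f g)" for k
    by (rule keys_fmultD[OF that]) (use assms in \<open>simp add: fgrade_def monom_degree_add\<close>)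
  thus ?thesis using assms by (auto simp: fgrade_def)
qed

lemma fparity_pderivative:
  assumes "f \<in> fparity n p a" shows "pderivative p i f \<in> fparity n p (a \<noteq> p i)"
proof -
  have "monom_parity p k = (a \<noteq> p i)" if "k \<in> keys (pderivative p i f)" for k
    using keys_pderivativeD[OF that] assms by (simp add: fparity_def) (metis monom_parity_add monom_parity_single)
  thus ?thesis using assms by (auto simp: fparity_def)
qed

lemma fgrade_pderivative:
  assumes "f \<in> fgrade n p w D" shows "pderivative p i f \<in> fgrade n p w (D - int (w i))"
proof -
  have "int (monom_degree w k) = D - int (w i)" if "k \<in> keys (pderivative p i f)" for k
    using keys_pderivativeD[OF that] assms monom_degree_add[of w k "single i 1"] by (auto simp: fgrade_def)
  thus ?thesis using assms by (auto simp: fgrade_def)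
qed

text \<open>The source of the vanishing arguments by degree below: exponents have no negative
  degree.\<close>

lemma fgrade_negative: "f \<in> fgrade n p w D \<Longrightarrow> D < 0 \<Longrightarrow> f = 0"
  by (rule poly_mapping_eqI) (fastforce simp: fgrade_def Poly_Mapping.in_keys_iff)

lemma fconst_fparity: "fconst c \<in> fparity n p False"
  and fconst_fgrade: "fconst c \<in> fgrade n p w 0"
  by (auto simp: fparity_def fgrade_def fconst_def superfuns_def)

lemma fconst_eq_0 [simp]: "fconst c = 0 \<longleftrightarrow> c = 0"
  by (metis fconst_def lookup_single_eq lookup_zero single_zero)

lemma fconst_zero [simp]: "fconst 0 = 0" by simp

lemma fscale_fconst [simp]: "fscale c (fconst x) = fconst (c * x)"
  by (simp add: fconst_def)

lemma pderivative_fconst [simp]: "pderivative p i (fconst c) = 0"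
  by (simp add: fconst_def pderivative_single deriv_coeff_def)

lemma mult_coeff_zero:
  assumes "a \<in> monoms n p"
  shows "mult_coeff p a 0 = (1::'k::field)" "mult_coeff p 0 a = (1::'k)"
proof -
  have "\<not> clash p a 0" "\<not> clash p 0 a" using assms by (auto simp: clash_def monoms_alt not_less)
  thus "mult_coeff p a 0 = (1::'k)" "mult_coeff p 0 a = (1::'k)"
    using assms inversions_add(1)[of n p 0 0 a] inversions_add(2)[of n p a 0 0]
    by (simp_all add: mult_coeff_eq[of _ n] even_coeff_def)
qed

lemma fmult_fconst_right: "f \<in> superfuns n p \<Longrightarrow> fmult p f (fconst c) = fscale c f"
  by (rule additive_ext[of "\<lambda>f. fmult p f (fconst c)"])
    (auto simp: additive_def fmult_add_left fscale_add fconst_def fmult_single superfuns_keys mult_coeff_zero[of _ n] mult.commute)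

lemma fmult_fconst_left: "f \<in> superfuns n p \<Longrightarrow> fmult p (fconst c) f = fscale c f"
  by (rule additive_ext[of "\<lambda>f. fmult p (fconst c) f"])
    (auto simp: additive_def fmult_add_right fscale_add fconst_def fmult_single superfuns_keys mult_coeff_zero[of _ n] mult.commute)

lemma monom_add_eq_0: "a + b = 0 \<longleftrightarrow> a = 0 \<and> b = 0" for a b :: monom
  unfolding poly_mapping_eq_iff fun_eq_iff lookup_add lookup_zero by auto

lemma lookup_fmult_0:
  fixes f g :: "'k::field superfun"
  shows "lookup (fmult p f g) 0 = lookup f 0 * lookup g 0"
proof -
  have "mult_coeff p 0 0 = (1::'k)" by (rule mult_coeff_zero) (rule zero_in_monoms)
  hence "lookup (single (a + b) (mult_coeff p a b * lookup f a * lookup g b)) 0 =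
      (if a = 0 then if b = 0 then lookup f 0 * lookup g 0 else 0 else 0)" for a b
    by (simp add: lookup_single_if monom_add_eq_0)
  hence "lookup (fmult p f g) 0 = (\<Sum>a\<in>keys f. \<Sum>b\<in>keys g.
      if a = 0 then if b = 0 then lookup f 0 * lookup g 0 else 0 else 0)"
    by (simp add: fmult_def Poly_Mapping.lookup_sum)
  also have "\<dots> = (\<Sum>a\<in>keys f. if a = 0 then (\<Sum>b\<in>keys g.
      if b = 0 then lookup f 0 * lookup g 0 else 0) else 0)"
    by (rule sum.cong) simp_all
  also have "\<dots> = lookup f 0 * lookup g 0"
    by (simp add: Poly_Mapping.in_keys_iff)
  finally show ?thesis .
qed

lemma parity_twist_twist: "parity_twist p a (parity_twist p b f) = parity_twist p (a \<noteq> b) f"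
  by (rule poly_mapping_eqI) (auto simp: koszul_def)

text \<open>Off-diagonal terms occur in equal pairs, and such a pair is 0. This replaces
  cancellation by signs, both for the square of an odd function and for the second-order part of the
  square of an odd field.\<close>

lemma sum_symmetric_char_2:
  fixes t :: "'i \<Rightarrow> 'i \<Rightarrow> 'a::ab_group_add"
  assumes "finite A" "\<And>x::'a. x + x = 0" "\<And>i j. i \<in> A \<Longrightarrow> j \<in> A \<Longrightarrow> t i j = t j i" "\<And>i. i \<in> A \<Longrightarrow> t i i = 0"
  shows "(\<Sum>i\<in>A. \<Sum>j\<in>A. t i j) = 0"
  using assms(1,3,4)
proof (induct A rule: finite_induct)
  case (insert x F)
  have "(\<Sum>j\<in>F. t x j) = (\<Sum>i\<in>F. t i x)" by (rule sum.cong) (auto intro: insert)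
  hence "(\<Sum>i\<in>insert x F. \<Sum>j\<in>insert x F. t i j) =
      t x x + ((\<Sum>i\<in>F. t i x) + (\<Sum>i\<in>F. t i x)) + (\<Sum>i\<in>F. \<Sum>j\<in>F. t i j)"
    using insert(1,2) by (simp add: sum.distrib algebra_simps)
  thus ?case using insert assms(2) by simp
qed simp

lemma superfun_char_2:
  assumes "CHAR('k::field) = 2"
  shows "f + f = (0 :: 'a \<Rightarrow>\<^sub>0 'k)"
proof (rule poly_mapping_eqI)
  fix m
  have "lookup f m + lookup f m = lookup f m + - lookup f m"
    by (simp only: uminus_CHAR_2[OF assms])
  thus "lookup (f + f) m = lookup 0 m" by (simp add: lookup_add)
qed


section \<open>Vector fields\<close>

abbreviation vpart :: "nat \<Rightarrow> (nat \<Rightarrow> bool) \<Rightarrow> bool \<Rightarrow> 'k::field vfield set" where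
  "vpart n p \<equiv> lsa_part (vect n p)"

lemma vpart_iff: "X \<in> vpart n p a \<longleftrightarrow> X \<in> vfields n p \<and> (\<forall>i. lookup X i \<in> fparity n p (a \<noteq> p i))"
  by (auto simp: vect_def fparity_def vfields_def)

lemma vgrade_iff: "X \<in> vgrade n p w k \<longleftrightarrow> X \<in> vfields n p \<and> (\<forall>i. lookup X i \<in> fgrade n p w (k + int (w i)))"
  by (fastforce simp: vgrade_def fgrade_def vfields_def)

lemma vfields_iff: "X \<in> vfields n p \<longleftrightarrow>
    (\<forall>i. i \<notin> {1..n} \<longrightarrow> lookup X i = 0) \<and> (\<forall>i. lookup X i \<in> superfuns n p)"
  by (auto simp: vfields_def Poly_Mapping.in_keys_iff)

lemma vpart_vfields: "X \<in> vpart n p a \<Longrightarrow> X \<in> vfields n p"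
  by (simp add: vpart_iff)

lemma vgrade_vfields: "X \<in> vgrade n p w k \<Longrightarrow> X \<in> vfields n p"
  by (simp add: vgrade_iff)

lemma vfields_lookup: "X \<in> vfields n p \<Longrightarrow> lookup X i \<in> superfuns n p"
  by (simp add: vfields_iff)

lemma vpart_lookup: "X \<in> vpart n p a \<Longrightarrow> lookup X i \<in> fparity n p (a \<noteq> p i)"
  by (simp add: vpart_iff)

lemma vgrade_lookup: "X \<in> vgrade n p w k \<Longrightarrow> lookup X i \<in> fgrade n p w (k + int (w i))"
  by (simp add: vgrade_iff)

lemma lookup_vscale [simp]: "lookup (vscale c X) i = fscale c (lookup X i)"
  by (simp add: vscale_def lookup_map_zero)

lemma lookup_fsmult [simp]: "lookup (fsmult p f X) i = fmult p f (lookup X i)"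
  by (simp add: fsmult_def lookup_map_zero)

lemma vact_zero [simp]: "vact p X 0 = 0"
  by (simp add: vact_def)

lemma lookup_vcomp [simp]: "lookup (vcomp p X Y) i = vact p X (lookup Y i)"
  by (simp add: vcomp_def lookup_map_zero)

lemma lookup_vparity_part:
  "lookup (lookup (vparity_part p a X) i) m =
    (if (monom_parity p m \<noteq> p i) = a then lookup (lookup X i) m else 0)"
proof -
  have "lookup (lookup (vparity_part p a X) i) m =
      (\<Sum>j\<in>keys X. \<Sum>k | k \<in> keys (lookup X j) \<and> (monom_parity p k \<noteq> p j) = a.
        if j = i then if k = m then lookup (lookup X i) m else 0 else 0)"
    unfolding vparity_part_def Poly_Mapping.lookup_sum
    by (intro sum.cong refl) (simp add: lookup_single_if)
  also have "\<dots> = (\<Sum>j\<in>keys X. if j = i then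
      (\<Sum>k | k \<in> keys (lookup X i) \<and> (monom_parity p k \<noteq> p i) = a.
        if k = m then lookup (lookup X i) m else 0) else 0)"
    by (intro sum.cong) simp_all
  also have "\<dots> = (if (monom_parity p m \<noteq> p i) = a then lookup (lookup X i) m else 0)"
    by (auto simp: Poly_Mapping.in_keys_iff)
  finally show ?thesis .
qed

section \<open>Parity components of a field\<close>

lemma vparity_part_add: "vparity_part p a (X + Y) = vparity_part p a X + vparity_part p a Y"
  by (intro poly_mapping_eqI) (simp add: lookup_vparity_part lookup_add)

lemma vparity_part_vscale: "vparity_part p a (vscale c X) = vscale c (vparity_part p a X)"
  by (intro poly_mapping_eqI) (simp add: lookup_vparity_part)

lemma vparity_part_sum: "X = vparity_part p False X + vparity_part p True X"
  by (intro poly_mapping_eqI) (simp add: lookup_vparity_part lookup_add)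

lemma vparity_part_homogeneous:
  assumes "X \<in> vpart n p a"
  shows "vparity_part p b X = (if a = b then X else 0)"
proof (intro poly_mapping_eqI)
  fix i m
  have "m \<in> keys (lookup X i) \<Longrightarrow> (monom_parity p m \<noteq> p i) = a"
    using assms by (auto simp: vpart_iff fparity_def)
  thus "lookup (lookup (vparity_part p b X) i) m = lookup (lookup (if a = b then X else 0) i) m"
    by (auto simp: lookup_vparity_part Poly_Mapping.in_keys_iff)
qed

lemma vparity_part_in:
  assumes "X \<in> vfields n p" shows "vparity_part p a X \<in> vpart n p a"
proof -
  have "keys (lookup (vparity_part p a X) i) \<subseteq>
      {m \<in> keys (lookup X i). (monom_parity p m \<noteq> p i) = a}" for i
    by (auto simp: Poly_Mapping.in_keys_iff lookup_vparity_part split: if_splits)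
  moreover have "lookup (vparity_part p a X) i = 0" if "i \<notin> {1..n}" for i
    using assms that by (intro poly_mapping_eqI) (simp add: lookup_vparity_part vfields_iff)
  ultimately show ?thesis using assms
    unfolding vpart_iff vfields_iff fparity_def superfuns_def by blast
qed

section \<open>Action of fields on functions\<close>

lemma vact_expand:
  assumes "finite A" "keys X \<subseteq> A"
  shows "vact p X f = (\<Sum>i\<in>A. fmult p (lookup X i) (pderivative p i f))"
  unfolding vact_def using assms
  by (intro sum.mono_neutral_left) (auto simp: Poly_Mapping.in_keys_iff)

lemma vact_eq: "X \<in> vfields n p \<Longrightarrow> vact p X f = (\<Sum>i\<in>{1..n}. fmult p (lookup X i) (pderivative p i f))"
  by (rule vact_expand) (auto simp: vfields_def)

lemma vact_add_left: "vact p (X + Y) f = vact p X f + vact p Y f"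
proof -
  have "keys (X + Y) \<subseteq> keys X \<union> keys Y" by (rule Poly_Mapping.keys_add)
  thus ?thesis
    by (simp add: vact_expand[where A = "keys X \<union> keys Y"] lookup_add fmult_add_left sum.distrib)
qed

lemma vact_add_right: "vact p X (f + g) = vact p X f + vact p X g"
  by (simp add: vact_def pderivative_add fmult_add_right sum.distrib)

lemma additive_vact_left: "additive (\<lambda>X. vact p X f)"
  and additive_vact_right: "additive (vact p X)"
  by (unfold_locales; simp add: vact_add_left vact_add_right)+

lemmas vact_zero_left [simp] = additive.zero[OF additive_vact_left]
  and vact_diff_left = additive.diff[OF additive_vact_left]
  and vact_diff_right = additive.diff[OF additive_vact_right]
  and vact_sum_left = additive.sum[OF additive_vact_left]
  and vact_sum_right = additive.sum[OF additive_vact_right]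

lemma vact_vscale: "vact p (vscale c X) f = fscale c (vact p X f)"
proof -
  have "keys (vscale c X) \<subseteq> keys X" by (auto simp: Poly_Mapping.in_keys_iff)
  thus ?thesis
    by (simp add: vact_expand[where A = "keys X"] fmult_fscale_left fscale_sum)
qed

lemma vact_fscale: "vact p X (fscale c f) = fscale c (vact p X f)"
  by (simp add: vact_def pderivative_fscale fmult_fscale_right fscale_sum)

lemma vact_fconst [simp]: "vact p X (fconst c) = 0"
  by (simp add: vact_def)

lemma vact_superfuns [intro]: "X \<in> vfields n p \<Longrightarrow> f \<in> superfuns n p \<Longrightarrow> vact p X f \<in> superfuns n p"
  unfolding vact_eq by (intro superfuns_sum superfuns_fmult superfuns_pderivative vfields_lookup)

lemma vact_fparity:
  assumes "X \<in> vpart n p a" "f \<in> fparity n p b"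
  shows "vact p X f \<in> fparity n p (a \<noteq> b)"
proof -
  have "fmult p (lookup X i) (pderivative p i f) \<in> fparity n p (a \<noteq> b)" for i
    using fparity_fmult[OF vpart_lookup[OF assms(1)] fparity_pderivative[OF assms(2)], of i i]
    by (cases "p i") auto
  thus ?thesis by (simp add: vact_def fparity_sum)
qed

lemma vact_fgrade:
  assumes "X \<in> vgrade n p w k" "f \<in> fgrade n p w D"
  shows "vact p X f \<in> fgrade n p w (k + D)"
proof -
  have "fmult p (lookup X i) (pderivative p i f) \<in> fgrade n p w (k + D)" for i
    using fgrade_fmult[OF vgrade_lookup[OF assms(1)] fgrade_pderivative[OF assms(2)], of i i]
    by simp
  thus ?thesis by (simp add: vact_def fgrade_sum)
qed

lemma pderivative_coordinate:
  "pderivative p i (single (single k 1) 1) = fconst (if i = k then 1 else 0 :: 'k::field)"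
proof -
  have e: "{j \<in> keys (single k 1 :: monom). p j \<and> j < k} = {}" by auto
  have "deriv_coeff p k (single k 1) = (1::'k)" unfolding deriv_coeff_def e by simp
  moreover have "i \<noteq> k \<Longrightarrow> deriv_coeff p i (single k 1) = (0::'k)"
    by (simp add: deriv_coeff_def lookup_single_if)
  ultimately show ?thesis
    by (auto simp: pderivative_single fconst_def)
qed

lemma coordinate_superfuns [simp]: "k \<in> {1..n} \<Longrightarrow> single (single k 1) 1 \<in> superfuns n p"
  by (auto simp: superfuns_def monoms_alt lookup_single_if)

lemma vact_coordinate:
  assumes "X \<in> vfields n p" "k \<in> {1..n}"
  shows "vact p X (single (single k 1) 1) = lookup X k"
proof -
  have "vact p X (single (single k 1) 1) = (\<Sum>i\<in>{1..n}. if i = k then lookup X i else 0)"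
    unfolding vact_eq[OF assms(1)]
    by (intro sum.cong refl)
      (simp add: pderivative_coordinate fmult_fconst_right[OF vfields_lookup[OF assms(1)]])
  thus ?thesis using assms by simp
qed

text \<open>The action is faithful because the coordinates recover the components. Identities
  between brackets are transferred from operators on functions through this lemma.\<close>

lemma vfield_eqI:
  assumes "X \<in> vfields n p" "Y \<in> vfields n p"
    and "\<And>f. f \<in> superfuns n p \<Longrightarrow> vact p X f = vact p Y f"
  shows "X = Y"
proof (rule poly_mapping_eqI)
  fix k show "lookup X k = lookup Y k"
  proof (cases "k \<in> {1..n}")
    case True
    thus ?thesis using assms(3)[OF coordinate_superfuns[OF True]]
      vact_coordinate[OF assms(1) True] vact_coordinate[OF assms(2) True] by simp
  qed (use assms in \<open>simp add: vfields_iff\<close>)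
qed

lemma vact_fmult:
  assumes X: "X \<in> vpart n p a" and f: "f \<in> superfuns n p" and g: "g \<in> superfuns n p"
  shows "vact p X (fmult p f g) = fmult p (vact p X f) g + fmult p (parity_twist p a f) (vact p X g)"
proof -
  have Xv: "X \<in> vfields n p" using X by (rule vpart_vfields)
  note Xl = vfields_lookup[OF Xv]
  have "fmult p (lookup X i) (pderivative p i (fmult p f g)) =
      fmult p (fmult p (lookup X i) (pderivative p i f)) g +
      fmult p (parity_twist p a f) (fmult p (lookup X i) (pderivative p i g))"
    if i: "i \<in> {1..n}" for i
  proof -
    \<comment> \<open>The component at \<open>i\<close> has parity \<open>a \<noteq> p i\<close>;
      moving \<open>f\<close> past it turns the twist by \<open>p i\<close>, left over from the
      derivative, into the twist by \<open>a\<close>.\<close>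
    have "fmult p (lookup X i) (parity_twist p (p i) f) = fmult p (parity_twist p a f) (lookup X i)"
      using fmult_commute[OF superfuns_parity_twist[OF f] vpart_lookup[OF X], of a i]
      by (simp add: parity_twist_twist) (cases a; simp)
    moreover have "fmult p (lookup X i) (fmult p (parity_twist p (p i) f) (pderivative p i g)) =
        fmult p (fmult p (lookup X i) (parity_twist p (p i) f)) (pderivative p i g)"
      by (rule fmult_assoc[symmetric]) (use f g Xl in auto)
    moreover have "fmult p (parity_twist p a f) (fmult p (lookup X i) (pderivative p i g)) =
        fmult p (fmult p (parity_twist p a f) (lookup X i)) (pderivative p i g)"
      by (rule fmult_assoc[symmetric]) (use f g Xl in auto)
    moreover have "fmult p (fmult p (lookup X i) (pderivative p i f)) g =
        fmult p (lookup X i) (fmult p (pderivative p i f) g)"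
      by (rule fmult_assoc) (use f g Xl in auto)
    ultimately show ?thesis by (simp add: pderivative_fmult[OF i f g] fmult_add_right)
  qed
  thus ?thesis by (simp add: vact_eq[OF Xv] sum.distrib fmult_sum_left fmult_sum_right)
qed

lemma vact_fsmult:
  assumes "X \<in> vfields n p" "f \<in> superfuns n p" "g \<in> superfuns n p"
  shows "vact p (fsmult p f X) g = fmult p f (vact p X g)"
proof -
  have "keys (fsmult p f X) \<subseteq> {1..n}" using assms by (auto simp: vfields_iff Poly_Mapping.in_keys_iff)
  thus ?thesis using assms
    by (auto simp: vact_expand[where A = "{1..n}" and X = "fsmult p f X"] vact_eq fmult_sum_right
        vfields_lookup intro!: sum.cong fmult_assoc)
qed

text \<open>The double sum is the second-order part of the composition.\<close>

lemma vact_vact: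
  assumes A: "A \<in> vpart n p a" and B: "B \<in> vpart n p b" and f: "f \<in> superfuns n p"
  shows "vact p A (vact p B f) = vact p (vcomp p A B) f +
    (\<Sum>j\<in>{1..n}. \<Sum>i\<in>{1..n}. fscale (koszul a (b \<noteq> p j))
      (fmult p (fmult p (lookup B j) (lookup A i)) (pderivative p i (pderivative p j f))))"
proof -
  have Av: "A \<in> vfields n p" and Bv: "B \<in> vfields n p" using A B by (auto intro: vpart_vfields)
  have k: "keys (vcomp p A B) \<subseteq> {1..n}" using Bv by (auto simp: vfields_iff Poly_Mapping.in_keys_iff)
  have "vact p A (fmult p (lookup B j) (pderivative p j f)) =
      fmult p (vact p A (lookup B j)) (pderivative p j f) +
      (\<Sum>i\<in>{1..n}. fscale (koszul a (b \<noteq> p j))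
        (fmult p (fmult p (lookup B j) (lookup A i)) (pderivative p i (pderivative p j f))))" for j
  proof -
    have "fmult p (fmult p (lookup B j) (lookup A i)) (pderivative p i (pderivative p j f)) =
        fmult p (lookup B j) (fmult p (lookup A i) (pderivative p i (pderivative p j f)))" for i
      by (rule fmult_assoc) (use Av Bv f in \<open>auto simp: vfields_lookup\<close>)
    moreover have "vact p A (fmult p (lookup B j) (pderivative p j f)) =
        fmult p (vact p A (lookup B j)) (pderivative p j f) +
        fmult p (parity_twist p a (lookup B j)) (vact p A (pderivative p j f))"
      by (rule vact_fmult[OF A]) (use Bv f in \<open>auto simp: vfields_lookup\<close>)
    ultimately show ?thesis
      by (simp add: vact_eq[OF Av, of "pderivative p j f"] parity_twist_fparity[OF vpart_lookup[OF B]]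
          fmult_fscale_left fmult_sum_right fscale_sum)
  qed
  thus ?thesis
    by (simp add: vact_eq[OF Bv, of f] vact_expand[OF _ k] vact_sum_right sum.distrib)
qed

text \<open>Interchanging the two coefficients and interchanging the two derivatives both produce
  signs; with those of the double sum in \<open>vact_vact\<close> they combine to
  \<open>koszul a b\<close>. So the second-order parts of the two compositions cancel in the
  supercommutator.\<close>

lemma vact_vcomp_commutator:
  assumes A: "A \<in> vpart n p a" and B: "B \<in> vpart n p b" and f: "f \<in> superfuns n p"
  shows "vact p (vcomp p A B - vscale (koszul a b) (vcomp p B A)) f =
    vact p A (vact p B f) - fscale (koszul a b) (vact p B (vact p A f))"
proof -
  have "(\<Sum>j\<in>{1..n}. \<Sum>i\<in>{1..n}. fscale (koszul a (b \<noteq> p j))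
      (fmult p (fmult p (lookup B j) (lookup A i)) (pderivative p i (pderivative p j f)))) =
    fscale (koszul a b) (\<Sum>i\<in>{1..n}. \<Sum>j\<in>{1..n}. fscale (koszul b (a \<noteq> p i))
      (fmult p (fmult p (lookup A i) (lookup B j)) (pderivative p j (pderivative p i f))))"
    unfolding fscale_sum
  proof (subst sum.swap, intro sum.cong refl)
    fix i j
    have "fmult p (lookup A i) (lookup B j) =
        fscale (koszul (b \<noteq> p j) (a \<noteq> p i)) (fmult p (lookup B j) (lookup A i))"
      using fmult_commute[OF fparity_superfuns[OF vpart_lookup[OF A]] vpart_lookup[OF B], of i j]
      by (simp add: parity_twist_fparity[OF vpart_lookup[OF A]] fmult_fscale_right)
    thus "fscale (koszul a (b \<noteq> p j))
      (fmult p (fmult p (lookup B j) (lookup A i)) (pderivative p i (pderivative p j f))) =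
      fscale (koszul a b) (fscale (koszul b (a \<noteq> p i))
      (fmult p (fmult p (lookup A i) (lookup B j)) (pderivative p j (pderivative p i f))))"
      by (subst (2) pderivative_commute[OF f])
        (auto simp: fmult_fscale_left fmult_fscale_right koszul_def)
  qed
  thus ?thesis
    by (simp add: vact_vact[OF A B f] vact_vact[OF B A f] vact_diff_left vact_vscale fscale_add)
qed


interpretation vs: vector_space "vscale :: 'k::field \<Rightarrow> 'k vfield \<Rightarrow> 'k vfield"
  by (rule vector_space_vscale)

text \<open>Anticommutativity says nothing here. The off-diagonal terms cancel in pairs, and a
  diagonal term squares an odd monomial, which contains an odd variable.\<close>

lemma fmult_self_odd_char_2:
  fixes f :: "'k::field superfun"
  assumes c: "CHAR('k) = 2" and f: "f \<in> fparity n p True"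
  shows "fmult p f f = 0"
  unfolding fmult_def
proof (rule sum_symmetric_char_2)
  fix a b assume ab: "a \<in> keys f" "b \<in> keys f"
  hence m: "a \<in> monoms n p" "b \<in> monoms n p" using f by (auto simp: fparity_def superfuns_def)
  have "mult_coeff p a b = (mult_coeff p b a :: 'k)"
    using mult_coeff_commute[OF m, where 'k = 'k] by (simp add: koszul_char_2[OF c])
  thus "single (a + b) (mult_coeff p a b * lookup f a * lookup f b) =
      single (b + a) (mult_coeff p b a * lookup f b * lookup f a)"
    by (simp add: add.commute mult_ac)
next
  fix a assume a: "a \<in> keys f"
  hence "monom_parity p a" using f by (auto simp: fparity_def)
  then obtain i where i: "i \<in> keys a" "p i"
    unfolding monom_parity_def by (metis (mono_tags, lifting) even_zero mem_Collect_eq sum.neutral)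
  hence "\<exists>i. p i \<and> lookup a i + lookup a i > 1"
    by (intro exI[of _ i]) (auto simp: Poly_Mapping.in_keys_iff)
  thus "single (a + a) (mult_coeff p a a * lookup f a * lookup f a) = 0"
    by (simp add: mult_coeff_def)
qed (simp_all add: superfun_char_2[OF c])

lemma pderivative_odd_twice:
  assumes f: "f \<in> superfuns n p" and "p i"
  shows "pderivative p i (pderivative p i f) = 0"
proof (rule poly_mapping_eqI)
  fix m
  have "m + single i 1 + single i 1 \<notin> monoms n p"
    using assms(2) by (auto simp: monoms_alt lookup_add)
  hence "lookup f (m + single i 1 + single i 1) = 0"
    using f by (auto simp: superfuns_def Poly_Mapping.in_keys_iff)
  thus "lookup (pderivative p i (pderivative p i f)) m = lookup 0 m"
    by (simp add: lookup_pderivative)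
qed

text \<open>The second-order part of the square vanishes: off-diagonal terms pair up, the second
  derivative in an odd variable is 0, and at an even variable the component of the odd field is an
  odd function, whose square is 0.\<close>

lemma vact_square_char_2:
  fixes A :: "'k::field vfield"
  assumes c: "CHAR('k) = 2" and A: "A \<in> vpart n p True" and f: "f \<in> superfuns n p"
  shows "vact p (vcomp p A A) f = vact p A (vact p A f)"
proof -
  have "(\<Sum>j\<in>{1..n}. \<Sum>i\<in>{1..n}. fscale (koszul True (True \<noteq> p j))
      (fmult p (fmult p (lookup A j) (lookup A i)) (pderivative p i (pderivative p j f)))) = 0"
  proof (rule sum_symmetric_char_2)
    fix i j
    have "fmult p (lookup A i) (lookup A j) = fmult p (lookup A j) (lookup A i)"
      using fmult_commute[OF fparity_superfuns[OF vpart_lookup[OF A]] vpart_lookup[OF A], of i j]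
      by (simp add: parity_twist_fparity[OF vpart_lookup[OF A]] koszul_char_2[OF c])
    moreover have "pderivative p i (pderivative p j f) = pderivative p j (pderivative p i f)"
      using pderivative_commute[OF f] by (simp add: koszul_char_2[OF c])
    ultimately show "fscale (koszul True (True \<noteq> p j))
        (fmult p (fmult p (lookup A j) (lookup A i)) (pderivative p i (pderivative p j f))) =
      fscale (koszul True (True \<noteq> p i))
        (fmult p (fmult p (lookup A i) (lookup A j)) (pderivative p j (pderivative p i f)))"
      by (simp add: koszul_char_2[OF c])
  next
    fix i
    show "fscale (koszul True (True \<noteq> p i))
        (fmult p (fmult p (lookup A i) (lookup A i)) (pderivative p i (pderivative p i f))) = 0"
    proof (cases "p i")
      case True
      thus ?thesis using pderivative_odd_twice[OF f True] by simp
    next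
      case False
      thus ?thesis using fmult_self_odd_char_2[OF c] vpart_lookup[OF A, of i] by simp
    qed
  qed (simp_all add: superfun_char_2[OF c])
  thus ?thesis using vact_vact[OF A A f] by simp
qed

section \<open>Composition and bracket\<close>

lemma vcomp_add_left: "vcomp p (X + X') Y = vcomp p X Y + vcomp p X' Y"
  and vcomp_add_right: "vcomp p X (Y + Y') = vcomp p X Y + vcomp p X Y'"
  and vcomp_vscale_left: "vcomp p (vscale c X) Y = vscale c (vcomp p X Y)"
  and vcomp_vscale_right: "vcomp p X (vscale c Y) = vscale c (vcomp p X Y)"
  by (intro poly_mapping_eqI;
      simp add: lookup_add vact_add_left vact_add_right vact_vscale vact_fscale)+

lemma vcomp_zero [simp]: "vcomp p 0 Y = 0" "vcomp p X 0 = 0"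
  by (intro poly_mapping_eqI; simp)+

lemma vbracket_add_left: "vbracket p (X + X') Y = vbracket p X Y + vbracket p X' Y"
  and vbracket_add_right: "vbracket p X (Y + Y') = vbracket p X Y + vbracket p X Y'"
  and vbracket_vscale_left: "vbracket p (vscale c X) Y = vscale c (vbracket p X Y)"
  and vbracket_vscale_right: "vbracket p X (vscale c Y) = vscale c (vbracket p X Y)"
  unfolding vbracket_def UNIV_bool
  by (simp_all add: vparity_part_add vparity_part_vscale vcomp_add_left vcomp_add_right
      vcomp_vscale_left vcomp_vscale_right vs.scale_right_distrib vs.scale_right_diff_distrib
      vs.scale_left_commute)

lemma additive_vbracket_left: "additive (\<lambda>X. vbracket p X Y)"
  and additive_vbracket_right: "additive (vbracket p X)"
  by (unfold_locales; simp add: vbracket_add_left vbracket_add_right)+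

lemmas vbracket_zero_left [simp] = additive.zero[OF additive_vbracket_left]
  and vbracket_zero_right [simp] = additive.zero[OF additive_vbracket_right]
  and vbracket_minus_left = additive.minus[OF additive_vbracket_left]
  and vbracket_minus_right = additive.minus[OF additive_vbracket_right]
  and vbracket_sum_left = additive.sum[OF additive_vbracket_left]
  and vbracket_sum_right = additive.sum[OF additive_vbracket_right]

lemma vbracket_homogeneous:
  assumes "A \<in> vpart n p a" "B \<in> vpart n p b"
  shows "vbracket p A B = vcomp p A B - vscale (koszul a b) (vcomp p B A)"
  unfolding vbracket_def UNIV_bool
  by (cases a; cases b) (simp_all add: vparity_part_homogeneous[OF assms(1)] vparity_part_homogeneous[OF assms(2)])

lemma vact_vbracket:
  assumes "A \<in> vpart n p a" "B \<in> vpart n p b" "f \<in> superfuns n p"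
  shows "vact p (vbracket p A B) f = vact p A (vact p B f) - fscale (koszul a b) (vact p B (vact p A f))"
  using vact_vcomp_commutator[OF assms] by (simp add: vbracket_homogeneous[OF assms(1,2)])

section \<open>Parity and degree of brackets\<close>

lemma vfields_subspace: "vs.subspace (vfields n p)"
  by (rule vs.subspaceI) (auto simp: vfields_iff lookup_add)

lemma vpart_subspace: "vs.subspace (vpart n p a)"
  by (rule vs.subspaceI) (auto simp: vpart_iff vfields_iff lookup_add intro: fparity_add fparity_fscale)

lemma vgrade_subspace: "vs.subspace (vgrade n p w k)"
  by (rule vs.subspaceI) (auto simp: vgrade_iff vfields_iff lookup_add intro: fgrade_add fgrade_fscale)

lemma vcomp_vfields: "X \<in> vfields n p \<Longrightarrow> Y \<in> vfields n p \<Longrightarrow> vcomp p X Y \<in> vfields n p"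
  by (auto simp: vfields_iff[of Y] vfields_iff[of "vcomp p X Y"])

lemma vcomp_vpart:
  assumes "X \<in> vpart n p a" "Y \<in> vpart n p b"
  shows "vcomp p X Y \<in> vpart n p (a \<noteq> b)"
proof -
  have "(a \<noteq> (b \<noteq> p i)) = ((a \<noteq> b) \<noteq> p i)" for i by auto
  thus ?thesis
    using vact_fparity[OF assms(1) vpart_lookup[OF assms(2)]] assms
    by (auto simp: vpart_iff[of "vcomp p X Y"] vpart_vfields vcomp_vfields)
qed

lemma vcomp_vgrade:
  assumes "X \<in> vgrade n p w k" "Y \<in> vgrade n p w l"
  shows "vcomp p X Y \<in> vgrade n p w (k + l)"
  using vact_fgrade[OF assms(1) vgrade_lookup[OF assms(2)]] assms
  by (auto simp: vgrade_iff[of "vcomp p X Y"] vgrade_vfields vcomp_vfields add.assoc)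

lemma vparity_part_vgrade:
  assumes "X \<in> vgrade n p w k" shows "vparity_part p a X \<in> vgrade n p w k"
proof -
  have "vparity_part p a X \<in> vfields n p"
    using vparity_part_in[OF vgrade_vfields[OF assms], of a] by (rule vpart_vfields)
  moreover have "keys (lookup (vparity_part p a X) i) \<subseteq> keys (lookup X i)" for i
    by (auto simp: Poly_Mapping.in_keys_iff lookup_vparity_part split: if_splits)
  ultimately show ?thesis using assms unfolding vgrade_def by blast
qed

lemma vbracket_vfields: "X \<in> vfields n p \<Longrightarrow> Y \<in> vfields n p \<Longrightarrow> vbracket p X Y \<in> vfields n p"
  unfolding vbracket_def
  by (intro vs.subspace_sum vs.subspace_diff vs.subspace_scale vfields_subspace vcomp_vfields
      vpart_vfields[OF vparity_part_in])

lemma vbracket_vgrade: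
  assumes X: "X \<in> vgrade n p w k" and Y: "Y \<in> vgrade n p w l"
  shows "vbracket p X Y \<in> vgrade n p w (k + l)"
proof -
  have "vcomp p (vparity_part p b Y) (vparity_part p a X) \<in> vgrade n p w (k + l)" for a b
    using vcomp_vgrade[OF vparity_part_vgrade[OF Y] vparity_part_vgrade[OF X]] by (simp add: add.commute)
  moreover have "vcomp p (vparity_part p a X) (vparity_part p b Y) \<in> vgrade n p w (k + l)" for a b
    by (intro vcomp_vgrade vparity_part_vgrade X Y)
  ultimately show ?thesis
    unfolding vbracket_def
    by (intro vs.subspace_sum vs.subspace_diff vs.subspace_scale vgrade_subspace) simp_all
qed

lemma vbracket_vpart:
  assumes "X \<in> vpart n p a" "Y \<in> vpart n p b"
  shows "vbracket p X Y \<in> vpart n p (a \<noteq> b)"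
proof -
  have "(b \<noteq> a) = (a \<noteq> b)" by auto
  thus ?thesis
    using vcomp_vpart[OF assms] vcomp_vpart[OF assms(2,1)]
    by (auto simp: vbracket_homogeneous[OF assms] intro: vs.subspace_diff vs.subspace_scale vpart_subspace)
qed

lemma vbracket_swap:
  assumes "A \<in> vpart n p a" "B \<in> vpart n p b"
  shows "vbracket p A B = vscale (- koszul a b) (vbracket p B A)"
  by (simp add: vbracket_homogeneous[OF assms] vbracket_homogeneous[OF assms(2,1)] koszul_commute[of b a]
      vs.scale_right_diff_distrib)

text \<open>As operators on functions both sides expand to the same iterated compositions;
  faithfulness of the action gives the identity of fields.\<close>

lemma vbracket_jacobi:
  assumes A: "A \<in> vpart n p a" and B: "B \<in> vpart n p b" and C: "C \<in> vpart n p c"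
  shows "vbracket p A (vbracket p B C) =
    vbracket p (vbracket p A B) C + vscale (koszul a b) (vbracket p B (vbracket p A C))"
proof (rule vfield_eqI[where n = n])
  note v = vpart_vfields[OF A] vpart_vfields[OF B] vpart_vfields[OF C]
  show "vbracket p A (vbracket p B C) \<in> vfields n p"
    by (intro vbracket_vfields v)
  show "vbracket p (vbracket p A B) C + vscale (koszul a b) (vbracket p B (vbracket p A C)) \<in> vfields n p"
    by (intro vs.subspace_add vs.subspace_scale vfields_subspace vbracket_vfields v)
  fix f :: "'a superfun" assume f: "f \<in> superfuns n p"
  show "vact p (vbracket p A (vbracket p B C)) f =
      vact p (vbracket p (vbracket p A B) C + vscale (koszul a b) (vbracket p B (vbracket p A C))) f"
    using f v
    by (simp add: vact_add_left vact_vscale vact_vbracket[OF A vbracket_vpart[OF B C]]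
        vact_vbracket[OF vbracket_vpart[OF A B] C] vact_vbracket[OF B vbracket_vpart[OF A C]]
        vact_vbracket[OF A B] vact_vbracket[OF B C] vact_vbracket[OF A C] vact_superfuns
        vact_diff_right vact_fscale fscale_diff)
      (cases a; cases b; cases c; simp add: koszul_def fscale_minus)
qed

text \<open>Expanding the double bracket as an operator, the mixed term with \<open>B\<close>
  between two copies of \<open>A\<close> appears twice and vanishes; the rest is the commutator of
  \<open>B\<close> with the operator square.\<close>

lemma vbracket_square_char_2:
  fixes A B :: "'k::field vfield"
  assumes c: "CHAR('k) = 2" and A: "A \<in> vpart n p True" and B: "B \<in> vpart n p b"
  shows "vbracket p (vcomp p A A) B = vbracket p A (vbracket p A B)"
proof (rule vfield_eqI[where n = n])
  note v = vpart_vfields[OF A] vpart_vfields[OF B]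
  have AA: "vcomp p A A \<in> vpart n p False" using vcomp_vpart[OF A A] by simp
  show "vbracket p (vcomp p A A) B \<in> vfields n p" "vbracket p A (vbracket p A B) \<in> vfields n p"
    by (intro vbracket_vfields vcomp_vfields v)+
  fix f :: "'k superfun" assume f: "f \<in> superfuns n p"
  have 1: "- x = x" for x :: "'k superfun"
    using superfun_char_2[OF c, of x] by (simp add: eq_neg_iff_add_eq_0)
  have "vact p (vbracket p A (vbracket p A B)) f =
      vact p A (vact p A (vact p B f)) - vact p A (vact p B (vact p A f))
      - (vact p A (vact p B (vact p A f)) - vact p B (vact p A (vact p A f)))"
    using f v by (simp add: vact_vbracket[OF A vbracket_vpart[OF A B]] vact_vbracket[OF A B]
       vact_superfuns koszul_char_2[OF c] vact_diff_right)
  also have "\<dots> = vact p A (vact p A (vact p B f)) - vact p B (vact p A (vact p A f))"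
    using 1[of "vact p A (vact p B (vact p A f))"] 1[of "vact p B (vact p A (vact p A f))"]
    by (simp add: algebra_simps) (metis add_diff_cancel_left' diff_minus_eq_add)
  also have "\<dots> = vact p (vbracket p (vcomp p A A) B) f"
    using f v by (simp add: vact_vbracket[OF AA B] vact_square_char_2[OF c A] vact_superfuns)
  finally show "vact p (vbracket p (vcomp p A A) B) f = vact p (vbracket p A (vbracket p A B)) f" ..
qed

section \<open>Multiplication of fields by functions\<close>

lemma fparity_decompose:
  fixes f :: "'k::field superfun"
  assumes "f \<in> superfuns n p"
  obtains g h where "f = g + h" "g \<in> fparity n p False" "h \<in> fparity n p True"
proof -
  define part where "part b = (\<Sum>m\<in>{m\<in>keys f. monom_parity p m = b}. single m (lookup f m))" for b
  have l: "lookup (part b) m = (if monom_parity p m = b then lookup f m else 0)" for b m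
    by (simp add: part_def Poly_Mapping.lookup_sum lookup_single_if Poly_Mapping.in_keys_iff)
  have "part b \<in> fparity n p b" for b
    using assms by (auto simp: fparity_def superfuns_def Poly_Mapping.in_keys_iff l subset_iff split: if_splits)
  moreover have "f = part False + part True"
    by (rule poly_mapping_eqI) (simp add: l lookup_add)
  ultimately show thesis using that by blast
qed

lemma vparity_decompose:
  assumes "X \<in> vfields n p"
  obtains Y Z where "X = Y + Z" "Y \<in> vpart n p False" "Z \<in> vpart n p True"
  using vparity_part_sum vparity_part_in[OF assms] by blast

lemma fsmult_add_left: "fsmult p (f + g) X = fsmult p f X + fsmult p g X"
  and fsmult_add_right: "fsmult p f (X + Y) = fsmult p f X + fsmult p f Y"
  by (intro poly_mapping_eqI; simp add: lookup_add fmult_add_left fmult_add_right)+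

lemma fsmult_zero [simp]: "fsmult p 0 X = 0" "fsmult p f 0 = 0"
  by (intro poly_mapping_eqI; simp)+

lemma fsmult_vfields: "f \<in> superfuns n p \<Longrightarrow> X \<in> vfields n p \<Longrightarrow> fsmult p f X \<in> vfields n p"
  by (auto simp: vfields_iff)

lemma fsmult_vpart:
  assumes "f \<in> fparity n p c" "X \<in> vpart n p b"
  shows "fsmult p f X \<in> vpart n p (c \<noteq> b)"
proof -
  have "((c \<noteq> b) \<noteq> p i) = (c \<noteq> (b \<noteq> p i))" for i by auto
  thus ?thesis
    using fparity_fmult[OF assms(1) vpart_lookup[OF assms(2)]] assms
    by (auto simp: vpart_iff[of "fsmult p f X"] vpart_vfields fsmult_vfields fparity_superfuns)
qed

text \<open>The twist allows \<open>f\<close> to be inhomogeneous, as are the frame coefficients of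
  an arbitrary field, to which this rule is applied.\<close>

lemma vbracket_fsmult:
  assumes A: "A \<in> vpart n p a" and f: "f \<in> superfuns n p" and B: "B \<in> vfields n p"
  shows "vbracket p A (fsmult p f B) = fsmult p (vact p A f) B + fsmult p (parity_twist p a f) (vbracket p A B)"
proof -
  have *: "vbracket p A (fsmult p f B) = fsmult p (vact p A f) B + fsmult p (parity_twist p a f) (vbracket p A B)"
    if f: "f \<in> fparity n p c" and B: "B \<in> vpart n p b" for f B b c
  proof (rule poly_mapping_eqI)
    fix k
    have v: "A \<in> vfields n p" "B \<in> vfields n p" "f \<in> superfuns n p"
      using A B f by (auto intro: vpart_vfields fparity_superfuns)
    show "lookup (vbracket p A (fsmult p f B)) k =
      lookup (fsmult p (vact p A f) B + fsmult p (parity_twist p a f) (vbracket p A B)) k"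
      unfolding vbracket_homogeneous[OF A fsmult_vpart[OF f B]] vbracket_homogeneous[OF A B]
      by (simp add: lookup_minus lookup_add vact_fmult[OF A v(3) vfields_lookup[OF v(2)]]
        vact_fsmult[OF v(2,3) vfields_lookup[OF v(1)]] parity_twist_fparity[OF f]
        fmult_diff_right fmult_fscale_left fmult_fscale_right koszul_xor fscale_diff mult_ac)
  qed
  obtain f0 f1 where f': "f = f0 + f1" "f0 \<in> fparity n p False" "f1 \<in> fparity n p True"
    using f by (rule fparity_decompose)
  obtain B0 B1 where B': "B = B0 + B1" "B0 \<in> vpart n p False" "B1 \<in> vpart n p True"
    using B by (rule vparity_decompose)
  note h = *[OF f'(2) B'(2)] *[OF f'(2) B'(3)] *[OF f'(3) B'(2)] *[OF f'(3) B'(3)]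
  show ?thesis
    by (simp add: f'(1) B'(1) fsmult_add_left fsmult_add_right vbracket_add_right h vact_add_right
      parity_twist_add add_ac)
qed

section \<open>Decomposition of fields by degree\<close>

definition vdegree_part :: "(nat \<Rightarrow> nat) \<Rightarrow> int \<Rightarrow> 'k::field vfield \<Rightarrow> 'k vfield" where
  "vdegree_part w k X = (\<Sum>i\<in>keys X. \<Sum>m\<in>{m \<in> keys (lookup X i). int (monom_degree w m) - int (w i) = k}.
     single i (single m (lookup (lookup X i) m)))"

lemma lookup_vdegree_part:
  "lookup (lookup (vdegree_part w k X) i) m =
    (if int (monom_degree w m) - int (w i) = k then lookup (lookup X i) m else 0)"
proof -
  have "lookup (lookup (vdegree_part w k X) i) m =
      (\<Sum>j\<in>keys X. \<Sum>l\<in>{l \<in> keys (lookup X j). int (monom_degree w l) - int (w j) = k}.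
        if j = i then if l = m then lookup (lookup X i) m else 0 else 0)"
    unfolding vdegree_part_def Poly_Mapping.lookup_sum
    by (intro sum.cong refl) (simp add: lookup_single_if)
  also have "\<dots> = (\<Sum>j\<in>keys X. if j = i then
      (\<Sum>l\<in>{l \<in> keys (lookup X i). int (monom_degree w l) - int (w i) = k}.
        if l = m then lookup (lookup X i) m else 0) else 0)"
    by (intro sum.cong) simp_all
  also have "\<dots> = (if int (monom_degree w m) - int (w i) = k then lookup (lookup X i) m else 0)"
    by (auto simp: Poly_Mapping.in_keys_iff)
  finally show ?thesis .
qed

lemma vdegree_part_in:
  assumes "X \<in> vfields n p" shows "vdegree_part w k X \<in> vgrade n p w k"
proof -
  have "keys (lookup (vdegree_part w k X) i) \<subseteq>
      {m \<in> keys (lookup X i). int (monom_degree w m) - int (w i) = k}" for i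
    by (auto simp: Poly_Mapping.in_keys_iff lookup_vdegree_part split: if_splits)
  moreover have "lookup (vdegree_part w k X) i = 0" if "i \<notin> {1..n}" for i
    using assms that by (intro poly_mapping_eqI) (simp add: lookup_vdegree_part vfields_iff)
  ultimately show ?thesis using assms
    unfolding vgrade_def vfields_iff superfuns_def mem_Collect_eq by blast
qed

lemma vdegree_part_add: "vdegree_part w k (X + Y) = vdegree_part w k X + vdegree_part w k Y"
  and vdegree_part_vscale: "vdegree_part w k (vscale c X) = vscale c (vdegree_part w k X)"
  by (intro poly_mapping_eqI; simp add: lookup_vdegree_part lookup_add)+

lemma vdegree_part_homogeneous:
  assumes "X \<in> vgrade n p w k"
  shows "vdegree_part w l X = (if k = l then X else 0)"
proof (intro poly_mapping_eqI)
  fix i m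
  have "m \<in> keys (lookup X i) \<Longrightarrow> int (monom_degree w m) - int (w i) = k"
    using assms by (auto simp: vgrade_def)
  thus "lookup (lookup (vdegree_part w l X) i) m = lookup (lookup (if k = l then X else 0) i) m"
    by (auto simp: lookup_vdegree_part Poly_Mapping.in_keys_iff)
qed

definition vdegrees :: "(nat \<Rightarrow> nat) \<Rightarrow> 'k::zero vfield \<Rightarrow> int set" where
  "vdegrees w X = (\<Union>i\<in>keys X. (\<lambda>m. int (monom_degree w m) - int (w i)) ` keys (lookup X i))"

lemma finite_vdegrees: "finite (vdegrees w X)"
  by (simp add: vdegrees_def)

text \<open>\<open>K\<close> may be larger than the set of degrees that occur, so that a prescribed
  degree can be inserted into the sum.\<close>

lemma vdegree_part_sum:
  assumes "finite K" "vdegrees w X \<subseteq> K"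
  shows "(\<Sum>k\<in>K. vdegree_part w k X) = X"
proof (intro poly_mapping_eqI)
  fix i m
  have "int (monom_degree w m) - int (w i) \<in> K" if "lookup (lookup X i) m \<noteq> 0"
  proof -
    have "lookup X i \<noteq> 0" using that by auto
    hence "i \<in> keys X" "m \<in> keys (lookup X i)" using that by (simp_all add: Poly_Mapping.in_keys_iff)
    thus ?thesis using assms(2) unfolding vdegrees_def by blast
  qed
  thus "lookup (lookup (\<Sum>k\<in>K. vdegree_part w k X) i) m = lookup (lookup X i) m"
    using assms(1) by (auto simp: Poly_Mapping.lookup_sum lookup_vdegree_part)
qed

section \<open>Frames\<close>

text \<open>Divided powers matter here: for ordinary powers in characteristic p, the p-th power of
  an even variable would also be killed.\<close>

lemma pderivative_eq_0_iff: "pderivative p i f = 0 \<longleftrightarrow> (\<forall>m\<in>keys f. lookup m i = 0)"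
proof
  assume 0: "pderivative p i f = 0"
  show "\<forall>m\<in>keys f. lookup m i = 0"
  proof (intro ballI, rule ccontr)
    fix m assume m: "m \<in> keys f" "lookup m i \<noteq> 0"
    then obtain m' where m': "m = m' + single i 1" by (elim monom_minus_single)
    have "lookup (pderivative p i f) m' = deriv_coeff p i m * lookup f m"
      by (simp add: lookup_pderivative m')
    thus False using 0 m deriv_coeff_nonzero[of m i p, where 'k = 'a] by (simp add: Poly_Mapping.in_keys_iff)
  qed
next
  assume m: "\<forall>m\<in>keys f. lookup m i = 0"
  have "lookup f (m + single i 1) = 0" for m
    using m by (metis Poly_Mapping.in_keys_iff add_is_0 lookup_add lookup_single_eq one_neq_zero)
  thus "pderivative p i f = 0" by (intro poly_mapping_eqI) (simp add: lookup_pderivative)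
qed

lemma superfun_eq_fconst:
  assumes "\<And>m. m \<in> keys f \<Longrightarrow> m = 0" shows "f = fconst (lookup f 0)"
  by (rule poly_mapping_eqI) (use assms in \<open>auto simp: fconst_def lookup_single_if Poly_Mapping.in_keys_iff\<close>)

lemma fun_constant:
  assumes f: "f \<in> superfuns n p" and "\<And>i. i \<in> {1..n} \<Longrightarrow> pderivative p i f = 0"
  shows "f = fconst (lookup f 0)"
proof (rule superfun_eq_fconst)
  fix m assume m: "m \<in> keys f"
  hence "lookup m i = 0" for i
    using assms lookup_monom_0D[of m n p i] by (cases "i \<in> {1..n}") (auto simp: pderivative_eq_0_iff superfuns_keys)
  thus "m = 0" by (intro poly_mapping_eqI) simp
qed

text \<open>The antiderivative is taken monomial by monomial and without constant of integration. An
  odd variable can be adjoined only to monomials free of it, hence the assumption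
  \<open>odd\<close>. The last clause ensures that variables absent from \<open>g\<close> stay
  absent, so that equations already solved are not disturbed.\<close>

lemma integral_exists:
  assumes g: "g \<in> fparity n p a" "g \<in> fgrade n p w D" and K: "K \<in> {1..n}"
    and odd: "p K \<Longrightarrow> pderivative p K g = 0"
  obtains f where "f \<in> fparity n p (a \<noteq> p K)" "f \<in> fgrade n p w (D + int (w K))"
    "pderivative p K f = g" "lookup f 0 = 0"
    "\<And>j. j \<noteq> K \<Longrightarrow> pderivative p j g = 0 \<Longrightarrow> pderivative p j f = 0"
proof
  let ?s = "single K 1 :: monom"
  define f where "f = (\<Sum>m\<in>keys g. single (m + ?s) (lookup g m / deriv_coeff p K (m + ?s)))"
  have l: "lookup f (m + ?s) = lookup g m / deriv_coeff p K (m + ?s)" for m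
    by (simp add: f_def Poly_Mapping.lookup_sum lookup_single_if Poly_Mapping.in_keys_iff)
  have k: "\<exists>m\<in>keys g. m' = m + ?s" if "m' \<in> keys f" for m'
  proof (rule ccontr)
    assume *: "\<not> ?thesis"
    have "lookup f m' = 0"
      unfolding f_def Poly_Mapping.lookup_sum
      by (rule sum.neutral) (use * in \<open>auto simp: lookup_single_if\<close>)
    thus False using that by (simp add: Poly_Mapping.in_keys_iff)
  qed
  have gm: "m \<in> monoms n p \<and> monom_parity p m = a \<and> int (monom_degree w m) = D" if "m \<in> keys g" for m
    using g that by (auto simp: fparity_def fgrade_def superfuns_def)
  have "m + ?s \<in> monoms n p" if m: "m \<in> keys g" for m
  proof -
    have "lookup m K = 0" if "p K" using odd[OF that] m by (simp add: pderivative_eq_0_iff)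
    thus ?thesis using gm[OF m] K by (auto simp: monoms_alt lookup_add lookup_single_if)
  qed
  hence f: "f \<in> superfuns n p" using k by (force simp: superfuns_keys)
  have "monom_parity p m' = (a \<noteq> p K)" "int (monom_degree w m') = D + int (w K)" if "m' \<in> keys f" for m'
    using k[OF that] gm by (auto simp: monom_parity_add monom_degree_add)
  thus "f \<in> fparity n p (a \<noteq> p K)" "f \<in> fgrade n p w (D + int (w K))"
    using f by (simp_all add: fparity_def fgrade_def)
  show "pderivative p K f = g"
    by (rule poly_mapping_eqI) (simp add: lookup_pderivative l deriv_coeff_nonzero lookup_add)
  show "lookup f 0 = 0"
    using k[of 0] monom_add_eq_0[of _ ?s] by (metis Poly_Mapping.in_keys_iff lookup_single_eq lookup_zero one_neq_zero)
  show "pderivative p j f = 0" if "j \<noteq> K" "pderivative p j g = 0" for j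
    using that k by (force simp: pderivative_eq_0_iff lookup_add lookup_single_if)
qed

text \<open>Forward substitution in a unitriangular system: for a triangular frame the component of
  \<open>Z\<close> at \<open>k\<close> involves only coefficients with index at most
  \<open>k\<close>, and the one at \<open>k\<close> enters with factor 1. The result is the value at
  \<open>Z\<close> of the dual form.\<close>

function frame_coef :: "(nat \<Rightarrow> bool) \<Rightarrow> (nat \<Rightarrow> 'k::field vfield) \<Rightarrow> 'k vfield \<Rightarrow> nat \<Rightarrow> 'k superfun" where
  "frame_coef p F Z k = lookup Z k - (\<Sum>i\<in>{1..<k}. fmult p (frame_coef p F Z i) (lookup (F i) k))"
  by auto
termination by (relation "measure (\<lambda>(p, F, Z, k). k)") auto

declare frame_coef.simps [simp del]

text \<open>Bracketing with a homogeneous field only permutes the parity parts. This is used to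
  extend statements from parity-homogeneous fields to all fields.\<close>

lemma vparity_part_vbracket:
  assumes A: "A \<in> vpart n p a" and Z: "Z \<in> vfields n p"
  shows "vparity_part p b (vbracket p A Z) = vbracket p A (vparity_part p (a \<noteq> b) Z)"
proof -
  obtain Y W where YW: "Z = Y + W" "Y \<in> vpart n p False" "W \<in> vpart n p True"
    using Z by (rule vparity_decompose)
  show ?thesis
    unfolding YW(1) vbracket_add_right vparity_part_add vparity_part_homogeneous[OF YW(2)]
      vparity_part_homogeneous[OF YW(3)] vparity_part_homogeneous[OF vbracket_vpart[OF A YW(2)]]
      vparity_part_homogeneous[OF vbracket_vpart[OF A YW(3)]]
    by (cases a; cases b) simp_all
qed

section \<open>Triangular frames\<close>

locale super_frame =
  fixes n :: nat and p :: "nat \<Rightarrow> bool" and w :: "nat \<Rightarrow> nat" and F :: "nat \<Rightarrow> 'k::field vfield"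
  assumes frame_part: "i \<in> {1..n} \<Longrightarrow> F i \<in> vpart n p (p i)"
    and frame_grade: "i \<in> {1..n} \<Longrightarrow> F i \<in> vgrade n p w (- int (w i))"
    and frame_at_0: "i \<in> {1..n} \<Longrightarrow> value_at_0 (F i) = vpartial i"
    and weight_mono: "mono_on {1..n} w"
    and weight_pos: "i \<in> {1..n} \<Longrightarrow> 0 < w i"
begin

lemma frame_vfields: "i \<in> {1..n} \<Longrightarrow> F i \<in> vfields n p"
  using frame_part by (rule vpart_vfields)

lemma frame_const:
  assumes "i \<in> {1..n}"
  shows "lookup (lookup (F i) k) 0 = (if k = i then 1 else 0)"
proof -
  have "lookup (value_at_0 (F i)) k = lookup (vpartial i) k" using frame_at_0[OF assms] by simp
  hence "fconst (lookup (lookup (F i) k) 0) = fconst (if k = i then 1 else 0)"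
    by (simp add: value_at_0_def vpartial_def lookup_map_zero lookup_single_if)
  hence "lookup (fconst (lookup (lookup (F i) k) 0)) 0 = lookup (fconst (if k = i then 1 else 0 :: 'k)) 0"
    by (rule arg_cong)
  thus ?thesis unfolding fconst_def by (simp only: lookup_single_eq)
qed

lemma fgrade_0_const:
  assumes f: "f \<in> fgrade n p w 0" shows "f = fconst (lookup f 0)"
proof (rule superfun_eq_fconst)
  fix m assume m: "m \<in> keys f"
  hence d: "monom_degree w m = 0" and k: "keys m \<subseteq> {1..n}"
    using f by (auto simp: fgrade_def superfuns_def monoms_def)
  have "lookup m i * w i = 0" if "i \<in> keys m" for i
    using d that by (simp add: monom_degree_def)
  moreover have "lookup m i \<noteq> 0" "w i \<noteq> 0" if "i \<in> keys m" for i
    using that subsetD[OF k that] weight_pos[of i] by (simp_all add: Poly_Mapping.in_keys_iff)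
  ultimately have "keys m = {}" by (metis equals0I mult_eq_0_iff)
  thus "m = 0" by simp
qed

lemma weight_le: "i \<in> {1..n} \<Longrightarrow> j \<in> {1..n} \<Longrightarrow> i \<le> j \<Longrightarrow> w i \<le> w j"
  using weight_mono by (auto simp: mono_on_def)

lemma weight_less: "i \<in> {1..n} \<Longrightarrow> j \<in> {1..n} \<Longrightarrow> w i < w j \<Longrightarrow> i < j"
  using weight_le[of j i] by (meson leD linorder_not_less)

lemma frame_lookup_grade: "i \<in> {1..n} \<Longrightarrow> lookup (F i) k \<in> fgrade n p w (int (w k) - int (w i))"
  using vgrade_lookup[OF frame_grade, of i k] by (simp add: algebra_simps)

text \<open>The component at \<open>k\<close> has degree \<open>w k - w i\<close>, which is at most
  0 for \<open>k \<le> i\<close>; so it vanishes or is a constant that can be read off at the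
  origin.\<close>

lemma frame_lookup_le:
  assumes "i \<in> {1..n}" "k \<in> {1..n}" "k \<le> i"
  shows "lookup (F i) k = fconst (if k = i then 1 else 0)"
proof (cases "w k = w i")
  case True
  hence "lookup (F i) k \<in> fgrade n p w 0" using frame_lookup_grade[OF assms(1), of k] by simp
  hence "lookup (F i) k = fconst (lookup (lookup (F i) k) 0)" by (rule fgrade_0_const)
  also have "\<dots> = fconst (if k = i then 1 else 0)" by (simp only: frame_const[OF assms(1)])
  finally show ?thesis .
next
  case False
  hence "k \<noteq> i" "w k < w i" using weight_le[of k i] assms by auto
  thus ?thesis using fgrade_negative[OF frame_lookup_grade[OF assms(1), of k]] by simp
qed

lemma vact_frame:
  assumes "i \<in> {1..n}" "f \<in> superfuns n p"
  shows "vact p (F i) f = pderivative p i f + (\<Sum>l\<in>{i<..n}. fmult p (lookup (F i) l) (pderivative p l f))"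
proof -
  have "{1..n} = {1..<i} \<union> {i} \<union> {i<..n}" using assms by auto
  hence "vact p (F i) f = (\<Sum>l\<in>{1..<i} \<union> {i} \<union> {i<..n}. fmult p (lookup (F i) l) (pderivative p l f))"
    by (simp add: vact_eq[OF frame_vfields[OF assms(1)]])
  also have "\<dots> = (\<Sum>l\<in>{1..<i}. fmult p (lookup (F i) l) (pderivative p l f)) +
      fmult p (lookup (F i) i) (pderivative p i f) + (\<Sum>l\<in>{i<..n}. fmult p (lookup (F i) l) (pderivative p l f))"
    by (subst sum.union_disjoint; (subst sum.union_disjoint)?) auto
  also have "(\<Sum>l\<in>{1..<i}. fmult p (lookup (F i) l) (pderivative p l f)) = 0"
    by (rule sum.neutral) (use assms in \<open>auto simp: frame_lookup_le\<close>)
  also have "fmult p (lookup (F i) i) (pderivative p i f) = pderivative p i f"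
    using assms by (simp add: frame_lookup_le fmult_fconst_left[OF superfuns_pderivative])
  finally show ?thesis by simp
qed

text \<open>Downward induction on \<open>j\<close>: the action of \<open>F j\<close> differs from
  the derivative in \<open>j\<close> only by later derivatives, already known to vanish. With
  \<open>K = 0\<close> this characterizes constants; a general \<open>K\<close> is needed for
  integrating the last variable.\<close>

lemma pderivative_0_if_vact_frame_0:
  assumes f: "f \<in> superfuns n p" and 0: "\<And>j. K < j \<Longrightarrow> j \<in> {1..n} \<Longrightarrow> vact p (F j) f = 0"
  shows "K < j \<Longrightarrow> j \<in> {1..n} \<Longrightarrow> pderivative p j f = 0"
proof (induction "n - j" arbitrary: j rule: less_induct)
  case less
  have "pderivative p l f = 0" if "l \<in> {j<..n}" for l
    using less.hyps[of l] less.prems that by auto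
  thus ?case using vact_frame[OF less.prems(2) f] 0[OF less.prems] by simp
qed

lemma fun_constant_frame:
  assumes f: "f \<in> superfuns n p" and 0: "\<And>j. j \<in> {1..n} \<Longrightarrow> vact p (F j) f = 0"
  shows "f = fconst (lookup f 0)"
proof (rule fun_constant[OF f])
  fix j assume "j \<in> {1..n}"
  thus "pderivative p j f = 0"
    using pderivative_0_if_vact_frame_0[OF f, of 0 j] 0 by auto
qed

text \<open>The derivative would have degree \<open>w k - w j - w m\<close>, which is negative. So
  the component at \<open>k\<close> depends only on variables of smaller weight, and the commutation
  equations can be treated one component after another.\<close>

lemma pderivative_frame_0:
  assumes "j \<in> {1..n}" "m \<in> {1..n}" "w k \<le> w m"
  shows "pderivative p m (lookup (F j) k) = 0"
  by (rule fgrade_negative[OF fgrade_pderivative[OF frame_lookup_grade[OF assms(1)]]])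
    (use assms weight_pos[of j] in auto)

text \<open>Induction over the components: once the earlier ones vanish, the component at
  \<open>k\<close> of the bracket with \<open>F j\<close> is just \<open>F j\<close> applied to that
  of \<open>Z\<close>, because the components of \<open>F j\<close> at \<open>k\<close> do not
  involve the variables from \<open>k\<close> on. So this component is constant and fixed at the
  origin.\<close>

lemma centralizing_determined:
  assumes Z: "Z \<in> vfields n p" and c: "\<And>j. j \<in> {1..n} \<Longrightarrow> vbracket p (F j) Z = 0"
    and z: "\<And>k. lookup (lookup Z k) 0 = 0"
  shows "Z = 0"
proof -
  have hom: "Z = 0" if Z: "Z \<in> vpart n p b" and c: "\<And>j. j \<in> {1..n} \<Longrightarrow> vbracket p (F j) Z = 0"
    and z: "\<And>k. lookup (lookup Z k) 0 = 0" for Z b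
  proof (rule poly_mapping_eqI)
    fix k
    show "lookup Z k = lookup 0 k"
    proof (induction k rule: less_induct)
      case (less k)
      show ?case
      proof (cases "k \<in> {1..n}")
        case True
        have "vact p (F j) (lookup Z k) = 0" if j: "j \<in> {1..n}" for j
        proof -
          have "fmult p (lookup Z m) (pderivative p m (lookup (F j) k)) = 0" if m: "m \<in> {1..n}" for m
            using less[of m] pderivative_frame_0[OF j m] weight_le[OF True m] by (cases "m < k") auto
          hence "vact p Z (lookup (F j) k) = 0"
            by (simp add: vact_eq[OF vpart_vfields[OF Z]])
          moreover have "lookup (vbracket p (F j) Z) k = 0" using c[OF j] by simp
          ultimately show ?thesis
            by (simp add: vbracket_homogeneous[OF frame_part[OF j] Z] lookup_minus)
        qed
        hence "lookup Z k = fconst (lookup (lookup Z k) 0)"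
          by (intro fun_constant_frame vfields_lookup[OF vpart_vfields[OF Z]])
        thus ?thesis using z by simp
      next
        case False
        thus ?thesis using vpart_vfields[OF Z] by (simp add: vfields_iff)
      qed
    qed
  qed
  have "vparity_part p b Z = 0" for b
  proof (rule hom[OF vparity_part_in[OF Z]])
    show "vbracket p (F j) (vparity_part p b Z) = 0" if "j \<in> {1..n}" for j
    proof -
      have "vparity_part p (p j \<noteq> b) (vbracket p (F j) Z) = 0"
        unfolding c[OF that] using vparity_part_vscale[of p "p j \<noteq> b" 0 Z] by simp
      thus ?thesis using vparity_part_vbracket[OF frame_part[OF that] Z, of "p j \<noteq> b"]
        by (cases "p j"; cases b) simp_all
    qed
  qed (simp add: lookup_vparity_part z)
  thus ?thesis using vparity_part_sum[of Z p] by simp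
qed

section \<open>Coefficients in a frame and dual forms\<close>

lemma coef_superfuns: "Z \<in> vfields n p \<Longrightarrow> k \<in> {1..n} \<Longrightarrow> frame_coef p F Z k \<in> superfuns n p"
proof (induction k rule: less_induct)
  case (less k)
  show ?case
    by (subst frame_coef.simps)
      (use less in \<open>auto intro!: superfuns_diff superfuns_sum superfuns_fmult vfields_lookup frame_vfields\<close>)
qed

lemma frame_expansion:
  assumes Z: "Z \<in> vfields n p"
  shows "Z = (\<Sum>i\<in>{1..n}. fsmult p (frame_coef p F Z i) (F i))"
proof (rule poly_mapping_eqI)
  fix k
  show "lookup Z k = lookup (\<Sum>i\<in>{1..n}. fsmult p (frame_coef p F Z i) (F i)) k"
  proof (cases "k \<in> {1..n}")
    case True
    hence "{1..n} = {1..<k} \<union> {k} \<union> {k<..n}" by auto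
    hence "(\<Sum>i\<in>{1..n}. fmult p (frame_coef p F Z i) (lookup (F i) k)) =
        (\<Sum>i\<in>{1..<k} \<union> {k} \<union> {k<..n}. fmult p (frame_coef p F Z i) (lookup (F i) k))" by simp
    also have "\<dots> = (\<Sum>i\<in>{1..<k}. fmult p (frame_coef p F Z i) (lookup (F i) k)) +
        fmult p (frame_coef p F Z k) (lookup (F k) k) +
        (\<Sum>i\<in>{k<..n}. fmult p (frame_coef p F Z i) (lookup (F i) k))"
      by (subst sum.union_disjoint; (subst sum.union_disjoint)?) auto
    also have "(\<Sum>i\<in>{k<..n}. fmult p (frame_coef p F Z i) (lookup (F i) k)) = 0"
      by (rule sum.neutral) (use True in \<open>auto simp: frame_lookup_le\<close>)
    also have "fmult p (frame_coef p F Z k) (lookup (F k) k) = frame_coef p F Z k"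
      using True by (simp add: frame_lookup_le fmult_fconst_right[OF coef_superfuns[OF Z]])
    finally show ?thesis
      by (simp add: Poly_Mapping.lookup_sum frame_coef.simps[of p F Z k])
  next
    case False
    thus ?thesis using Z frame_vfields by (simp add: Poly_Mapping.lookup_sum vfields_iff)
  qed
qed

lemma coef_add: "frame_coef p F (Y + Z) k = frame_coef p F Y k + frame_coef p F Z k"
proof (induction k rule: less_induct)
  case (less k)
  show ?case
    by (subst (1 2 3) frame_coef.simps) (use less in \<open>simp add: lookup_add fmult_add_left sum.distrib\<close>)
qed

lemma additive_coef: "additive (\<lambda>Z. frame_coef p F Z k)"
  by unfold_locales (rule coef_add)

lemma coef_fsmult:
  assumes "f \<in> superfuns n p" "Z \<in> vfields n p"
  shows "k \<in> {1..n} \<Longrightarrow> frame_coef p F (fsmult p f Z) k = fmult p f (frame_coef p F Z k)"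
proof (induction k rule: less_induct)
  case (less k)
  have "fmult p (fmult p f (frame_coef p F Z i)) (lookup (F i) k) =
    fmult p f (fmult p (frame_coef p F Z i) (lookup (F i) k))" if "i \<in> {1..<k}" for i
    by (rule fmult_assoc) (use assms that less in \<open>auto intro!: coef_superfuns vfields_lookup[of _ n] frame_vfields\<close>)
  thus ?case
    by (subst (1 2) frame_coef.simps)
      (use less in \<open>simp add: fmult_diff_right fmult_sum_right\<close>)
qed

lemma coef_frame:
  assumes j: "j \<in> {1..n}"
  shows "k \<in> {1..n} \<Longrightarrow> frame_coef p F (F j) k = fconst (if k = j then 1 else 0)"
proof (induction k rule: less_induct)
  case (less k)
  have "(\<Sum>i\<in>{1..<k}. fmult p (frame_coef p F (F j) i) (lookup (F i) k)) =
      (\<Sum>i\<in>{1..<k}. if i = j then lookup (F j) k else 0)"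
    using less by (intro sum.cong refl)
      (auto simp: fmult_fconst_left[OF vfields_lookup[OF frame_vfields]])
  also have "\<dots> = (if j < k then lookup (F j) k else 0)" using j by simp
  finally show ?case
    using less.prems j frame_lookup_le[of j k] by (subst frame_coef.simps) auto
qed

lemma coef_fparity:
  assumes "Z \<in> vpart n p a"
  shows "k \<in> {1..n} \<Longrightarrow> frame_coef p F Z k \<in> fparity n p (a \<noteq> p k)"
proof (induction k rule: less_induct)
  case (less k)
  have "fmult p (frame_coef p F Z i) (lookup (F i) k) \<in> fparity n p (a \<noteq> p k)" if "i \<in> {1..<k}" for i
  proof -
    have i: "i < k" "i \<in> {1..n}" using that less.prems by auto
    have "((a \<noteq> p i) \<noteq> (p i \<noteq> p k)) = (a \<noteq> p k)" by auto
    thus ?thesis using fparity_fmult[OF less.IH[OF i] vpart_lookup[OF frame_part[OF i(2)], of k]] by simp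
  qed
  thus ?case
    by (subst frame_coef.simps) (intro fparity_diff fparity_sum vpart_lookup[OF assms])
qed

lemma coef_fgrade:
  assumes "Z \<in> vgrade n p w l"
  shows "k \<in> {1..n} \<Longrightarrow> frame_coef p F Z k \<in> fgrade n p w (l + int (w k))"
proof (induction k rule: less_induct)
  case (less k)
  have "fmult p (frame_coef p F Z i) (lookup (F i) k) \<in> fgrade n p w (l + int (w k))" if "i \<in> {1..<k}" for i
  proof -
    have i: "i < k" "i \<in> {1..n}" using that less.prems by auto
    thus ?thesis using fgrade_fmult[OF less.IH[OF i] frame_lookup_grade[OF i(2), of k]] by simp
  qed
  thus ?case
    by (subst frame_coef.simps) (intro fgrade_diff fgrade_sum vgrade_lookup[OF assms])
qed

lemma coef_eq_0_imp:
  assumes "Z \<in> vfields n p" "\<And>k. k \<in> {1..n} \<Longrightarrow> frame_coef p F Z k = 0"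
  shows "Z = 0"
  using frame_expansion[OF assms(1)] assms(2) by simp

lemma dual_forms_coef: "dual_forms n p F (\<lambda>i Z. frame_coef p F Z i)"
  unfolding dual_forms_def one_form_def
  by (auto simp: coef_superfuns coef_add coef_fsmult coef_frame intro: coef_superfuns)

text \<open>A form that is linear over functions is determined on fields by its values on the frame,
  so every dual system agrees there with the explicit coefficients.\<close>

lemma dual_forms_eq_coef:
  assumes \<theta>: "dual_forms n p F \<theta>" and k: "k \<in> {1..n}" and Z: "Z \<in> vfields n p"
  shows "\<theta> k Z = frame_coef p F Z k"
proof -
  have o: "one_form n p (\<theta> k)" using \<theta> k by (simp add: dual_forms_def)
  have v: "fsmult p (frame_coef p F Z i) (F i) \<in> vfields n p" if "i \<in> {1..n}" for i
    using that by (intro fsmult_vfields coef_superfuns Z frame_vfields)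
  have s: "\<theta> k (sum h A) = (\<Sum>i\<in>A. \<theta> k (h i))" if "finite A" "\<And>i. i \<in> A \<Longrightarrow> h i \<in> vfields n p" for h and A :: "nat set"
    using that
  proof (induction A rule: finite_induct)
    case empty
    have "\<theta> k (0 + 0) = \<theta> k 0 + \<theta> k 0"
      using o vs.subspace_0[OF vfields_subspace] unfolding one_form_def by blast
    thus ?case by (metis add_0_left add_cancel_right_left sum.empty)
  next
    case (insert x A)
    hence "sum h A \<in> vfields n p" by (intro vs.subspace_sum[OF vfields_subspace]) auto
    thus ?case using insert o by (simp add: one_form_def)
  qed
  have "\<theta> k Z = \<theta> k (\<Sum>i\<in>{1..n}. fsmult p (frame_coef p F Z i) (F i))"
    using frame_expansion[OF Z] by simp
  also have "\<dots> = (\<Sum>i\<in>{1..n}. \<theta> k (fsmult p (frame_coef p F Z i) (F i)))"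
    by (rule s) (auto simp: v)
  also have "\<dots> = (\<Sum>i\<in>{1..n}. fmult p (frame_coef p F Z i) (fconst (if k = i then 1 else 0)))"
    using o \<theta> k coef_superfuns[OF Z] frame_vfields
    by (intro sum.cong refl) (simp add: one_form_def dual_forms_def)
  also have "\<dots> = (\<Sum>i\<in>{1..n}. if i = k then frame_coef p F Z k else 0)"
    by (intro sum.cong refl) (use coef_superfuns[OF Z] in \<open>auto simp: fmult_fconst_right[of _ n]\<close>)
  finally show ?thesis using k by simp
qed

lemma lookup_span_0:
  assumes "k \<in> {1..n}"
  shows "lookup (lookup (\<Sum>i\<in>{1..n}. vscale (a i) (F i)) k) 0 = a k"
proof -
  have "lookup (lookup (\<Sum>i\<in>{1..n}. vscale (a i) (F i)) k) 0 = (\<Sum>i\<in>{1..n}. if i = k then a k else 0)"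
    unfolding Poly_Mapping.lookup_sum by (intro sum.cong refl) (auto simp: frame_const)
  thus ?thesis using assms by simp
qed

end

section \<open>Structure constants and integrability conditions\<close>

locale super_lie_frame = super_frame n p w F
  for n :: nat and p w and F :: "nat \<Rightarrow> 'a::field vfield" +
  fixes c :: "nat \<Rightarrow> nat \<Rightarrow> nat \<Rightarrow> 'a" and s :: "nat \<Rightarrow> nat \<Rightarrow> 'a"
  assumes frame_bracket: "i \<in> {1..n} \<Longrightarrow> j \<in> {1..n} \<Longrightarrow>
      vbracket p (F i) (F j) = (\<Sum>k\<in>{1..n}. vscale (c i j k) (F k))"
    and frame_square: "CHAR('a) = 2 \<Longrightarrow> i \<in> {1..n} \<Longrightarrow> p i \<Longrightarrow>
      vcomp p (F i) (F i) = (\<Sum>k\<in>{1..n}. vscale (s i k) (F k))"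
begin

text \<open>\<open>a k\<close> is the constant term of the component at \<open>k\<close>, so a
  nonzero \<open>a k\<close> already determines the parity and the degree of the whole
  combination.\<close>

lemma constants_homogeneous:
  assumes X: "(\<Sum>k\<in>{1..n}. vscale (a k) (F k)) \<in> vpart n p b"
      "(\<Sum>k\<in>{1..n}. vscale (a k) (F k)) \<in> vgrade n p w l"
    and k: "k \<in> {1..n}" "a k \<noteq> 0"
  shows "p k = b" "int (w k) = - l"
proof -
  let ?X = "\<Sum>k\<in>{1..n}. vscale (a k) (F k)"
  have "0 \<in> keys (lookup ?X k)" using k lookup_span_0[of k a] by (simp add: Poly_Mapping.in_keys_iff)
  thus "p k = b" "int (w k) = - l"
    using vpart_lookup[OF X(1), of k] vgrade_lookup[OF X(2), of k]
    by (force simp: fparity_def fgrade_def)+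
qed

lemma structure_constant_homogeneous:
  assumes "i \<in> {1..n}" "j \<in> {1..n}" "k \<in> {1..n}" "c i j k \<noteq> 0"
  shows "p k = (p i \<noteq> p j)" "w k = w i + w j"
  using constants_homogeneous[of "c i j" "p i \<noteq> p j" "- int (w i) + - int (w j)" k] assms
    vbracket_vpart[OF frame_part frame_part, of i j] vbracket_vgrade[OF frame_grade frame_grade, of i j]
  unfolding frame_bracket[OF assms(1,2)] by simp_all

lemma square_constant_homogeneous:
  assumes "CHAR('a) = 2" "i \<in> {1..n}" "p i" "k \<in> {1..n}" "s i k \<noteq> 0"
  shows "w k = 2 * w i"
  using constants_homogeneous[of "s i" False "- int (w i) + - int (w i)" k] assms
    vcomp_vpart[OF frame_part frame_part, of i i] vcomp_vgrade[OF frame_grade frame_grade, of i i]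
  unfolding frame_square[OF assms(1-3)] by simp

lemma vact_frame_bracket:
  assumes "i \<in> {1..n}" "j \<in> {1..n}" "f \<in> superfuns n p"
  shows "vact p (F i) (vact p (F j) f) - fscale (koszul (p i) (p j)) (vact p (F j) (vact p (F i) f)) =
    (\<Sum>k\<in>{1..n}. fscale (c i j k) (vact p (F k) f))"
  using vact_vbracket[OF frame_part[OF assms(1)] frame_part[OF assms(2)] assms(3)]
  by (simp add: frame_bracket[OF assms(1,2)] vact_sum_left vact_vscale)

text \<open>In characteristic 2 the bracket constants \<open>c\<close> give no information about the
  operator square of an odd \<open>F i\<close>; the constants \<open>s\<close> supply it.\<close>

lemma vact_frame_square:
  assumes "CHAR('a) = 2" "i \<in> {1..n}" "p i" "f \<in> superfuns n p"
  shows "vact p (F i) (vact p (F i) f) = (\<Sum>k\<in>{1..n}. fscale (s i k) (vact p (F k) f))"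
proof -
  have "F i \<in> vpart n p True" using frame_part[OF assms(2)] assms(3) by simp
  from vact_square_char_2[OF assms(1) this assms(4)] show ?thesis
    by (simp add: frame_square[OF assms(1-3)] vact_sum_left vact_vscale)
qed

text \<open>The integrability conditions of the system with left-hand sides
  \<open>vact p (F j) f\<close> and right-hand sides \<open>g j\<close>: the 1-cocycle condition
  with values in functions, supplemented in characteristic 2 by a condition on squares. The signs
  are the same for \<open>f\<close> of either parity, since the fields act from the left.\<close>

definition cocycle :: "(nat \<Rightarrow> 'a superfun) \<Rightarrow> bool" where
  "cocycle g \<longleftrightarrow>
    (\<forall>i\<in>{1..n}. \<forall>j\<in>{1..n}. vact p (F i) (g j) - fscale (koszul (p i) (p j)) (vact p (F j) (g i)) =
      (\<Sum>k\<in>{1..n}. fscale (c i j k) (g k))) \<and>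
    (CHAR('a) = 2 \<longrightarrow> (\<forall>i\<in>{1..n}. p i \<longrightarrow> vact p (F i) (g i) = (\<Sum>k\<in>{1..n}. fscale (s i k) (g k))))"

lemma cocycle_diff:
  assumes "cocycle g" "f \<in> superfuns n p"
  shows "cocycle (\<lambda>j. g j - vact p (F j) f)"
  unfolding cocycle_def
proof (intro conjI ballI impI)
  fix i j assume ij: "i \<in> {1..n}" "j \<in> {1..n}"
  have "vact p (F i) (g j) - fscale (koszul (p i) (p j)) (vact p (F j) (g i)) =
      (\<Sum>k\<in>{1..n}. fscale (c i j k) (g k))" using assms(1) ij by (simp add: cocycle_def)
  thus "vact p (F i) (g j - vact p (F j) f) - fscale (koszul (p i) (p j)) (vact p (F j) (g i - vact p (F i) f)) =
      (\<Sum>k\<in>{1..n}. fscale (c i j k) (g k - vact p (F k) f))"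
    using vact_frame_bracket[OF ij assms(2)]
    by (simp add: vact_diff_right fscale_diff sum_subtractf algebra_simps)
next
  fix i assume i: "CHAR('a) = 2" "i \<in> {1..n}" "p i"
  have "vact p (F i) (g i) = (\<Sum>k\<in>{1..n}. fscale (s i k) (g k))"
    using assms(1) i by (simp add: cocycle_def)
  thus "vact p (F i) (g i - vact p (F i) f) = (\<Sum>k\<in>{1..n}. fscale (s i k) (g k - vact p (F k) f))"
    using vact_frame_square[OF i assms(2)]
    by (simp add: vact_diff_right fscale_diff sum_subtractf)
qed

lemma fscale_eq_0: "fscale x f = 0 \<Longrightarrow> x = 0 \<or> f = (0 :: 'a superfun)"
proof -
  assume h: "fscale x f = 0"
  have "x * lookup f m = 0" for m using arg_cong[OF h, of "\<lambda>g. lookup g m"] by simp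
  thus ?thesis by (auto intro!: poly_mapping_eqI)
qed

lemma two_eq_0_CHAR: "(2::'a) = 0 \<Longrightarrow> CHAR('a) = 2"
proof -
  assume "(2::'a) = 0"
  hence "of_nat 2 = (0::'a)" by simp
  hence "CHAR('a) dvd 2" by (simp only: of_nat_eq_0_iff_char_dvd)
  hence "CHAR('a) \<le> 2" "CHAR('a) \<noteq> 0" using dvd_pos_nat[of 2 "CHAR('a)"] by (auto dest: dvd_imp_le)
  moreover have "CHAR('a) \<noteq> 1" by (rule CHAR_not_1[unfolded One_nat_def[symmetric]])
  ultimately show ?thesis by linarith
qed

text \<open>A nonzero constant \<open>c j K k\<close> or \<open>s K k\<close> forces
  \<open>w K < w k\<close>, hence \<open>K < k\<close>, where \<open>g\<close> vanishes; so the
  right-hand sides of the cocycle conditions drop out. For odd \<open>K\<close> the bracket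
  condition becomes twice \<open>vact p (F K) (g K)\<close> equal to 0, which is useless in
  characteristic 2; there the condition on squares takes over.\<close>

lemma cocycle_last:
  assumes g: "cocycle g" and gf: "\<And>j. j \<in> {1..n} \<Longrightarrow> g j \<in> superfuns n p"
    and K: "K \<in> {1..n}" and 0: "\<And>j. K < j \<Longrightarrow> j \<in> {1..n} \<Longrightarrow> g j = 0"
  shows "j \<in> {1..n} \<Longrightarrow> K < j \<Longrightarrow> pderivative p j (g K) = 0"
    and "p K \<Longrightarrow> pderivative p K (g K) = 0"
proof -
  have z: "(\<Sum>k\<in>{1..n}. fscale (c j K k) (g k)) = 0" if j: "j \<in> {1..n}" for j
  proof (rule sum.neutral, rule ballI)
    fix k assume k: "k \<in> {1..n}"
    show "fscale (c j K k) (g k) = 0"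
    proof (cases "c j K k = 0")
      case False
      hence "w K < w k"
        using structure_constant_homogeneous(2)[OF j K k] weight_pos[OF j] by simp
      thus ?thesis using 0[OF weight_less[OF K k] k] by simp
    qed simp
  qed
  have "vact p (F j) (g K) = 0" if "j \<in> {1..n}" "K < j" for j
  proof -
    have "vact p (F j) (g K) - fscale (koszul (p j) (p K)) (vact p (F K) (g j)) = 0"
      using g that K z[OF that(1)] by (simp add: cocycle_def)
    thus ?thesis using 0[OF that(2,1)] by simp
  qed
  thus d: "j \<in> {1..n} \<Longrightarrow> K < j \<Longrightarrow> pderivative p j (g K) = 0" for j
    using pderivative_0_if_vact_frame_0[OF gf[OF K]] by blast
  assume p: "p K"
  have "vact p (F K) (g K) = 0"
  proof (cases "CHAR('a) = 2")
    case True
    have "(\<Sum>k\<in>{1..n}. fscale (s K k) (g k)) = 0"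
    proof (rule sum.neutral, rule ballI)
      fix k assume k: "k \<in> {1..n}"
      show "fscale (s K k) (g k) = 0"
      proof (cases "s K k = 0")
        case False
        hence "w K < w k"
          using square_constant_homogeneous[OF True K p k] weight_pos[OF K] by simp
        thus ?thesis using 0[OF weight_less[OF K k] k] by simp
      qed simp
    qed
    thus ?thesis using g True K p by (simp add: cocycle_def)
  next
    case False
    have "vact p (F K) (g K) - fscale (koszul (p K) (p K)) (vact p (F K) (g K)) = 0"
      using g K z[OF K] by (simp add: cocycle_def)
    hence "fscale 2 (vact p (F K) (g K)) = 0"
      using p by (simp add: poly_mapping_eq_iff fun_eq_iff lookup_minus koszul_def)
    thus ?thesis using two_eq_0_CHAR False fscale_eq_0 by blast
  qed
  thus "pderivative p K (g K) = 0"
    using vact_frame[OF K gf[OF K]] d by simp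
qed

text \<open>A Poincare lemma, \<open>H\<^sup>1 = 0\<close>: one integrates in the last variable on whose component the
  cocycle does not vanish; the remaining variables of higher index do not occur there.\<close>

lemma cocycle_exact:
  assumes g: "cocycle g"
    and gh: "\<And>j. j \<in> {1..n} \<Longrightarrow> g j \<in> fparity n p (a \<noteq> p j)"
      "\<And>j. j \<in> {1..n} \<Longrightarrow> g j \<in> fgrade n p w (D - int (w j))"
  obtains f where "f \<in> fparity n p a" "f \<in> fgrade n p w D" "lookup f 0 = 0"
    "\<And>j. j \<in> {1..n} \<Longrightarrow> vact p (F j) f = g j"
proof -
  have "\<exists>f. f \<in> fparity n p a \<and> f \<in> fgrade n p w D \<and> lookup f 0 = 0 \<and> (\<forall>j\<in>{1..n}. vact p (F j) f = g j)"
    if "K \<le> n" "\<And>j. K < j \<Longrightarrow> j \<in> {1..n} \<Longrightarrow> g j = 0" "cocycle g"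
      "\<And>j. j \<in> {1..n} \<Longrightarrow> g j \<in> fparity n p (a \<noteq> p j)"
      "\<And>j. j \<in> {1..n} \<Longrightarrow> g j \<in> fgrade n p w (D - int (w j))" for K g
    using that
  proof (induction K arbitrary: g)
    case 0
    thus ?case by (intro exI[of _ 0]) auto
  next
    case (Suc K)
    let ?K = "Suc K"
    have K: "?K \<in> {1..n}" using Suc.prems(1) by auto
    have gf: "g j \<in> superfuns n p" if "j \<in> {1..n}" for j
      using Suc.prems(4)[OF that] by (rule fparity_superfuns)
    have last: "pderivative p j (g ?K) = 0" if "?K < j" "j \<in> {1..n}" for j
      using cocycle_last(1)[OF Suc.prems(3) gf K Suc.prems(2) that(2,1)] by blast
    have last': "pderivative p ?K (g ?K) = 0" if "p ?K"
      using cocycle_last(2)[OF Suc.prems(3) gf K Suc.prems(2) that] by blast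
    obtain f where f: "f \<in> fparity n p ((a \<noteq> p ?K) \<noteq> p ?K)" "f \<in> fgrade n p w (D - int (w ?K) + int (w ?K))"
      "pderivative p ?K f = g ?K" "lookup f 0 = 0"
      "\<And>j. j \<noteq> ?K \<Longrightarrow> pderivative p j (g ?K) = 0 \<Longrightarrow> pderivative p j f = 0"
      using integral_exists[OF Suc.prems(4)[OF K] Suc.prems(5)[OF K] K last'] by blast
    have f1: "f \<in> fparity n p a" and f2: "f \<in> fgrade n p w D" using f(1,2) by (cases "p ?K"; simp)+
    have fs: "f \<in> superfuns n p" using f1 by (rule fparity_superfuns)
    have d0: "pderivative p j f = 0" if "j \<in> {1..n}" "?K < j" for j
      using f(5)[of j] last[OF that(2,1)] that(2) by auto
    \<comment> \<open>\<open>f\<close> does not involve the variables after \<open>?K\<close>, so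
      the equations beyond \<open>?K\<close> stay satisfied while the one at \<open>?K\<close>
      becomes solved. Subtracting this coboundary leaves a cocycle that vanishes already after
      \<open>K\<close>.\<close>
    have X0: "vact p (F j) f = 0" if "j \<in> {1..n}" "?K < j" for j
      using that by (simp add: vact_frame[OF that(1) fs] d0)
    have XK: "vact p (F ?K) f = g ?K"
      by (simp add: vact_frame[OF K fs] d0 f(3))
    have "\<exists>h. h \<in> fparity n p a \<and> h \<in> fgrade n p w D \<and> lookup h 0 = 0 \<and>
      (\<forall>j\<in>{1..n}. vact p (F j) h = g j - vact p (F j) f)"
    proof (rule Suc.IH)
      show "g j - vact p (F j) f = 0" if "K < j" "j \<in> {1..n}" for j
        using that X0[of j] XK Suc.prems(2)[of j] by (cases "j = ?K") auto
      show "cocycle (\<lambda>j. g j - vact p (F j) f)" by (rule cocycle_diff[OF Suc.prems(3) fs])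
      fix j assume j: "j \<in> {1..n}"
      have "(p j \<noteq> a) = (a \<noteq> p j)" by auto
      thus "g j - vact p (F j) f \<in> fparity n p (a \<noteq> p j)"
        using vact_fparity[OF frame_part[OF j] f1] by (intro fparity_diff Suc.prems(4) j) simp
      show "g j - vact p (F j) f \<in> fgrade n p w (D - int (w j))"
        using vact_fgrade[OF frame_grade[OF j] f2] by (intro fgrade_diff Suc.prems(5) j) simp
    qed (use Suc.prems in auto)
    then obtain h where h: "h \<in> fparity n p a" "h \<in> fgrade n p w D" "lookup h 0 = 0"
      "\<And>j. j \<in> {1..n} \<Longrightarrow> vact p (F j) h = g j - vact p (F j) f" by blast
    show ?case
      by (rule exI[of _ "f + h"])
        (use f1 f2 f(4) h in \<open>auto simp: vact_add_right lookup_add intro: fparity_add fgrade_add\<close>)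
  qed
  from this[OF le_refl _ g gh] show thesis using that by auto
qed

text \<open>Starting from the constant field \<open>vpartial i\<close>, one later component is added
  at a time. Commutation with the frame at a given component is a system for that component whose
  right-hand side depends only on components already found; the Poincare lemma solves it, without a
  constant term, so the value at the origin is kept.\<close>

lemma centralizing_field_exists:
  assumes i: "i \<in> {1..n}"
  obtains Y where "Y \<in> vpart n p (p i)" "Y \<in> vgrade n p w (- int (w i))" "value_at_0 Y = vpartial i"
    "\<And>j. j \<in> {1..n} \<Longrightarrow> vbracket p (F j) Y = 0"
proof -
  have step: "\<exists>Y. Y \<in> vpart n p (p i) \<and> Y \<in> vgrade n p w (- int (w i)) \<and>
      (\<forall>k. lookup (lookup Y k) 0 = (if k = i then 1 else 0)) \<and> (\<forall>k>l. lookup Y k = 0) \<and>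
      (\<forall>j\<in>{1..n}. \<forall>k\<le>l. lookup (vbracket p (F j) Y) k = 0)" if "i \<le> l" "l \<le> n" for l
    using that
  proof (induction l rule: dec_induct)
    case base
    let ?Y = "vpartial i :: 'a vfield"
    have lY: "lookup ?Y k = fconst (if k = i then 1 else 0)" for k
      by (simp add: vpartial_def lookup_single_if)
    have v: "?Y \<in> vfields n p" using i by (auto simp: vfields_iff lY)
    have Yp: "?Y \<in> vpart n p (p i)"
      using v by (auto simp: vpart_iff lY intro: fconst_fparity)
    have Yg: "?Y \<in> vgrade n p w (- int (w i))"
      using v by (auto simp: vgrade_iff lY intro: fconst_fgrade)
    have "lookup (vbracket p (F j) ?Y) k = 0" if j: "j \<in> {1..n}" and k: "k \<le> i" for j k
    proof -
      have "vact p ?Y (lookup (F j) k) = 0"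
      proof (cases "k \<in> {1..n}")
        case True
        have "vact p ?Y (lookup (F j) k) \<in> fgrade n p w (- int (w i) + (int (w k) - int (w j)))"
          by (rule vact_fgrade[OF Yg frame_lookup_grade[OF j]])
        thus ?thesis
          by (rule fgrade_negative) (use weight_le[OF True i k] weight_pos[OF j] in simp)
      next
        case False
        hence "lookup (F j) k = 0" using frame_vfields[OF j] by (simp add: vfields_iff)
        thus ?thesis by simp
      qed
      thus ?thesis by (simp add: vbracket_homogeneous[OF frame_part[OF j] Yp] lookup_minus lY)
    qed
    thus ?case using Yp Yg by (intro exI[of _ ?Y]) (simp add: lY fconst_def lookup_single_if)
  next
    case (step l)
    then obtain Y where Y: "Y \<in> vpart n p (p i)" "Y \<in> vgrade n p w (- int (w i))"
      "\<And>k. lookup (lookup Y k) 0 = (if k = i then 1 else 0)" "\<And>k. k > l \<Longrightarrow> lookup Y k = 0"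
      "\<And>j k. j \<in> {1..n} \<Longrightarrow> k \<le> l \<Longrightarrow> lookup (vbracket p (F j) Y) k = 0" by auto
    let ?L = "Suc l"
    have L: "?L \<in> {1..n}" using step by auto
    have Yv: "Y \<in> vfields n p" using Y(1) by (rule vpart_vfields)
    \<comment> \<open>For a field with only the component \<open>h\<close> at \<open>?L\<close>, the
      bracket with \<open>F j\<close> has component \<open>vact p (F j) h\<close> there, whereas
      that of \<open>Y\<close> has component \<open>- g j\<close>. Hence \<open>h\<close> has to
      solve the system with right-hand side \<open>g\<close>.\<close>
    define g where "g j = fscale (koszul (p j) (p i)) (vact p Y (lookup (F j) ?L))" for j
    have FL: "lookup (F j) ?L \<in> superfuns n p" if "j \<in> {1..n}" for j
      by (intro vfields_lookup[of _ n] frame_vfields that)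
    \<comment> \<open>The bracket of \<open>F j\<close> and \<open>Y\<close> has no components up to
      \<open>l\<close>, and the component of \<open>F b\<close> at \<open>?L\<close> does not
      involve the variables beyond \<open>l\<close>; so \<open>F j\<close> and \<open>Y\<close>
      supercommute on it. This makes \<open>g\<close> inherit the cocycle condition from the frame
      relations.\<close>
    have swap: "vact p (F j) (vact p Y (lookup (F b) ?L)) =
        fscale (koszul (p j) (p i)) (vact p Y (vact p (F j) (lookup (F b) ?L)))"
      if j: "j \<in> {1..n}" and b: "b \<in> {1..n}" for j b
    proof -
      have "fmult p (lookup (vbracket p (F j) Y) m) (pderivative p m (lookup (F b) ?L)) = 0"
        if m: "m \<in> {1..n}" for m
      proof (cases "m \<le> l")
        case False
        hence "pderivative p m (lookup (F b) ?L) = 0"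
          by (intro pderivative_frame_0 b m weight_le L) auto
        thus ?thesis by simp
      qed (simp add: Y(5)[OF j])
      hence "vact p (vbracket p (F j) Y) (lookup (F b) ?L) = 0"
        by (simp add: vact_eq[OF vbracket_vfields[OF frame_vfields[OF j] Yv]])
      thus ?thesis by (simp add: vact_vbracket[OF frame_part[OF j] Y(1) FL[OF b]])
    qed
    have coc: "cocycle g"
      unfolding cocycle_def
    proof (intro conjI ballI impI)
      fix a b assume a: "a \<in> {1..n}" and b: "b \<in> {1..n}"
      define x :: 'a where "x = koszul (p b) (p i) * koszul (p a) (p i)"
      have "vact p (F a) (g b) - fscale (koszul (p a) (p b)) (vact p (F b) (g a)) =
        fscale x (vact p Y (vact p (F a) (lookup (F b) ?L) -
          fscale (koszul (p a) (p b)) (vact p (F b) (lookup (F a) ?L))))"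
        by (simp add: g_def vact_fscale swap[OF a b] swap[OF b a] vact_diff_right fscale_diff x_def mult_ac)
      also have "vact p (F a) (lookup (F b) ?L) - fscale (koszul (p a) (p b)) (vact p (F b) (lookup (F a) ?L)) =
          lookup (vbracket p (F a) (F b)) ?L"
        by (simp add: vbracket_homogeneous[OF frame_part[OF a] frame_part[OF b]] lookup_minus)
      also have "\<dots> = (\<Sum>k\<in>{1..n}. fscale (c a b k) (lookup (F k) ?L))"
        by (simp add: frame_bracket[OF a b] Poly_Mapping.lookup_sum)
      also have "fscale x (vact p Y \<dots>) = (\<Sum>k\<in>{1..n}. fscale (c a b k) (g k))"
        unfolding vact_sum_right fscale_sum
      proof (intro sum.cong refl)
        fix k assume k: "k \<in> {1..n}"
        show "fscale x (vact p Y (fscale (c a b k) (lookup (F k) ?L))) = fscale (c a b k) (g k)"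
        proof (cases "c a b k = 0")
          case False
          have "koszul (p k) (p i) = x"
            using structure_constant_homogeneous(1)[OF a b k False] by (simp add: x_def koszul_xor mult_ac)
          thus ?thesis by (simp add: g_def vact_fscale mult_ac)
        qed simp
      qed
      finally show "vact p (F a) (g b) - fscale (koszul (p a) (p b)) (vact p (F b) (g a)) =
        (\<Sum>k\<in>{1..n}. fscale (c a b k) (g k))" .
    next
      fix a assume a: "CHAR('a) = 2" "a \<in> {1..n}" "p a"
      have "vact p (F a) (g a) = vact p Y (lookup (vcomp p (F a) (F a)) ?L)"
        by (simp add: g_def vact_fscale swap[OF a(2) a(2)])
      also have "\<dots> = (\<Sum>k\<in>{1..n}. fscale (s a k) (g k))"
        by (simp only: frame_square[OF a] Poly_Mapping.lookup_sum lookup_vscale vact_sum_right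
            vact_fscale g_def koszul_char_2[OF a(1)] fscale_one)
      finally show "vact p (F a) (g a) = (\<Sum>k\<in>{1..n}. fscale (s a k) (g k))" .
    qed
    have gp: "g j \<in> fparity n p ((p i \<noteq> p ?L) \<noteq> p j)" if "j \<in> {1..n}" for j
    proof -
      have "(p i \<noteq> (p j \<noteq> p ?L)) = ((p i \<noteq> p ?L) \<noteq> p j)" by auto
      thus ?thesis
        using vact_fparity[OF Y(1) vpart_lookup[OF frame_part[OF that], of ?L]]
        unfolding g_def by (intro fparity_fscale) simp
    qed
    have gg: "g j \<in> fgrade n p w (int (w ?L) - int (w i) - int (w j))" if "j \<in> {1..n}" for j
      using vact_fgrade[OF Y(2) frame_lookup_grade[OF that, of ?L]]
      unfolding g_def by (intro fgrade_fscale) (simp add: algebra_simps)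
    obtain h where h: "h \<in> fparity n p (p i \<noteq> p ?L)" "h \<in> fgrade n p w (int (w ?L) - int (w i))"
      "lookup h 0 = 0" "\<And>j. j \<in> {1..n} \<Longrightarrow> vact p (F j) h = g j"
      using cocycle_exact[OF coc gp gg] by metis
    let ?H = "single ?L h" and ?Y = "Y + single ?L h"
    have lH: "lookup ?H k = (if k = ?L then h else 0)" for k by (simp add: lookup_single_if)
    have Hv: "?H \<in> vfields n p" using L h(1) by (auto simp: vfields_iff lH fparity_superfuns)
    have Hp: "?H \<in> vpart n p (p i)" using Hv h(1) by (auto simp: vpart_iff lH)
    have Hg: "?H \<in> vgrade n p w (- int (w i))" using Hv h(2) by (auto simp: vgrade_iff lH)
    have "lookup (vbracket p (F j) ?Y) k = 0" if j: "j \<in> {1..n}" and k: "k \<le> ?L" for j k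
    proof -
      have "vact p ?H (lookup (F j) k) = 0"
      proof (cases "k \<in> {1..n}")
        case True
        have "vact p ?H (lookup (F j) k) = fmult p h (pderivative p ?L (lookup (F j) k))"
          by (simp add: vact_expand[where A = "{?L}"] lH)
        thus ?thesis using pderivative_frame_0[OF j L weight_le[OF True L k]] by simp
      next
        case False
        hence "lookup (F j) k = 0" using frame_vfields[OF j] by (simp add: vfields_iff)
        thus ?thesis by simp
      qed
      hence H: "lookup (vbracket p (F j) ?H) k = (if k = ?L then g j else 0)"
        by (simp add: vbracket_homogeneous[OF frame_part[OF j] Hp] lookup_minus lH h(4)[OF j])
      show ?thesis
      proof (cases "k = ?L")
        case True
        have "lookup (vbracket p (F j) Y) ?L = - g j"
          by (simp add: vbracket_homogeneous[OF frame_part[OF j] Y(1)] lookup_minus Y(4) g_def)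
        thus ?thesis using H True by (simp add: vbracket_add_right lookup_add)
      next
        case False
        thus ?thesis using H Y(5)[OF j] k by (simp add: vbracket_add_right lookup_add)
      qed
    qed
    moreover have "lookup (lookup ?Y k) 0 = (if k = i then 1 else 0)" for k
      using Y(3)[of k] h(3) step by (auto simp: lookup_add lH)
    moreover have "lookup ?Y k = 0" if "k > ?L" for k
      using Y(4)[of k] that by (simp add: lookup_add lH)
    ultimately show ?case
      using Y(1,2) Hp Hg by (intro exI[of _ ?Y]) (auto intro: vs.subspace_add[OF vpart_subspace] vs.subspace_add[OF vgrade_subspace])
  qed
  obtain Y where Y: "Y \<in> vpart n p (p i)" "Y \<in> vgrade n p w (- int (w i))"
    "\<And>k. lookup (lookup Y k) 0 = (if k = i then 1 else 0)"
    "\<And>j k. j \<in> {1..n} \<Longrightarrow> k \<le> n \<Longrightarrow> lookup (vbracket p (F j) Y) k = 0"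
    using step[of n] i by auto
  show thesis
  proof (rule that[OF Y(1,2)])
    show "value_at_0 Y = vpartial i"
      by (rule poly_mapping_eqI) (simp add: value_at_0_def vpartial_def lookup_map_zero lookup_single_if Y(3))
    show "vbracket p (F j) Y = 0" if j: "j \<in> {1..n}" for j
    proof (rule poly_mapping_eqI)
      fix k
      show "lookup (vbracket p (F j) Y) k = lookup 0 k"
        using Y(4)[OF j, of k] vbracket_vfields[OF frame_vfields[OF j] vpart_vfields[OF Y(1)]]
        by (cases "k \<le> n") (auto simp: vfields_iff)
    qed
  qed
qed

end

section \<open>The centralizer\<close>

lemma vparity_part_vbracket_left:
  assumes A: "A \<in> vpart n p a" and Z: "Z \<in> vfields n p"
  shows "vparity_part p b (vbracket p Z A) = vbracket p (vparity_part p (a \<noteq> b) Z) A"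
proof -
  obtain Y W where YW: "Z = Y + W" "Y \<in> vpart n p False" "W \<in> vpart n p True"
    using Z by (rule vparity_decompose)
  show ?thesis
    unfolding YW(1) vbracket_add_left vparity_part_add vparity_part_homogeneous[OF YW(2)]
      vparity_part_homogeneous[OF YW(3)] vparity_part_homogeneous[OF vbracket_vpart[OF YW(2) A]]
      vparity_part_homogeneous[OF vbracket_vpart[OF YW(3) A]]
    by (cases a; cases b) simp_all
qed

lemma vdegree_part_vbracket_left:
  assumes A: "A \<in> vgrade n p w l" and Z: "Z \<in> vfields n p"
  shows "vdegree_part w k (vbracket p Z A) = vbracket p (vdegree_part w (k - l) Z) A"
proof -
  interpret a: additive "vdegree_part w k"
    by unfold_locales (rule vdegree_part_add)
  let ?K = "insert (k - l) (vdegrees w Z)"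
  have "vbracket p Z A = vbracket p (\<Sum>j\<in>?K. vdegree_part w j Z) A"
    by (subst vdegree_part_sum) (auto simp: finite_vdegrees)
  also have "vdegree_part w k \<dots> = (\<Sum>j\<in>?K. vdegree_part w k (vbracket p (vdegree_part w j Z) A))"
    by (simp only: vbracket_sum_left a.sum)
  also have "\<dots> = (\<Sum>j\<in>?K. if j = k - l then vbracket p (vdegree_part w j Z) A else 0)"
    by (intro sum.cong refl) (auto simp: vdegree_part_homogeneous[OF vbracket_vgrade[OF vdegree_part_in[OF Z] A]])
  also have "\<dots> = vbracket p (vdegree_part w (k - l) Z) A" by (simp add: finite_vdegrees)
  finally show ?thesis .
qed

text \<open>Membership in the span is turned into a condition on degree parts, which can be tested
  on individual fields.\<close>

lemma vneg_iff:
  "Z \<in> vneg n p w \<longleftrightarrow> Z \<in> vfields n p \<and> (\<forall>k\<ge>0. vdegree_part w k Z = (0 :: 'k::field vfield))"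
proof
  have "vs.subspace {Z \<in> vfields n p. \<forall>k\<ge>0. vdegree_part w k Z = (0 :: 'k vfield)}"
  proof (rule vs.subspaceI)
    show "0 \<in> {Z \<in> vfields n p. \<forall>k\<ge>0. vdegree_part w k Z = (0 :: 'k vfield)}"
      using vdegree_part_vscale[of w _ 0 "0 :: 'k vfield"] by (simp add: vs.subspace_0 vfields_subspace)
  qed (auto simp: vdegree_part_add vdegree_part_vscale intro: vs.subspace_add[OF vfields_subspace]
      vs.subspace_scale[OF vfields_subspace])
  moreover have "(\<Union>k\<in>{..<0}. vgrade n p w k) \<subseteq> {Z \<in> vfields n p. \<forall>k\<ge>0. vdegree_part w k Z = (0 :: 'k vfield)}"
    by (auto simp: vdegree_part_homogeneous vgrade_vfields)
  ultimately have "vneg n p w \<subseteq> {Z \<in> vfields n p. \<forall>k\<ge>0. vdegree_part w k Z = (0 :: 'k vfield)}"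
    unfolding vneg_def by (intro vs.span_minimal)
  thus "Z \<in> vneg n p w \<Longrightarrow> Z \<in> vfields n p \<and> (\<forall>k\<ge>0. vdegree_part w k Z = 0)" by auto
next
  assume Z: "Z \<in> vfields n p \<and> (\<forall>k\<ge>0. vdegree_part w k Z = 0)"
  have "vdegree_part w k Z \<in> vneg n p w" for k
  proof (cases "k < 0")
    case True
    thus ?thesis unfolding vneg_def using Z vdegree_part_in[of Z n p w k] by (intro vs.span_base) auto
  next
    case False
    thus ?thesis using Z by (simp add: vneg_def vs.span_zero)
  qed
  hence "(\<Sum>k\<in>vdegrees w Z. vdegree_part w k Z) \<in> vneg n p w"
    unfolding vneg_def by (intro vs.span_sum)
  thus "Z \<in> vneg n p w" by (simp add: vdegree_part_sum finite_vdegrees)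
qed

lemma vgrade_vneg: "X \<in> vgrade n p w k \<Longrightarrow> k < 0 \<Longrightarrow> X \<in> vneg n p w"
  by (auto simp: vneg_iff vdegree_part_homogeneous vgrade_vfields)

text \<open>At the origin the result of the action depends on \<open>X\<close> only through its
  value there, so \<open>X\<close> may be exchanged for another field with the same value.\<close>

lemma lookup_vact_0_eq:
  "X \<in> vfields n p \<Longrightarrow> lookup (vact p X f) 0 = (\<Sum>i\<in>{1..n}. lookup (lookup X i) 0 * lookup (pderivative p i f) 0)"
  by (simp add: vact_eq Poly_Mapping.lookup_sum lookup_fmult_0)

lemma vparity_part_zero [simp]: "vparity_part p a 0 = 0"
  using vparity_part_vscale[of p a 0 0] by simp

text \<open>The centralizer is taken in all fields, where brackets and parity parts need no degree
  bookkeeping. Restricting to negative degrees does not change it, since it turns out to be spanned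
  by fields of negative degree.\<close>

definition centralized :: "nat \<Rightarrow> (nat \<Rightarrow> bool) \<Rightarrow> (nat \<Rightarrow> 'k::field vfield) \<Rightarrow> 'k vfield set" where
  "centralized n p F = {Z \<in> vfields n p. \<forall>j\<in>{1..n}. vbracket p (F j) Z = 0}"

section \<open>Rigidity of centralizing fields\<close>

context super_frame
begin

lemma centralized_subspace: "vs.subspace (centralized n p F)"
  unfolding centralized_def
  by (rule vs.subspaceI) (auto simp: vbracket_add_right vbracket_vscale_right
      intro: vs.subspace_0[OF vfields_subspace] vs.subspace_add[OF vfields_subspace] vs.subspace_scale[OF vfields_subspace])

lemma centralized_vparity_part:
  assumes "Z \<in> centralized n p F" shows "vparity_part p a Z \<in> centralized n p F"
  unfolding centralized_def
proof (intro CollectI conjI ballI)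
  have Z: "Z \<in> vfields n p" using assms by (simp add: centralized_def)
  thus "vparity_part p a Z \<in> vfields n p" using vparity_part_in vpart_vfields by blast
  fix j assume j: "j \<in> {1..n}"
  hence "vbracket p (F j) Z = 0" using assms by (simp add: centralized_def)
  thus "vbracket p (F j) (vparity_part p a Z) = 0"
    using vparity_part_vbracket[OF frame_part[OF j] Z, of "p j \<noteq> a"] by (cases "p j"; cases a) simp_all
qed

lemma centralized_vbracket:
  assumes A: "A \<in> centralized n p F" and B: "B \<in> centralized n p F"
  shows "vbracket p A B \<in> centralized n p F"
proof -
  have *: "vbracket p A B \<in> centralized n p F"
    if A: "A \<in> centralized n p F" "A \<in> vpart n p a" and B: "B \<in> centralized n p F" "B \<in> vpart n p b" for A B a b
    unfolding centralized_def
  proof (intro CollectI conjI ballI)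
    show "vbracket p A B \<in> vfields n p" using A B by (intro vbracket_vfields) (auto simp: centralized_def)
    fix j assume j: "j \<in> {1..n}"
    thus "vbracket p (F j) (vbracket p A B) = 0"
      using A(1) B(1) by (simp add: vbracket_jacobi[OF frame_part[OF j] A(2) B(2)] centralized_def)
  qed
  have v: "A \<in> vfields n p" "B \<in> vfields n p" using A B by (simp_all add: centralized_def)
  have "vbracket p (vparity_part p False A + vparity_part p True A) (vparity_part p False B + vparity_part p True B)
      \<in> centralized n p F"
    unfolding vbracket_add_left vbracket_add_right
    by (intro vs.subspace_add centralized_subspace *[OF centralized_vparity_part vparity_part_in
      centralized_vparity_part vparity_part_in] A B v)
  thus ?thesis by (simp flip: vparity_part_sum)
qed

lemma centralized_square:
  assumes c: "CHAR('k) = 2" and A: "A \<in> centralized n p F" "A \<in> vpart n p True"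
  shows "vcomp p A A \<in> centralized n p F"
  unfolding centralized_def
proof (intro CollectI conjI ballI)
  show "vcomp p A A \<in> vfields n p" using A by (intro vcomp_vfields) (auto simp: centralized_def)
  fix j assume j: "j \<in> {1..n}"
  have "vcomp p A A \<in> vpart n p False" using vcomp_vpart[OF A(2,2)] by simp
  hence "vbracket p (F j) (vcomp p A A) = vscale (- 1) (vbracket p A (vbracket p A (F j)))"
    using vbracket_swap[OF frame_part[OF j]] vbracket_square_char_2[OF c A(2) frame_part[OF j]] by simp
  also have "vbracket p A (F j) = 0"
    using vbracket_swap[OF A(2) frame_part[OF j]] A(1) j by (simp add: centralized_def)
  finally show "vbracket p (F j) (vcomp p A A) = 0" by simp
qed

text \<open>The rigidity principle: identities between fields that commute with the frame need only
  be checked at the origin.\<close>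

lemma centralized_eqI:
  assumes "A \<in> centralized n p F" "B \<in> centralized n p F"
    and "\<And>k. lookup (lookup A k) 0 = lookup (lookup B k) 0"
  shows "A = B"
proof -
  have "A - B \<in> centralized n p F" using assms by (intro vs.subspace_diff centralized_subspace)
  moreover have "lookup (lookup (A - B) k) 0 = 0" for k
    unfolding lookup_minus assms(3) by simp
  ultimately have "A - B = 0"
    by - (rule centralizing_determined, auto simp: centralized_def)
  thus ?thesis by simp
qed

lemma inj_frame: "inj_on F {1..n}"
proof (rule inj_onI)
  fix i j assume ij: "i \<in> {1..n}" "j \<in> {1..n}" "F i = F j"
  have "lookup (lookup (F i) i) 0 = lookup (lookup (F j) i) 0" using ij by simp
  thus "i = j" using ij(1,2) by (simp add: frame_const split: if_splits)
qed

lemma frame_span: "vs.span (F ` {1..n}) = range (\<lambda>a. \<Sum>i\<in>{1..n}. vscale (a i) (F i))"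
proof -
  have "vs.span (F ` {1..n}) = range (\<lambda>u. \<Sum>i\<in>{1..n}. vscale (u (F i)) (F i))"
    by (simp add: vs.span_finite sum.reindex[OF inj_frame])
  also have "\<dots> = range (\<lambda>a. \<Sum>i\<in>{1..n}. vscale (a i) (F i))"
  proof (intro equalityI subsetI)
    fix x assume "x \<in> range (\<lambda>a. \<Sum>i\<in>{1..n}. vscale (a i) (F i))"
    then obtain a where "x = (\<Sum>i\<in>{1..n}. vscale (a i) (F i))" by auto
    also have "\<dots> = (\<Sum>i\<in>{1..n}. vscale ((\<lambda>v. a (the_inv_into {1..n} F v)) (F i)) (F i))"
      by (intro sum.cong refl) (simp add: the_inv_into_f_f[OF inj_frame])
    finally show "x \<in> range (\<lambda>u. \<Sum>i\<in>{1..n}. vscale (u (F i)) (F i))"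
      by (intro range_eqI[of _ _ "\<lambda>v. a (the_inv_into {1..n} F v)"])
  qed auto
  finally show ?thesis .
qed

lemma frame_family_basis: "family_basis vscale {1..n} F (vs.span (F ` {1..n}))"
  unfolding family_basis_def
proof (intro conjI refl inj_frame notI)
  assume "vs.dependent (F ` {1..n})"
  then obtain u where u: "\<exists>v\<in>F ` {1..n}. u v \<noteq> 0" "(\<Sum>v\<in>F ` {1..n}. vscale (u v) v) = 0"
    by (auto simp: vs.dependent_finite)
  then obtain i where i: "i \<in> {1..n}" "u (F i) \<noteq> 0" by auto
  have "(\<Sum>i\<in>{1..n}. vscale (u (F i)) (F i)) = 0" using u(2) by (simp add: sum.reindex[OF inj_frame])
  thus False using lookup_span_0[OF i(1), of "\<lambda>i. u (F i)"] i(2) by simp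
qed

lemma frame_span_value:
  assumes "Z \<in> vs.span (F ` {1..n})"
  shows "Z = (\<Sum>k\<in>{1..n}. vscale (lookup (lookup Z k) 0) (F k))"
proof -
  obtain a where a: "Z = (\<Sum>i\<in>{1..n}. vscale (a i) (F i))" using assms frame_span by auto
  hence "lookup (lookup Z k) 0 = a k" if "k \<in> {1..n}" for k using lookup_span_0[OF that] by simp
  thus ?thesis by (subst a) simp
qed

text \<open>By rigidity a centralizing field is the combination of the \<open>H j\<close> whose
  coefficients are its own values at the origin. Applied with the two frames in either order, it
  shows that each span is the centralizer of the other.\<close>

lemma span_frame_eq_centralized:
  assumes H: "super_frame n p w H" and c: "\<And>i j. i \<in> {1..n} \<Longrightarrow> j \<in> {1..n} \<Longrightarrow> vbracket p (F i) (H j) = 0"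
  shows "vs.span (H ` {1..n}) = centralized n p F"
proof -
  interpret H: super_frame n p w H by (rule H)
  have Hc: "H j \<in> centralized n p F" if "j \<in> {1..n}" for j
    using that c H.frame_vfields by (auto simp: centralized_def)
  show ?thesis
  proof
    show "vs.span (H ` {1..n}) \<subseteq> centralized n p F"
      by (rule vs.span_minimal) (use Hc centralized_subspace in auto)
    show "centralized n p F \<subseteq> vs.span (H ` {1..n})"
    proof
      fix Z assume Z: "Z \<in> centralized n p F"
      let ?W = "\<Sum>k\<in>{1..n}. vscale (lookup (lookup Z k) 0) (H k)"
      have "Z = ?W"
      proof (rule centralized_eqI[OF Z])
        show W: "?W \<in> centralized n p F"
          by (intro vs.subspace_sum vs.subspace_scale centralized_subspace Hc)
        show "lookup (lookup Z k) 0 = lookup (lookup ?W k) 0" for k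
        proof (cases "k \<in> {1..n}")
          case True
          thus ?thesis by (simp only: H.lookup_span_0)
        next
          case False
          hence "lookup Z k = 0" "lookup ?W k = 0"
            using Z W unfolding centralized_def vfields_iff by blast+
          thus ?thesis by simp
        qed
      qed
      moreover have "?W \<in> vs.span (H ` {1..n})" by (intro vs.span_sum vs.span_scale vs.span_base) simp
      ultimately show "Z \<in> vs.span (H ` {1..n})" by simp
    qed
  qed
qed

lemma coef_combination:
  assumes "\<And>i. i \<in> {1..n} \<Longrightarrow> g i \<in> superfuns n p" "k \<in> {1..n}"
  shows "frame_coef p F (\<Sum>i\<in>{1..n}. fsmult p (g i) (F i)) k = g k"
proof -
  have "frame_coef p F (\<Sum>i\<in>{1..n}. fsmult p (g i) (F i)) k = (\<Sum>i\<in>{1..n}. if i = k then g k else 0)"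
    unfolding additive.sum[OF additive_coef]
    by (intro sum.cong refl) (use assms in \<open>auto simp: coef_fsmult frame_vfields coef_frame fmult_fconst_right[of _ n]\<close>)
  thus ?thesis using assms(2) by simp
qed

end

section \<open>Two mutually centralizing frames\<close>

context super_lie_frame
begin

text \<open>The choice is only apparent: by \<open>centralized_eqI\<close> the commutation relations
  and the value at the origin leave a single candidate.\<close>

definition dual_frame :: "nat \<Rightarrow> 'a vfield" where
  "dual_frame i = (SOME Y. Y \<in> vpart n p (p i) \<and> Y \<in> vgrade n p w (- int (w i)) \<and>
     value_at_0 Y = vpartial i \<and> (\<forall>j\<in>{1..n}. vbracket p (F j) Y = 0))"

lemma dual_frame:
  assumes "i \<in> {1..n}"
  shows "dual_frame i \<in> vpart n p (p i)" "dual_frame i \<in> vgrade n p w (- int (w i))"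
    "value_at_0 (dual_frame i) = vpartial i" "\<And>j. j \<in> {1..n} \<Longrightarrow> vbracket p (F j) (dual_frame i) = 0"
proof -
  obtain Y where "Y \<in> vpart n p (p i) \<and> Y \<in> vgrade n p w (- int (w i)) \<and>
     value_at_0 Y = vpartial i \<and> (\<forall>j\<in>{1..n}. vbracket p (F j) Y = 0)"
    using centralizing_field_exists[OF assms] by metis
  hence "dual_frame i \<in> vpart n p (p i) \<and> dual_frame i \<in> vgrade n p w (- int (w i)) \<and>
     value_at_0 (dual_frame i) = vpartial i \<and> (\<forall>j\<in>{1..n}. vbracket p (F j) (dual_frame i) = 0)"
    unfolding dual_frame_def by (rule someI)
  thus "dual_frame i \<in> vpart n p (p i)" "dual_frame i \<in> vgrade n p w (- int (w i))"
    "value_at_0 (dual_frame i) = vpartial i" "\<And>j. j \<in> {1..n} \<Longrightarrow> vbracket p (F j) (dual_frame i) = 0" by auto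
qed

sublocale dual: super_frame n p w dual_frame
  by unfold_locales (auto simp: dual_frame weight_pos weight_mono)

lemma dual_frame_commutes:
  assumes "i \<in> {1..n}" "j \<in> {1..n}" shows "vbracket p (dual_frame i) (F j) = 0"
  using vbracket_swap[OF dual.frame_part[OF assms(1)] frame_part[OF assms(2)]] assms
  by (simp add: dual_frame)

lemma span_dual_frame: "vs.span (dual_frame ` {1..n}) = centralized n p F"
  by (rule span_frame_eq_centralized) (auto simp: dual_frame dual.super_frame_axioms)

lemma span_frame: "vs.span (F ` {1..n}) = centralized n p dual_frame"
  by (rule dual.span_frame_eq_centralized) (auto simp: dual_frame_commutes super_frame_axioms)

lemma centralized_commute:
  assumes A: "A \<in> centralized n p dual_frame" and B: "B \<in> centralized n p F"
  shows "vbracket p A B = 0"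
proof -
  have "A = (\<Sum>k\<in>{1..n}. vscale (lookup (lookup A k) 0) (F k))"
    using A frame_span_value by (simp add: span_frame)
  moreover have "vbracket p (F k) B = 0" if "k \<in> {1..n}" for k using B that by (simp add: centralized_def)
  ultimately show ?thesis
    by (metis (no_types, lifting) sum.neutral vbracket_sum_left vbracket_vscale_left vs.scale_zero_right)
qed

text \<open>The isomorphism between the two mutually centralizing algebras, up to a sign: the vector
  field with the same value at the origin.\<close>

definition transpose_field :: "'a vfield \<Rightarrow> 'a vfield" where
  "transpose_field X = (\<Sum>k\<in>{1..n}. vscale (lookup (lookup X k) 0) (dual_frame k))"

lemma transpose_field_centralized: "transpose_field X \<in> centralized n p F"
  unfolding transpose_field_def span_dual_frame[symmetric]
  by (intro vs.span_sum vs.span_scale vs.span_base) simp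

lemma transpose_field_value:
  "X \<in> vfields n p \<Longrightarrow> lookup (lookup (transpose_field X) k) 0 = lookup (lookup X k) 0"
proof (cases "k \<in> {1..n}")
  case True
  thus ?thesis unfolding transpose_field_def by (rule dual.lookup_span_0)
next
  case False
  moreover have "transpose_field X \<in> vfields n p"
    using transpose_field_centralized[of X] by (simp add: centralized_def)
  ultimately have "lookup (transpose_field X) k = 0" unfolding vfields_iff by blast
  moreover assume "X \<in> vfields n p"
  hence "lookup X k = 0" using False unfolding vfields_iff by blast
  ultimately show ?thesis by simp
qed

lemma transpose_field_add: "transpose_field (X + Y) = transpose_field X + transpose_field Y"
  by (simp add: transpose_field_def lookup_add vs.scale_left_distrib sum.distrib)

lemma transpose_field_vscale: "transpose_field (vscale a X) = vscale a (transpose_field X)"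
  by (simp add: transpose_field_def vs.scale_sum_right)

lemma transpose_field_frame: "i \<in> {1..n} \<Longrightarrow> transpose_field (F i) = dual_frame i"
  by (rule centralized_eqI[OF transpose_field_centralized])
    (auto simp: transpose_field_value frame_vfields centralized_def dual.frame_vfields dual_frame
      frame_const dual.frame_const)

lemma transpose_field_vpart:
  assumes "X \<in> vpart n p a" shows "transpose_field X \<in> vpart n p a"
  unfolding transpose_field_def
proof (rule vs.subspace_sum[OF vpart_subspace])
  fix k assume k: "k \<in> {1..n}"
  show "vscale (lookup (lookup X k) 0) (dual_frame k) \<in> vpart n p a"
  proof (cases "lookup (lookup X k) 0 = 0")
    case True
    thus ?thesis by (simp add: vs.subspace_0[OF vpart_subspace])
  next
    case False
    hence "p k = a" using vpart_lookup[OF assms, of k] by (force simp: fparity_def Poly_Mapping.in_keys_iff)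
    thus ?thesis using dual.frame_part[OF k] by (auto intro: vs.subspace_scale[OF vpart_subspace])
  qed
qed

text \<open>Since \<open>X'\<close> commutes with \<open>?Y\<close>, applying \<open>X'\<close> to a
  component of \<open>?Y\<close> equals, up to sign, applying \<open>?Y\<close> to that component of
  \<open>X'\<close>. At the origin the acting fields may be replaced by \<open>?Y'\<close> and
  \<open>X\<close>, which have the same values there.\<close>

lemma vcomp_transpose_value:
  assumes X: "X \<in> centralized n p dual_frame" "X \<in> vpart n p a"
    and X': "X' \<in> centralized n p dual_frame" "X' \<in> vpart n p b"
  shows "lookup (lookup (vcomp p X X') k) 0 =
    koszul a b * lookup (lookup (vcomp p (transpose_field X') (transpose_field X)) k) 0"
proof -
  let ?Y = "transpose_field X" and ?Y' = "transpose_field X'"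
  note Y = transpose_field_centralized[of X] transpose_field_vpart[OF X(2)]
  note Y' = transpose_field_centralized[of X'] transpose_field_vpart[OF X'(2)]
  note v = vpart_vfields[OF X(2)] vpart_vfields[OF X'(2)] vpart_vfields[OF Y(2)] vpart_vfields[OF Y'(2)]
  have "lookup (vbracket p X' ?Y) k = 0" using centralized_commute[OF X'(1) Y(1)] by simp
  hence "vact p X' (lookup ?Y k) = fscale (koszul b a) (vact p ?Y (lookup X' k))"
    by (simp add: vbracket_homogeneous[OF X'(2) Y(2)] lookup_minus)
  hence "fscale (koszul a b) (vact p X' (lookup ?Y k)) = vact p ?Y (lookup X' k)"
    by (simp add: koszul_commute[of b a])
  hence "koszul a b * lookup (vact p X' (lookup ?Y k)) 0 = lookup (vact p ?Y (lookup X' k)) 0"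
    by (metis lookup_fscale)
  moreover have "lookup (vact p ?Y (lookup X' k)) 0 = lookup (vact p X (lookup X' k)) 0"
    "lookup (vact p X' (lookup ?Y k)) 0 = lookup (vact p ?Y' (lookup ?Y k)) 0"
    using v by (simp_all add: lookup_vact_0_eq transpose_field_value)
  ultimately show ?thesis by simp
qed

text \<open>Both sides commute with the frame, so their values at the origin decide. Transposition
  reverses the order of a composition there, and antisymmetrizing turns the reversal into the minus
  sign.\<close>

lemma transpose_field_vbracket:
  assumes X: "X \<in> centralized n p dual_frame" "X \<in> vpart n p a"
    and X': "X' \<in> centralized n p dual_frame" "X' \<in> vpart n p b"
  shows "vbracket p (transpose_field X) (transpose_field X') = - transpose_field (vbracket p X X')"
proof (rule centralized_eqI)
  note Y = transpose_field_vpart[OF X(2)]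
  note Y' = transpose_field_vpart[OF X'(2)]
  show "vbracket p (transpose_field X) (transpose_field X') \<in> centralized n p F"
    by (intro centralized_vbracket transpose_field_centralized)
  show "- transpose_field (vbracket p X X') \<in> centralized n p F"
    by (intro vs.subspace_neg centralized_subspace transpose_field_centralized)
  show "lookup (lookup (vbracket p (transpose_field X) (transpose_field X')) k) 0 =
      lookup (lookup (- transpose_field (vbracket p X X')) k) 0" for k
    using vcomp_transpose_value[OF X X', of k] vcomp_transpose_value[OF X' X, of k]
    by (simp add: transpose_field_value vbracket_vfields vpart_vfields[OF X(2)] vpart_vfields[OF X'(2)])
      (simp add: vbracket_homogeneous[OF Y Y'] vbracket_homogeneous[OF X(2) X'(2)] lookup_minus koszul_commute[of b a])
qed

text \<open>A homomorphism must respect brackets of arbitrary elements of the carrier, so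
  homogeneity is removed by splitting both arguments.\<close>

lemma transpose_field_vbracket_centralized:
  assumes X: "X \<in> centralized n p dual_frame" and X': "X' \<in> centralized n p dual_frame"
  shows "vbracket p (transpose_field X) (transpose_field X') = - transpose_field (vbracket p X X')"
proof -
  have v: "X \<in> vfields n p" "X' \<in> vfields n p" using X X' by (simp_all add: centralized_def)
  have "vbracket p (transpose_field (vparity_part p a X)) (transpose_field (vparity_part p b X')) =
      - transpose_field (vbracket p (vparity_part p a X) (vparity_part p b X'))" for a b
    by (rule transpose_field_vbracket[OF dual.centralized_vparity_part[OF X] vparity_part_in[OF v(1)]
      dual.centralized_vparity_part[OF X'] vparity_part_in[OF v(2)]])
  hence "vbracket p (transpose_field (vparity_part p False X + vparity_part p True X))
      (transpose_field (vparity_part p False X' + vparity_part p True X')) =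
      - transpose_field (vbracket p (vparity_part p False X + vparity_part p True X)
        (vparity_part p False X' + vparity_part p True X'))"
    by (simp only: transpose_field_add vbracket_add_left vbracket_add_right minus_add_distrib)
  thus ?thesis by (simp flip: vparity_part_sum)
qed

lemma transpose_field_square:
  assumes c: "CHAR('a) = 2" and X: "X \<in> centralized n p dual_frame" "X \<in> vpart n p True"
  shows "vcomp p (transpose_field X) (transpose_field X) = transpose_field (vcomp p X X)"
proof (rule centralized_eqI)
  show "vcomp p (transpose_field X) (transpose_field X) \<in> centralized n p F"
    by (intro centralized_square c transpose_field_centralized transpose_field_vpart X)
  show "lookup (lookup (vcomp p (transpose_field X) (transpose_field X)) k) 0 =
      lookup (lookup (transpose_field (vcomp p X X)) k) 0" for k
    using vcomp_transpose_value[OF X X, of k] vpart_vfields[OF X(2)]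
    by (simp only: transpose_field_value vcomp_vfields koszul_char_2[OF c] mult_1)
qed (rule transpose_field_centralized)

lemma frame_centralized: "i \<in> {1..n} \<Longrightarrow> F i \<in> centralized n p dual_frame"
  by (simp add: centralized_def frame_vfields dual_frame_commutes)

lemma dual_frame_vbracket:
  assumes "i \<in> {1..n}" "j \<in> {1..n}"
  shows "vbracket p (dual_frame i) (dual_frame j) = - (\<Sum>k\<in>{1..n}. vscale (c i j k) (dual_frame k))"
proof -
  have "additive transpose_field" by unfold_locales (rule transpose_field_add)
  hence "transpose_field (vbracket p (F i) (F j)) = (\<Sum>k\<in>{1..n}. transpose_field (vscale (c i j k) (F k)))"
    unfolding frame_bracket[OF assms] by (rule additive.sum)
  hence "transpose_field (vbracket p (F i) (F j)) = (\<Sum>k\<in>{1..n}. vscale (c i j k) (dual_frame k))"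
    by (simp add: transpose_field_vscale transpose_field_frame)
  thus ?thesis
    using transpose_field_vbracket[OF frame_centralized[OF assms(1)] frame_part[OF assms(1)]
      frame_centralized[OF assms(2)] frame_part[OF assms(2)]] assms
    by (simp add: transpose_field_frame)
qed

section \<open>The centralizer and its normalized basis\<close>

lemma centralizer_eq:
  "lsa_centralizer (vect n p) (vneg n p w) (vs.span (F ` {1..n})) = centralized n p F"
proof (intro equalityI subsetI)
  fix z assume "z \<in> lsa_centralizer (vect n p) (vneg n p w) (vs.span (F ` {1..n}))"
  thus "z \<in> centralized n p F"
    by (auto simp: lsa_centralizer_def centralized_def vneg_iff vect_def vs.span_base)
next
  fix z assume z: "z \<in> centralized n p F"
  have "dual_frame k \<in> vneg n p w" if "k \<in> {1..n}" for k
    using dual.frame_grade[OF that] weight_pos[OF that] by (intro vgrade_vneg) auto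
  hence "vs.span (dual_frame ` {1..n}) \<subseteq> vneg n p w"
    unfolding vneg_def by (intro vs.span_minimal vs.subspace_span) auto
  hence "z \<in> vneg n p w" using z by (auto simp: span_dual_frame)
  moreover have "vbracket p u z = 0" if "u \<in> vs.span (F ` {1..n})" for u
    using that centralized_commute z by (simp add: span_frame)
  ultimately show "z \<in> lsa_centralizer (vect n p) (vneg n p w) (vs.span (F ` {1..n}))"
    by (simp add: lsa_centralizer_def vect_def)
qed

lemma normalized_basis_unique:
  assumes Y: "normalized_basis n (centralized n p F) Y" and i: "i \<in> {1..n}"
  shows "Y i = dual_frame i"
proof (rule centralized_eqI)
  show "Y i \<in> centralized n p F"
    using Y i vs.span_base[of "Y i" "Y ` {1..n}"] by (auto simp: normalized_basis_def family_basis_def)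
  show "dual_frame i \<in> centralized n p F"
    using i by (simp add: centralized_def dual.frame_vfields dual_frame)
  fix k
  have "lookup (value_at_0 (Y i)) k = lookup (value_at_0 (dual_frame i)) k"
    using Y i by (simp add: normalized_basis_def dual_frame)
  hence "fconst (lookup (lookup (Y i) k) 0) = fconst (lookup (lookup (dual_frame i) k) 0)"
    by (simp add: value_at_0_def lookup_map_zero)
  hence "lookup (fconst (lookup (lookup (Y i) k) 0)) 0 = lookup (fconst (lookup (lookup (dual_frame i) k) 0)) 0"
    by (rule arg_cong)
  thus "lookup (lookup (Y i) k) 0 = lookup (lookup (dual_frame i) k) 0"
    unfolding fconst_def by (simp only: lookup_single_eq)
qed

end

section \<open>The prolong\<close>

lemma fparity_add_eq_0:
  assumes "f \<in> fparity n p a" "g \<in> fparity n p (\<not> a)" "f + g = (0 :: 'k::field superfun)"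
  shows "f = 0"
proof (rule poly_mapping_eqI)
  fix m
  have "lookup f m + lookup g m = 0" using assms(3) by (metis lookup_add lookup_zero)
  moreover have "\<not> (m \<in> keys f \<and> m \<in> keys g)"
    using assms(1,2) by (auto simp: fparity_def)
  hence "lookup f m = 0 \<or> lookup g m = 0" by (simp add: Poly_Mapping.in_keys_iff)
  ultimately show "lookup f m = lookup 0 m" by auto
qed

text \<open>Generation is expressed as an induction principle for a property \<open>Q b x\<close> of
  homogeneous fields \<open>x\<close> of parity \<open>b\<close>. Keeping the two parities apart
  means that closure has to be checked only for homogeneous brackets and odd squares.\<close>

locale generated_super_lie_frame = super_lie_frame n p w F c s
  for n :: nat and p w and F :: "nat \<Rightarrow> 'a::field vfield" and c s +
  fixes n1 :: nat
  assumes weight_1: "i \<in> {1..n} \<Longrightarrow> w i = 1 \<longleftrightarrow> i \<le> n1"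
    and n1_le: "n1 \<le> n"
    and frame_generated: "\<And>Q. (\<And>b. vs.subspace (Q b)) \<Longrightarrow> (\<And>b. Q b \<subseteq> vpart n p b) \<Longrightarrow>
      (\<And>i. i \<in> {1..n1} \<Longrightarrow> F i \<in> Q (p i)) \<Longrightarrow>
      (\<And>a b x y. x \<in> Q a \<Longrightarrow> y \<in> Q b \<Longrightarrow> vbracket p x y \<in> Q (a \<noteq> b)) \<Longrightarrow>
      (\<And>x. CHAR('a) = 2 \<Longrightarrow> x \<in> Q True \<Longrightarrow> vcomp p x x \<in> Q False) \<Longrightarrow>
      (\<And>i. i \<in> {1..n} \<Longrightarrow> F i \<in> Q (p i))"
begin

abbreviation coef :: "'a vfield \<Rightarrow> nat \<Rightarrow> 'a superfun" where
  "coef \<equiv> frame_coef p dual_frame"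

text \<open>The distribution \<D>, written with the explicit coefficients so that it does not refer
  to a choice of dual forms.\<close>

definition horizontal :: "'a vfield set" where
  "horizontal = {W \<in> vfields n p. \<forall>k\<in>{n1 + 1..n}. coef W k = 0}"

text \<open>Only the generators of \<D> are tested; that all of \<D> is preserved is the content of
  \<open>stabilizer_preserves_horizontal\<close>.\<close>

definition stabilizer :: "'a vfield set" where
  "stabilizer = {Z \<in> vfields n p. \<forall>i\<in>{1..n1}. vbracket p Z (dual_frame i) \<in> horizontal}"

lemma low [simp]: "i \<in> {1..n1} \<Longrightarrow> i \<in> {1..n}" and high [simp]: "k \<in> {n1 + 1..n} \<Longrightarrow> k \<in> {1..n}"
  using n1_le by auto

lemma dual_low_grade: "i \<in> {1..n1} \<Longrightarrow> dual_frame i \<in> vgrade n p w (- 1)"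
  using dual.frame_grade[of i] weight_1[of i] n1_le by auto

lemma frame_low_grade: "i \<in> {1..n1} \<Longrightarrow> F i \<in> vgrade n p w (- 1)"
  using frame_grade[of i] weight_1[of i] n1_le by auto

lemma coef_zero [simp]: "coef 0 k = 0"
  by (rule additive.zero[OF dual.additive_coef])

lemma coef_vscale: "Z \<in> vfields n p \<Longrightarrow> k \<in> {1..n} \<Longrightarrow> coef (vscale a Z) k = fscale a (coef Z k)"
proof -
  assume Z: "Z \<in> vfields n p" and k: "k \<in> {1..n}"
  have "fsmult p (fconst a) Z = vscale a Z"
    by (rule poly_mapping_eqI) (simp add: fmult_fconst_left[OF vfields_lookup[OF Z]])
  thus ?thesis using dual.coef_fsmult[OF superfuns_fconst Z k, of a]
    by (simp add: fmult_fconst_left[OF dual.coef_superfuns[OF Z k]])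
qed

lemma horizontal_subspace: "vs.subspace horizontal"
  unfolding horizontal_def
  by (rule vs.subspaceI)
    (auto simp: dual.coef_add coef_vscale vs.subspace_0[OF vfields_subspace]
      intro: vs.subspace_add[OF vfields_subspace] vs.subspace_scale[OF vfields_subspace])

lemma horizontal_fsmult: "f \<in> superfuns n p \<Longrightarrow> W \<in> horizontal \<Longrightarrow> fsmult p f W \<in> horizontal"
  by (auto simp: horizontal_def dual.coef_fsmult fsmult_vfields)

lemma dual_low_horizontal:
  assumes "i \<in> {1..n1}" shows "dual_frame i \<in> horizontal"
  using assms by (auto simp: horizontal_def dual.frame_vfields[OF low[OF assms]] dual.coef_frame[OF low[OF assms]])

lemma horizontal_vfields: "W \<in> horizontal \<Longrightarrow> W \<in> vfields n p"
  by (simp add: horizontal_def)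

lemma horizontal_vparity_part:
  assumes "W \<in> horizontal" shows "vparity_part p a W \<in> horizontal"
  unfolding horizontal_def
proof (intro CollectI conjI ballI)
  have W: "W \<in> vfields n p" using assms by (rule horizontal_vfields)
  show "vparity_part p a W \<in> vfields n p" using vparity_part_in[OF W] by (rule vpart_vfields)
  fix k assume k: "k \<in> {n1 + 1..n}"
  have "coef (vparity_part p a W + vparity_part p (\<not> a) W) k = 0"
    using assms k vparity_part_sum[of W p] by (cases a) (simp_all add: horizontal_def add.commute)
  thus "coef (vparity_part p a W) k = 0"
    unfolding dual.coef_add
    using fparity_add_eq_0[OF dual.coef_fparity[OF vparity_part_in[OF W, of a] high[OF k]],
        of "coef (vparity_part p (\<not> a) W) k"]
      dual.coef_fparity[OF vparity_part_in[OF W, of "\<not> a"] high[OF k]]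
    by (cases a; cases "p k") simp_all
qed

text \<open>The coefficients of different degree parts are homogeneous of different degrees and so
  have disjoint supports; their sum vanishes only if each of them does.\<close>

lemma horizontal_vdegree_part:
  assumes "W \<in> horizontal" shows "vdegree_part w l W \<in> horizontal"
  unfolding horizontal_def
proof (intro CollectI conjI ballI)
  have W: "W \<in> vfields n p" using assms by (rule horizontal_vfields)
  show "vdegree_part w l W \<in> vfields n p" using vdegree_part_in[OF W] by (rule vgrade_vfields)
  fix k assume k: "k \<in> {n1 + 1..n}"
  let ?L = "insert l (vdegrees w W)"
  have g: "coef (vdegree_part w j W) k \<in> fgrade n p w (j + int (w k))" for j
    by (rule dual.coef_fgrade[OF vdegree_part_in[OF W] high[OF k]])
  have "coef (\<Sum>j\<in>?L. vdegree_part w j W) k = 0"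
    using assms k by (subst vdegree_part_sum) (auto simp: finite_vdegrees horizontal_def)
  hence s: "(\<Sum>j\<in>?L. coef (vdegree_part w j W) k) = 0"
    by (simp only: additive.sum[OF dual.additive_coef])
  show "coef (vdegree_part w l W) k = 0"
  proof (rule poly_mapping_eqI, rule ccontr)
    fix m assume m: "lookup (coef (vdegree_part w l W) k) m \<noteq> lookup 0 m"
    hence "int (monom_degree w m) = l + int (w k)"
      using g[of l] by (simp add: fgrade_def Poly_Mapping.in_keys_iff)
    hence "m \<notin> keys (coef (vdegree_part w j W) k)" if "j \<noteq> l" for j
      using g[of j] that by (auto simp: fgrade_def)
    hence "lookup (coef (vdegree_part w j W) k) m = 0" if "j \<noteq> l" for j
      using that by (simp add: Poly_Mapping.in_keys_iff)
    hence "(\<Sum>j\<in>?L. lookup (coef (vdegree_part w j W) k) m) =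
        (\<Sum>j\<in>?L. if j = l then lookup (coef (vdegree_part w l W) k) m else 0)"
      by (intro sum.cong) auto
    also have "\<dots> = lookup (coef (vdegree_part w l W) k) m" by (simp add: finite_vdegrees)
    finally show False using m s by (metis Poly_Mapping.lookup_sum)
  qed
qed

section \<open>The algebra preserving the distribution\<close>

lemma stabilizer_vfields: "Z \<in> stabilizer \<Longrightarrow> Z \<in> vfields n p"
  by (simp add: stabilizer_def)

lemma stabilizer_subspace: "vs.subspace stabilizer"
  unfolding stabilizer_def
  by (rule vs.subspaceI)
    (auto simp: vbracket_add_left vbracket_vscale_left vs.subspace_0[OF vfields_subspace] vs.subspace_0[OF horizontal_subspace]
      intro: vs.subspace_add[OF vfields_subspace] vs.subspace_scale[OF vfields_subspace]
       vs.subspace_add[OF horizontal_subspace] vs.subspace_scale[OF horizontal_subspace])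

lemma stabilizer_vparity_part:
  assumes "Z \<in> stabilizer" shows "vparity_part p a Z \<in> stabilizer"
  unfolding stabilizer_def
proof (intro CollectI conjI ballI)
  have Z: "Z \<in> vfields n p" using assms by (rule stabilizer_vfields)
  show "vparity_part p a Z \<in> vfields n p" using vparity_part_in[OF Z] by (rule vpart_vfields)
  fix i assume i: "i \<in> {1..n1}"
  have "vparity_part p (p i \<noteq> a) (vbracket p Z (dual_frame i)) \<in> horizontal"
    using assms i by (intro horizontal_vparity_part) (simp add: stabilizer_def)
  thus "vbracket p (vparity_part p a Z) (dual_frame i) \<in> horizontal"
    unfolding vparity_part_vbracket_left[OF dual.frame_part[OF low[OF i]] Z] by (cases "p i"; cases a) simp_all
qed

lemma stabilizer_vdegree_part:
  assumes "Z \<in> stabilizer" shows "vdegree_part w k Z \<in> stabilizer"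
  unfolding stabilizer_def
proof (intro CollectI conjI ballI)
  have Z: "Z \<in> vfields n p" using assms by (rule stabilizer_vfields)
  show "vdegree_part w k Z \<in> vfields n p" using vdegree_part_in[OF Z] by (rule vgrade_vfields)
  fix i assume i: "i \<in> {1..n1}"
  have "vdegree_part w (k - 1) (vbracket p Z (dual_frame i)) \<in> horizontal"
    using assms i by (intro horizontal_vdegree_part) (simp add: stabilizer_def)
  thus "vbracket p (vdegree_part w k Z) (dual_frame i) \<in> horizontal"
    unfolding vdegree_part_vbracket_left[OF dual_low_grade[OF i] Z] by simp
qed

text \<open>\<D> is generated over functions by the \<open>dual_frame i\<close> with
  \<open>i \<le> n1\<close>, and the Leibniz rule for the bracket produces only multiples of these
  and of their brackets with \<open>Z\<close>.\<close>

lemma stabilizer_preserves_horizontal: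
  assumes "Z \<in> stabilizer" "W \<in> horizontal" shows "vbracket p Z W \<in> horizontal"
proof -
  have W: "W \<in> vfields n p" using assms by (simp add: horizontal_def)
  have hom: "vbracket p Z W \<in> horizontal" if Z: "Z \<in> stabilizer" "Z \<in> vpart n p a" for Z a
  proof -
    have "vbracket p Z W = vbracket p Z (\<Sum>i\<in>{1..n}. fsmult p (coef W i) (dual_frame i))"
      using dual.frame_expansion[OF W] by simp
    also have "\<dots> \<in> horizontal"
      unfolding vbracket_sum_right
    proof (rule vs.subspace_sum[OF horizontal_subspace])
      fix i assume i: "i \<in> {1..n}"
      have cs: "coef W i \<in> superfuns n p" by (rule dual.coef_superfuns[OF W i])
      show "vbracket p Z (fsmult p (coef W i) (dual_frame i)) \<in> horizontal"
      proof (cases "i \<le> n1")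
        case True
        hence i': "i \<in> {1..n1}" using i by auto
        have "vbracket p Z (dual_frame i) \<in> horizontal" using Z(1) i' by (simp add: stabilizer_def)
        thus ?thesis
          unfolding vbracket_fsmult[OF Z(2) cs dual.frame_vfields[OF i]]
          by (intro vs.subspace_add[OF horizontal_subspace] horizontal_fsmult superfuns_parity_twist cs
              vact_superfuns[OF vpart_vfields[OF Z(2)]] dual_low_horizontal[OF i'])
      next
        case False
        hence "coef W i = 0" using assms(2) i by (simp add: horizontal_def)
        thus ?thesis by (simp add: vs.subspace_0[OF horizontal_subspace])
      qed
    qed
    finally show ?thesis .
  qed
  have "vbracket p (vparity_part p False Z + vparity_part p True Z) W \<in> horizontal"
    unfolding vbracket_add_left
    by (intro vs.subspace_add[OF horizontal_subspace] hom[OF stabilizer_vparity_part vparity_part_in]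
      assms(1) stabilizer_vfields)
  thus ?thesis by (simp flip: vparity_part_sum)
qed

lemma stabilizer_eq_preserving: "stabilizer = preserving n p horizontal"
  using stabilizer_preserves_horizontal dual_low_horizontal
  by (auto simp: preserving_def stabilizer_def)

text \<open>In the Jacobi identity \<open>vbracket p Z' (dual_frame i)\<close> is horizontal but
  need not be a constant combination of generators, so preservation of all of \<D> is
  required.\<close>

lemma stabilizer_vbracket:
  assumes "Z \<in> stabilizer" "Z' \<in> stabilizer" shows "vbracket p Z Z' \<in> stabilizer"
proof -
  have hom: "vbracket p Z Z' \<in> stabilizer"
    if Z: "Z \<in> stabilizer" "Z \<in> vpart n p a" and Z': "Z' \<in> stabilizer" "Z' \<in> vpart n p b" for Z Z' a b
    unfolding stabilizer_def
  proof (intro CollectI conjI ballI)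
    show "vbracket p Z Z' \<in> vfields n p" by (intro vbracket_vfields stabilizer_vfields Z Z')
    fix i assume i: "i \<in> {1..n1}"
    let ?Y = "dual_frame i"
    have "vbracket p (vbracket p Z Z') ?Y =
        vbracket p Z (vbracket p Z' ?Y) - vscale (koszul a b) (vbracket p Z' (vbracket p Z ?Y))"
      by (simp add: vbracket_jacobi[OF Z(2) Z'(2) dual.frame_part[OF low[OF i]]])
    also have "\<dots> \<in> horizontal"
      by (intro vs.subspace_diff[OF horizontal_subspace] vs.subspace_scale[OF horizontal_subspace]
          stabilizer_preserves_horizontal Z Z' dual_low_horizontal i)
    finally show "vbracket p (vbracket p Z Z') ?Y \<in> horizontal" .
  qed
  have "vbracket p (vparity_part p False Z + vparity_part p True Z)
      (vparity_part p False Z' + vparity_part p True Z') \<in> stabilizer"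
    unfolding vbracket_add_left vbracket_add_right
    by (intro vs.subspace_add[OF stabilizer_subspace]
      hom[OF stabilizer_vparity_part vparity_part_in stabilizer_vparity_part vparity_part_in]
      assms stabilizer_vfields)
  thus ?thesis by (simp flip: vparity_part_sum)
qed

lemma stabilizer_square:
  assumes c: "CHAR('a) = 2" and Z: "Z \<in> stabilizer" "Z \<in> vpart n p True"
  shows "vcomp p Z Z \<in> stabilizer"
  unfolding stabilizer_def
proof (intro CollectI conjI ballI)
  show "vcomp p Z Z \<in> vfields n p" by (intro vcomp_vfields stabilizer_vfields Z)
  fix i assume i: "i \<in> {1..n1}"
  show "vbracket p (vcomp p Z Z) (dual_frame i) \<in> horizontal"
    unfolding vbracket_square_char_2[OF c Z(2) dual.frame_part[OF low[OF i]]]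
    by (intro stabilizer_preserves_horizontal Z dual_low_horizontal i)
qed

lemma span_frame_stabilizer: "vs.span (F ` {1..n}) \<subseteq> stabilizer"
proof (rule vs.span_minimal[OF _ stabilizer_subspace], rule image_subsetI)
  fix j assume j: "j \<in> {1..n}"
  have "vbracket p (F j) (dual_frame i) \<in> horizontal" if "i \<in> {1..n1}" for i
    unfolding dual_frame(4)[OF low[OF that] j] by (rule vs.subspace_0[OF horizontal_subspace])
  thus "F j \<in> stabilizer"
    by (simp add: stabilizer_def frame_vfields[OF j])
qed

text \<open>Generation is assumed only for \<open>F\<close>; transposition carries it over to
  \<open>dual_frame\<close>. The condition that \<open>Z\<close> commutes with the transposed field
  is closed under brackets by Jacobi and under squares in characteristic 2, because transposition
  respects both up to sign.\<close>

lemma centralizes_low_dual: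
  assumes Z: "Z \<in> vpart n p a" and 0: "\<And>i. i \<in> {1..n1} \<Longrightarrow> vbracket p Z (dual_frame i) = 0"
    and i: "i \<in> {1..n}"
  shows "vbracket p Z (dual_frame i) = 0"
proof -
  let ?Q = "\<lambda>b. {x \<in> vpart n p b \<inter> centralized n p dual_frame. vbracket p Z (transpose_field x) = 0}"
  have "F i \<in> ?Q (p i)"
  proof (rule frame_generated[OF _ _ _ _ _ i])
    show "vs.subspace (?Q b)" for b
    proof (rule vs.subspaceI)
      show "0 \<in> ?Q b"
        using transpose_field_vscale[of 0 0]
        by (simp add: vs.subspace_0[OF vpart_subspace] vs.subspace_0[OF dual.centralized_subspace])
    qed (auto simp: transpose_field_add transpose_field_vscale vbracket_add_right vbracket_vscale_right
        intro: vs.subspace_add[OF vpart_subspace] vs.subspace_scale[OF vpart_subspace]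
        vs.subspace_add[OF dual.centralized_subspace] vs.subspace_scale[OF dual.centralized_subspace])
    show "F j \<in> ?Q (p j)" if "j \<in> {1..n1}" for j
      using low[OF that] 0[OF that] by (simp add: frame_part frame_centralized transpose_field_frame)
    show "vbracket p x y \<in> ?Q (b \<noteq> b')" if xy: "x \<in> ?Q b" "y \<in> ?Q b'" for x y b b'
    proof -
      have x: "x \<in> vpart n p b" "x \<in> centralized n p dual_frame" "vbracket p Z (transpose_field x) = 0"
        and y: "y \<in> vpart n p b'" "y \<in> centralized n p dual_frame" "vbracket p Z (transpose_field y) = 0"
        using xy by auto
      have "vbracket p Z (vbracket p (transpose_field x) (transpose_field y)) = 0"
        by (simp add: vbracket_jacobi[OF Z transpose_field_vpart[OF x(1)] transpose_field_vpart[OF y(1)]] x(3) y(3))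
      hence "vbracket p Z (transpose_field (vbracket p x y)) = 0"
        by (simp add: transpose_field_vbracket[OF x(2,1) y(2,1)] vbracket_minus_right)
      thus ?thesis using vbracket_vpart[OF x(1) y(1)] dual.centralized_vbracket[OF x(2) y(2)] by simp
    qed
    show "vcomp p x x \<in> ?Q False" if c: "CHAR('a) = 2" and x': "x \<in> ?Q True" for x
    proof -
      have x: "x \<in> vpart n p True" "x \<in> centralized n p dual_frame" "vbracket p Z (transpose_field x) = 0"
        using x' by auto
      let ?y = "transpose_field x"
      have y: "?y \<in> vpart n p True" by (rule transpose_field_vpart[OF x(1)])
      have yy: "vcomp p ?y ?y \<in> vpart n p False" using vcomp_vpart[OF y y] by simp
      have "vbracket p ?y Z = 0" using vbracket_swap[OF y Z] x(3) by simp
      hence "vbracket p (vcomp p ?y ?y) Z = 0" by (simp add: vbracket_square_char_2[OF c y Z])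
      hence "vbracket p Z (vcomp p ?y ?y) = 0" using vbracket_swap[OF Z yy] by simp
      thus ?thesis
        using vcomp_vpart[OF x(1,1)] dual.centralized_square[OF c x(2,1)]
        by (simp add: transpose_field_square[OF c x(2,1)])
    qed
  qed auto
  thus ?thesis using i by (simp add: transpose_field_frame)
qed

lemma stabilizer_negative:
  assumes Z: "Z \<in> stabilizer" "Z \<in> vgrade n p w k" and k: "k < 0"
  shows "Z \<in> vs.span (F ` {1..n})"
proof -
  have hom: "Z \<in> vs.span (F ` {1..n})"
    if Z: "Z \<in> stabilizer" "Z \<in> vgrade n p w k" "Z \<in> vpart n p a" for Z a
  proof -
    have "vbracket p Z (dual_frame i) = 0" if i: "i \<in> {1..n1}" for i
    proof (rule dual.coef_eq_0_imp)
      show v: "vbracket p Z (dual_frame i) \<in> vfields n p"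
        by (intro vbracket_vfields stabilizer_vfields Z dual.frame_vfields low i)
      fix m assume m: "m \<in> {1..n}"
      show "coef (vbracket p Z (dual_frame i)) m = 0"
      proof (cases "m \<le> n1")
        case True
        hence "w m = 1" using weight_1[OF m] by simp
        \<comment> \<open>For \<open>m \<le> n1\<close> the degree is \<open>k - 1 + 1\<close>,
          hence negative; the coefficients beyond \<open>n1\<close> vanish because the bracket is
          horizontal.\<close>
        moreover have "coef (vbracket p Z (dual_frame i)) m \<in> fgrade n p w (k + - 1 + int (w m))"
          by (rule dual.coef_fgrade[OF vbracket_vgrade[OF Z(2) dual_low_grade[OF i]] m])
        ultimately show ?thesis using k by (intro fgrade_negative) auto
      next
        case False
        thus ?thesis using Z(1) i m by (simp add: stabilizer_def horizontal_def)
      qed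
    qed
    hence "vbracket p Z (dual_frame i) = 0" if "i \<in> {1..n}" for i
      using centralizes_low_dual[OF Z(3) _ that] by blast
    hence "vbracket p (dual_frame i) Z = 0" if "i \<in> {1..n}" for i
      using vbracket_swap[OF dual.frame_part[OF that] Z(3)] that by simp
    thus ?thesis unfolding span_frame using stabilizer_vfields[OF Z(1)] by (simp add: centralized_def)
  qed
  have "vparity_part p False Z + vparity_part p True Z \<in> vs.span (F ` {1..n})"
    by (intro vs.span_add hom[OF stabilizer_vparity_part vparity_part_vgrade vparity_part_in]
      Z stabilizer_vfields)
  thus ?thesis by (simp flip: vparity_part_sum)
qed

text \<open>The fields annihilating \<open>f\<close> are closed under brackets and, in
  characteristic 2, under squares of odd fields; so generation extends the hypothesis to the whole
  frame.\<close>

lemma fun_constant_low_frame: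
  assumes f: "f \<in> superfuns n p" and 0: "\<And>i. i \<in> {1..n1} \<Longrightarrow> vact p (F i) f = 0"
  shows "f = fconst (lookup f 0)"
proof (rule fun_constant_frame[OF f])
  fix i assume i: "i \<in> {1..n}"
  let ?Q = "\<lambda>b. {x \<in> vpart n p b. vact p x f = 0}"
  have "F i \<in> ?Q (p i)"
  proof (rule frame_generated[OF _ _ _ _ _ i])
    show "vs.subspace (?Q b)" for b
      by (rule vs.subspaceI) (auto simp: vact_add_left vact_vscale vs.subspace_0[OF vpart_subspace]
        intro: vs.subspace_add[OF vpart_subspace] vs.subspace_scale[OF vpart_subspace])
    show "F j \<in> ?Q (p j)" if "j \<in> {1..n1}" for j
      using low[OF that] 0[OF that] by (simp add: frame_part)
    show "vbracket p x y \<in> ?Q (b \<noteq> b')" if "x \<in> ?Q b" "y \<in> ?Q b'" for x y b b'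
      using that vbracket_vpart[of x n p b y b'] vact_vbracket[of x n p b y b' f] f by simp
    show "vcomp p x x \<in> ?Q False" if "CHAR('a) = 2" "x \<in> ?Q True" for x
      using that vcomp_vpart[of x n p True x True] vact_square_char_2[of x n p f] f by simp
  qed auto
  thus "vact p (F i) f = 0" by simp
qed

text \<open>\<open>F i\<close> commutes with every \<open>dual_frame l\<close>, so in the expansion
  of \<open>W\<close> it differentiates only the coefficients.\<close>

lemma coef_vbracket_frame:
  assumes W: "W \<in> vfields n p" and i: "i \<in> {1..n}" and m: "m \<in> {1..n}"
  shows "coef (vbracket p (F i) W) m = vact p (F i) (coef W m)"
proof -
  have cs: "coef W l \<in> superfuns n p" if "l \<in> {1..n}" for l by (rule dual.coef_superfuns[OF W that])
  have "vbracket p (F i) W = vbracket p (F i) (\<Sum>l\<in>{1..n}. fsmult p (coef W l) (dual_frame l))"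
    using dual.frame_expansion[OF W] by simp
  also have "\<dots> = (\<Sum>l\<in>{1..n}. fsmult p (vact p (F i) (coef W l)) (dual_frame l))"
    unfolding vbracket_sum_right
    by (intro sum.cong refl)
      (simp add: vbracket_fsmult[OF frame_part[OF i] cs dual.frame_vfields] dual_frame(4)[OF _ i])
  finally show ?thesis
    using dual.coef_combination[OF vact_superfuns[OF frame_vfields[OF i] cs] m] by simp
qed

lemma stabilizer_nonnegative:
  assumes Z: "Z \<in> vgrade n p w k" and k: "0 \<le> k"
    and st: "\<And>i. i \<in> {1..n1} \<Longrightarrow> vbracket p Z (F i) \<in> stabilizer"
  shows "Z \<in> stabilizer"
proof -
  have hom: "Z \<in> stabilizer"
    if Z: "Z \<in> vgrade n p w k" "Z \<in> vpart n p a" and st: "\<And>i. i \<in> {1..n1} \<Longrightarrow> vbracket p Z (F i) \<in> stabilizer" for Z a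
    unfolding stabilizer_def
  proof (intro CollectI conjI ballI)
    show Zv: "Z \<in> vfields n p" using Z(1) by (rule vgrade_vfields)
    fix j assume j: "j \<in> {1..n1}"
    let ?W = "vbracket p Z (dual_frame j)"
    have W: "?W \<in> vfields n p" by (intro vbracket_vfields Zv dual.frame_vfields low j)
    \<comment> \<open>As \<open>F i\<close> commutes with \<open>dual_frame j\<close>, Jacobi moves
      it onto \<open>Z\<close>, and the hypothesis on the bracket of \<open>Z\<close> and
      \<open>F i\<close> applies.\<close>
    have d: "vbracket p (F i) ?W \<in> horizontal" if i: "i \<in> {1..n1}" for i
    proof -
      have "vbracket p (F i) Z \<in> stabilizer"
        unfolding vbracket_swap[OF frame_part[OF low[OF i]] Z(2)]
        by (intro vs.subspace_scale[OF stabilizer_subspace] st i)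
      moreover have "vbracket p (F i) ?W = vbracket p (vbracket p (F i) Z) (dual_frame j)"
        by (simp add: vbracket_jacobi[OF frame_part[OF low[OF i]] Z(2) dual.frame_part[OF low[OF j]]]
            dual_frame(4)[OF low[OF j] low[OF i]])
      ultimately show ?thesis using j by (simp add: stabilizer_def)
    qed
    show "?W \<in> horizontal"
      unfolding horizontal_def
    proof (intro CollectI conjI ballI W)
      fix m assume m: "m \<in> {n1 + 1..n}"
      have "vact p (F i) (coef ?W m) = 0" if i: "i \<in> {1..n1}" for i
        using d[OF i] m coef_vbracket_frame[OF W low[OF i] high[OF m]] by (simp add: horizontal_def)
      hence f: "coef ?W m = fconst (lookup (coef ?W m) 0)"
        by (rule fun_constant_low_frame[OF dual.coef_superfuns[OF W high[OF m]]])
      \<comment> \<open>Beyond \<open>n1\<close> the weight is at least 2, so the coefficient has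
        degree \<open>k - 1 + w m\<close>, which is positive even for \<open>k = 0\<close> and
        excludes a nonzero constant.\<close>
      have "w m \<noteq> 1" "0 < w m" using weight_1[OF high[OF m]] m weight_pos[OF high[OF m]] by auto
      moreover have "coef ?W m \<in> fgrade n p w (k + - 1 + int (w m))"
        by (rule dual.coef_fgrade[OF vbracket_vgrade[OF Z(1) dual_low_grade[OF j]] high[OF m]])
      ultimately have "lookup (coef ?W m) 0 = 0"
        using k by (intro ccontr[of "lookup (coef ?W m) 0 = 0"])
          (auto simp: fgrade_def Poly_Mapping.in_keys_iff dest: bspec[of _ _ 0])
      thus "coef ?W m = 0" using f by simp
    qed
  qed
  have "vparity_part p b Z \<in> stabilizer" for b
  proof (rule hom[OF vparity_part_vgrade[OF Z] vparity_part_in[OF vgrade_vfields[OF Z]]])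
    fix i assume i: "i \<in> {1..n1}"
    have "vparity_part p (p i \<noteq> b) (vbracket p Z (F i)) \<in> stabilizer"
      by (rule stabilizer_vparity_part[OF st[OF i]])
    thus "vbracket p (vparity_part p b Z) (F i) \<in> stabilizer"
      unfolding vparity_part_vbracket_left[OF frame_part[OF low[OF i]] vgrade_vfields[OF Z]]
      by (cases "p i"; cases b) simp_all
  qed
  hence "vparity_part p False Z + vparity_part p True Z \<in> stabilizer"
    by (intro vs.subspace_add[OF stabilizer_subspace])
  thus ?thesis by (simp flip: vparity_part_sum)
qed

section \<open>Comparison with the complete prolong\<close>

lemma prolong_nonneg_eq:
  "prolong_nonneg n p w (vs.span (F ` {1..n})) k = stabilizer \<inter> vgrade n p w (int k)"
proof (induction k)
  case 0
  let ?g = "vs.span (F ` {1..n})"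
  have g: "?g \<inter> vgrade n p w (- 1) = stabilizer \<inter> vgrade n p w (- 1)"
    using span_frame_stabilizer stabilizer_negative[of _ "- 1"] by auto
  \<comment> \<open>One inclusion is the criterion for nonnegative degrees, which tests only the
    fields \<open>F i\<close> of degree -1; the other is closure of \<open>stabilizer\<close> under
    brackets.\<close>
  have "X \<in> stabilizer" if "X \<in> vgrade n p w 0"
    "\<And>Z. Z \<in> stabilizer \<inter> vgrade n p w (- 1) \<Longrightarrow> vbracket p X Z \<in> stabilizer" for X
    using that frame_low_grade span_frame_stabilizer vs.span_base[of _ "F ` {1..n}"] low
    by (intro stabilizer_nonnegative[of X 0]) (auto simp: subset_iff)
  moreover have "vbracket p X Z \<in> vgrade n p w (- 1)" if "X \<in> vgrade n p w 0" "Z \<in> vgrade n p w (- 1)" for X Z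
    using vbracket_vgrade[OF that] by simp
  ultimately show ?case using stabilizer_vbracket by (simp add: g) blast
next
  case (Suc k)
  let ?g = "vs.span (F ` {1..n})"
  have g: "?g \<inter> vgrade n p w (- 1) = stabilizer \<inter> vgrade n p w (- 1)"
    using span_frame_stabilizer stabilizer_negative[of _ "- 1"] by auto
  have "X \<in> stabilizer" if "X \<in> vgrade n p w (int (Suc k))"
    "\<And>Z. Z \<in> stabilizer \<inter> vgrade n p w (- 1) \<Longrightarrow> vbracket p X Z \<in> stabilizer" for X
    using that frame_low_grade span_frame_stabilizer vs.span_base[of _ "F ` {1..n}"] low
    by (intro stabilizer_nonnegative[of X "int (Suc k)"]) (auto simp: subset_iff)
  moreover have "vbracket p X Z \<in> vgrade n p w (int k)"
    if "X \<in> vgrade n p w (int (Suc k))" "Z \<in> vgrade n p w (- 1)" for X Z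
    using vbracket_vgrade[OF that] by simp
  ultimately show ?case using stabilizer_vbracket unfolding prolong_nonneg.simps g Suc by blast
qed

lemma prolong_component_eq:
  "prolong_component n p w (vs.span (F ` {1..n})) k = stabilizer \<inter> vgrade n p w k"
  using span_frame_stabilizer stabilizer_negative[of _ k]
  by (auto simp: prolong_component_def prolong_nonneg_eq)

lemma stabilizer_graded: "stabilizer = vs.span (\<Union>k. stabilizer \<inter> vgrade n p w k)"
proof (intro equalityI subsetI)
  fix Z assume Z: "Z \<in> stabilizer"
  have "(\<Sum>k\<in>vdegrees w Z. vdegree_part w k Z) \<in> vs.span (\<Union>k. stabilizer \<inter> vgrade n p w k)"
    using stabilizer_vdegree_part[OF Z] vdegree_part_in[OF stabilizer_vfields[OF Z]]
    by (intro vs.span_sum vs.span_base) blast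
  thus "Z \<in> vs.span (\<Union>k. stabilizer \<inter> vgrade n p w k)" by (simp add: vdegree_part_sum finite_vdegrees)
next
  have "vs.span (\<Union>k. stabilizer \<inter> vgrade n p w k) \<subseteq> stabilizer"
    by (intro vs.span_minimal stabilizer_subspace) auto
  thus "Z \<in> vs.span (\<Union>k. stabilizer \<inter> vgrade n p w k) \<Longrightarrow> Z \<in> stabilizer" for Z by auto
qed

lemma complete_prolong_eq: "complete_prolong n p w (vs.span (F ` {1..n})) = stabilizer"
  unfolding complete_prolong_def prolong_component_eq by (rule stabilizer_graded[symmetric])

lemma super_subspaceI:
  assumes "vs.subspace h" "h \<subseteq> vfields n p" "\<And>Z a. Z \<in> h \<Longrightarrow> vparity_part p a Z \<in> h"
  shows "super_subspace (vect n p) h"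
proof -
  have sc: "lsa_scale (vect n p) = vscale" by (simp add: vect_def)
  have "h = {x + y |x y. x \<in> h \<inter> vpart n p False \<and> y \<in> h \<inter> vpart n p True}"
  proof (intro equalityI subsetI)
    fix Z assume "Z \<in> h"
    thus "Z \<in> {x + y |x y. x \<in> h \<inter> vpart n p False \<and> y \<in> h \<inter> vpart n p True}"
      using assms(2,3) vparity_part_sum[of Z p] vparity_part_in[of Z n p] by blast
  qed (use vs.subspace_add[OF assms(1)] in auto)
  thus ?thesis unfolding super_subspace_def sc using assms(1) by blast
qed

lemma stabilizer_subalgebra: "lsa_subalgebra (vect n p) stabilizer"
proof -
  have "lsa_bracket (vect n p) = (vbracket p :: 'a vfield \<Rightarrow> _)"
    "lsa_square (vect n p) = (\<lambda>X :: 'a vfield. vcomp p X X)"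
    by (simp_all add: vect_def)
  thus ?thesis unfolding lsa_subalgebra_def
    using super_subspaceI[OF stabilizer_subspace subsetI[OF stabilizer_vfields] stabilizer_vparity_part]
      stabilizer_vbracket stabilizer_square by auto
qed

lemma stabilizer_graded_subalgebra: "graded_subalgebra n p w stabilizer"
  unfolding graded_subalgebra_def using stabilizer_subalgebra stabilizer_graded by blast

lemma centralized_subalgebra: "lsa_subalgebra (vect n p) (centralized n p F)"
proof -
  have "lsa_bracket (vect n p) = (vbracket p :: 'a vfield \<Rightarrow> _)"
    "lsa_square (vect n p) = (\<lambda>X :: 'a vfield. vcomp p X X)"
    by (simp_all add: vect_def)
  moreover have "centralized n p F \<subseteq> vfields n p" by (auto simp: centralized_def)
  ultimately show ?thesis unfolding lsa_subalgebra_def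
    using super_subspaceI[OF centralized_subspace _ centralized_vparity_part]
      centralized_vbracket centralized_square by auto
qed

lemma stabilizer_vneg: "stabilizer \<inter> vneg n p w = vs.span (F ` {1..n})"
proof (intro equalityI subsetI)
  fix Z assume "Z \<in> stabilizer \<inter> vneg n p w"
  hence Z: "Z \<in> stabilizer" "\<And>k. k \<ge> 0 \<Longrightarrow> vdegree_part w k Z = 0" by (auto simp: vneg_iff)
  have "vdegree_part w k Z \<in> vs.span (F ` {1..n})" for k
    using stabilizer_negative[OF stabilizer_vdegree_part[OF Z(1)] vdegree_part_in[OF stabilizer_vfields[OF Z(1)]], of k] Z(2)[of k]
    by (cases "k < 0") (auto simp: vs.span_zero)
  hence "(\<Sum>k\<in>vdegrees w Z. vdegree_part w k Z) \<in> vs.span (F ` {1..n})" by (intro vs.span_sum)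
  thus "Z \<in> vs.span (F ` {1..n})" by (simp add: vdegree_part_sum finite_vdegrees)
next
  fix Z assume Z: "Z \<in> vs.span (F ` {1..n})"
  have "F k \<in> vneg n p w" if "k \<in> {1..n}" for k
    using frame_grade[OF that] weight_pos[OF that] by (intro vgrade_vneg) auto
  hence "vs.span (F ` {1..n}) \<subseteq> vneg n p w"
    unfolding vneg_def by (intro vs.span_minimal vs.subspace_span) auto
  thus "Z \<in> stabilizer \<inter> vneg n p w" using Z span_frame_stabilizer by auto
qed

lemma stabilizer_maximal:
  assumes h: "graded_subalgebra n p w h" and g: "h \<inter> vneg n p w = vs.span (F ` {1..n})"
  shows "h \<subseteq> stabilizer"
proof -
  have br: "vbracket p x y \<in> h" if "x \<in> h" "y \<in> h" for x y
    using h that by (simp add: graded_subalgebra_def lsa_subalgebra_def vect_def)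
  have neg: "h \<inter> vgrade n p w k \<subseteq> stabilizer" if "k < 0" for k
    using vgrade_vneg[OF _ that] g span_frame_stabilizer by fast
  have Fh: "F i \<in> h" if "i \<in> {1..n1}" for i
    using g vs.span_base[of "F i" "F ` {1..n}"] low[OF that] by auto
  \<comment> \<open>The shift by 1 lets the induction over natural numbers start in degree -1, where
    \<open>h\<close> is known to agree with the span of the frame.\<close>
  have pos: "h \<inter> vgrade n p w (int k - 1) \<subseteq> stabilizer" for k
  proof (induction k)
    case (Suc k)
    show ?case
    proof
      fix Z assume Z: "Z \<in> h \<inter> vgrade n p w (int (Suc k) - 1)"
      show "Z \<in> stabilizer"
      proof (rule stabilizer_nonnegative)
        show "Z \<in> vgrade n p w (int k)" using Z by simp
        fix i assume i: "i \<in> {1..n1}"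
        have "vbracket p Z (F i) \<in> h \<inter> vgrade n p w (int k + - 1)"
          using br[OF _ Fh[OF i]] vbracket_vgrade[OF _ frame_low_grade[OF i], of Z "int k"] Z by simp
        thus "vbracket p Z (F i) \<in> stabilizer" using Suc by auto
      qed simp
    qed
  qed (use neg[of "-1"] in simp)
  have "h \<inter> vgrade n p w k \<subseteq> stabilizer" for k
    using neg[of k] pos[of "nat (k + 1)"] by (cases "k < 0") simp_all
  moreover have "h = vs.span (\<Union>k. h \<inter> vgrade n p w k)" using h by (simp add: graded_subalgebra_def)
  ultimately show ?thesis
    by (metis (no_types, lifting) UN_least stabilizer_subspace vs.span_minimal)
qed

section \<open>The defining equations\<close>

lemma stabilizer_iff_coef:
  "stabilizer = {Z \<in> vfields n p. \<forall>i\<in>{1..n1}. \<forall>k\<in>{n1 + 1..n}. coef (vbracket p Z (dual_frame i)) k = 0}"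
  unfolding stabilizer_def horizontal_def
  using vbracket_vfields[OF _ dual.frame_vfields[OF low]] by blast

text \<open>The Leibniz rule is applied to the expansion of \<open>Z\<close>. The minus sign comes
  from the structure constants of \<open>dual_frame\<close>, which are opposite to \<open>c\<close>;
  the twist comes from moving \<open>dual_frame i\<close> past the coefficients.\<close>

lemma coef_dual_vbracket:
  assumes Z: "Z \<in> vfields n p" and i: "i \<in> {1..n}" and k: "k \<in> {1..n}"
  shows "coef (vbracket p (dual_frame i) Z) k =
    vact p (dual_frame i) (coef Z k) - (\<Sum>j\<in>{1..n}. fscale (c i j k) (parity_twist p (p i) (coef Z j)))"
proof -
  have cs: "coef Z l \<in> superfuns n p" if "l \<in> {1..n}" for l by (rule dual.coef_superfuns[OF Z that])
  let ?t = "\<lambda>j. parity_twist p (p i) (coef Z j)"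
  have "vbracket p (dual_frame i) Z = vbracket p (dual_frame i) (\<Sum>l\<in>{1..n}. fsmult p (coef Z l) (dual_frame l))"
    using dual.frame_expansion[OF Z] by simp
  also have "\<dots> = (\<Sum>l\<in>{1..n}. fsmult p (vact p (dual_frame i) (coef Z l)) (dual_frame l)) +
      (\<Sum>l\<in>{1..n}. fsmult p (?t l) (vbracket p (dual_frame i) (dual_frame l)))"
    unfolding vbracket_sum_right sum.distrib[symmetric]
    by (intro sum.cong refl) (simp add: vbracket_fsmult[OF dual.frame_part[OF i] cs dual.frame_vfields])
  finally have "coef (vbracket p (dual_frame i) Z) k = vact p (dual_frame i) (coef Z k) +
      (\<Sum>l\<in>{1..n}. coef (fsmult p (?t l) (vbracket p (dual_frame i) (dual_frame l))) k)"
    by (simp only: dual.coef_add dual.coef_combination[OF vact_superfuns[OF dual.frame_vfields[OF i] cs] k]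
        additive.sum[OF dual.additive_coef[of k], of "\<lambda>l. fsmult p (?t l) (vbracket p (dual_frame i) (dual_frame l))"])
  moreover have "coef (fsmult p (?t l) (vbracket p (dual_frame i) (dual_frame l))) k = - fscale (c i l k) (?t l)"
    if l: "l \<in> {1..n}" for l
  proof -
    have v: "vbracket p (dual_frame i) (dual_frame l) \<in> vfields n p"
      by (intro vbracket_vfields dual.frame_vfields i l)
    have "coef (vscale (c i l m) (dual_frame m)) k = (if m = k then fconst (c i l k) else 0)" if "m \<in> {1..n}" for m
      using that k by (simp add: coef_vscale dual.frame_vfields dual.coef_frame)
    hence "coef (\<Sum>m\<in>{1..n}. vscale (c i l m) (dual_frame m)) k = fconst (c i l k)"
      using k unfolding additive.sum[OF dual.additive_coef] by simp
    hence "coef (vbracket p (dual_frame i) (dual_frame l)) k = - fconst (c i l k)"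
      by (simp add: dual_frame_vbracket[OF i l] additive.minus[OF dual.additive_coef])
    thus ?thesis
      by (simp add: dual.coef_fsmult[OF superfuns_parity_twist[OF cs[OF l]] v k] fmult_minus_right
          fmult_fconst_right[OF superfuns_parity_twist[OF cs[OF l]]])
  qed
  ultimately show ?thesis by (simp add: sum_negf)
qed

text \<open>The equations arise from the bracket with \<open>dual_frame i\<close> on the left,
  whereas preservation has it on the right. The two differ by a sign depending on parity, so an
  inhomogeneous \<open>Z\<close> is split, and horizontality passes to the parity parts.\<close>

lemma vbracket_horizontal_swap:
  assumes Z: "Z \<in> vfields n p" and i: "i \<in> {1..n}"
  shows "vbracket p Z (dual_frame i) \<in> horizontal \<longleftrightarrow> vbracket p (dual_frame i) Z \<in> horizontal"
proof -
  note s = vs.subspace_scale[OF horizontal_subspace] vs.subspace_add[OF horizontal_subspace]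
  have hom: "vbracket p A B \<in> horizontal" if "A \<in> vpart n p a" "B \<in> vpart n p b" "vbracket p B A \<in> horizontal" for A B a b
    unfolding vbracket_swap[OF that(1,2)] by (intro s that(3))
  note Y = dual.frame_part[OF i]
  have l: "vbracket p (vparity_part p b Z) (dual_frame i) = vparity_part p (p i \<noteq> b) (vbracket p Z (dual_frame i))" for b
    unfolding vparity_part_vbracket_left[OF Y Z] by (cases "p i"; cases b) simp_all
  have r: "vbracket p (dual_frame i) (vparity_part p b Z) = vparity_part p (p i \<noteq> b) (vbracket p (dual_frame i) Z)" for b
    unfolding vparity_part_vbracket[OF Y Z] by (cases "p i"; cases b) simp_all
  show ?thesis
  proof
    assume "vbracket p Z (dual_frame i) \<in> horizontal"
    hence "vbracket p (dual_frame i) (vparity_part p b Z) \<in> horizontal" for b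
      using hom[OF Y vparity_part_in[OF Z]] l horizontal_vparity_part by simp
    hence "vbracket p (dual_frame i) (vparity_part p False Z + vparity_part p True Z) \<in> horizontal"
      unfolding vbracket_add_right by (intro s)
    thus "vbracket p (dual_frame i) Z \<in> horizontal" by (simp flip: vparity_part_sum)
  next
    assume "vbracket p (dual_frame i) Z \<in> horizontal"
    hence "vbracket p (vparity_part p b Z) (dual_frame i) \<in> horizontal" for b
      using hom[OF vparity_part_in[OF Z] Y] r horizontal_vparity_part by simp
    hence "vbracket p (vparity_part p False Z + vparity_part p True Z) (dual_frame i) \<in> horizontal"
      unfolding vbracket_add_left by (intro s)
    thus "vbracket p Z (dual_frame i) \<in> horizontal" by (simp flip: vparity_part_sum)
  qed
qed

lemma stabilizer_iff_equations:
  "stabilizer = {Z \<in> vfields n p. \<forall>i\<in>{1..n1}. \<forall>k\<in>{n1 + 1..n}.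
     vact p (dual_frame i) (coef Z k) - (\<Sum>j = 1..n. fscale (c i j k) (parity_twist p (p i) (coef Z j))) = 0}"
proof -
  have "vbracket p Z (dual_frame i) \<in> horizontal \<longleftrightarrow> (\<forall>k\<in>{n1 + 1..n}.
     vact p (dual_frame i) (coef Z k) - (\<Sum>j = 1..n. fscale (c i j k) (parity_twist p (p i) (coef Z j))) = 0)"
    if "Z \<in> vfields n p" "i \<in> {1..n1}" for Z i
    using vbracket_vfields[OF dual.frame_vfields[OF low[OF that(2)]] that(1)] high
      coef_dual_vbracket[OF that(1) low[OF that(2)]]
    unfolding vbracket_horizontal_swap[OF that(1) low[OF that(2)]] unfolding horizontal_def by simp
  thus ?thesis unfolding stabilizer_def by auto
qed

end

section \<open>Abstract generation and isomorphism\<close>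

text \<open>This identifies the index set of the degree -1 part with an interval starting at 1: as
  \<open>w\<close> is monotone, the indices of smallest weight form an initial segment.\<close>

lemma initial_segment_card:
  fixes I :: "nat set"
  assumes "finite I" "0 \<notin> I" "\<And>i j. i \<in> I \<Longrightarrow> 1 \<le> j \<Longrightarrow> j \<le> i \<Longrightarrow> j \<in> I"
  shows "I = {1..card I}"
proof (cases "I = {}")
  case False
  have "I = {1..Max I}"
  proof (intro equalityI subsetI)
    fix i assume "i \<in> I"
    thus "i \<in> {1..Max I}" using assms(1,2) by (cases i) auto
  next
    fix i assume "i \<in> {1..Max I}"
    thus "i \<in> I" using assms(3)[OF Max_in[OF assms(1) False]] by auto
  qed
  moreover from this have "card I = card {1..Max I}" by (rule arg_cong)
  hence "card I = Max I" by (simp only: card_atLeastAtMost diff_Suc_1' Suc_eq_plus1 add_diff_cancel_right')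
  ultimately show ?thesis by (simp only:)
qed simp

lemma lsa_part_subspace:
  assumes "lie_superalgebra L" shows "module.subspace (lsa_scale L) (lsa_part L a)"
proof -
  have "\<forall>a. module.subspace (lsa_scale L) (lsa_part L a)"
    using assms unfolding lie_superalgebra_def by (elim conjE) assumption
  thus ?thesis by blast
qed

lemma lsa_part_subset_carrier:
  assumes "lie_superalgebra L" shows "lsa_part L a \<subseteq> lsa_carrier L"
proof
  interpret vector_space "lsa_scale L" using assms by (simp add: lie_superalgebra_def)
  have "0 \<in> lsa_part L b" for b by (rule subspace_0[OF lsa_part_subspace[OF assms]])
  moreover fix x assume "x \<in> lsa_part L a"
  ultimately show "x \<in> lsa_carrier L" unfolding lsa_carrier_def mem_Collect_eq
    by (cases a) (rule exI[of _ 0], rule exI[of _ x], simp, rule exI[of _ x], rule exI[of _ 0], simp)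
qed

section \<open>Transfer along the embedding\<close>

locale embedded_superalgebra =
  fixes L :: "('k::field, 'v::ab_group_add) lsa" and n :: nat and p :: "nat \<Rightarrow> bool"
    and \<phi> :: "'v \<Rightarrow> 'k vfield" and e :: "nat \<Rightarrow> 'v"
  assumes lie: "lie_superalgebra L"
    and embedding: "lsa_embedding L (vect n p) \<phi>"
    and basis: "family_basis (lsa_scale L) {1..n} e (lsa_carrier L)"
    and basis_parity: "\<And>i. i \<in> {1..n} \<Longrightarrow> e i \<in> lsa_part L (p i)"
begin

sublocale L: vector_space "lsa_scale L"
  using lie by (simp add: lie_superalgebra_def)

lemma part_carrier: "x \<in> lsa_part L a \<Longrightarrow> x \<in> lsa_carrier L"
  using lsa_part_subset_carrier[OF lie] by blast

lemma carrier_span: "L.span (e ` {1..n}) = lsa_carrier L"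
  using basis by (simp add: family_basis_def)

lemma carrier_subspace: "L.subspace (lsa_carrier L)"
  using carrier_span L.subspace_span by metis

lemma part_subspace: "L.subspace (lsa_part L a)"
  by (rule lsa_part_subspace[OF lie])

lemma hom_part: "x \<in> lsa_part L a \<Longrightarrow> \<phi> x \<in> vpart n p a"
  using embedding unfolding lsa_embedding_def lsa_hom_def by blast

lemma hom_add: "x \<in> lsa_carrier L \<Longrightarrow> y \<in> lsa_carrier L \<Longrightarrow> \<phi> (x + y) = \<phi> x + \<phi> y"
  using embedding unfolding lsa_embedding_def lsa_hom_def by blast

lemma hom_bracket:
  "x \<in> lsa_carrier L \<Longrightarrow> y \<in> lsa_carrier L \<Longrightarrow> \<phi> (lsa_bracket L x y) = vbracket p (\<phi> x) (\<phi> y)"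
  using embedding unfolding lsa_embedding_def lsa_hom_def by (simp add: vect_def)

lemma hom_scale: "x \<in> lsa_carrier L \<Longrightarrow> \<phi> (lsa_scale L a x) = vscale a (\<phi> x)"
  using embedding unfolding lsa_embedding_def lsa_hom_def by (simp add: vect_def)

lemma hom_square:
  "CHAR('k) = 2 \<Longrightarrow> x \<in> lsa_part L True \<Longrightarrow> \<phi> (lsa_square L x) = vcomp p (\<phi> x) (\<phi> x)"
  using embedding unfolding lsa_embedding_def lsa_hom_def by (simp add: vect_def)

lemma hom_inj: "inj_on \<phi> (lsa_carrier L)"
  using embedding unfolding lsa_embedding_def by blast

lemma hom_zero: "\<phi> 0 = 0"
  using hom_scale[of 0 0] L.subspace_0[OF carrier_subspace] by simp

lemma basis_carrier: "i \<in> {1..n} \<Longrightarrow> e i \<in> lsa_carrier L"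
  using basis_parity part_carrier by blast

lemma hom_combination:
  assumes "finite A" "A \<subseteq> {1..n}"
  shows "\<phi> (\<Sum>k\<in>A. lsa_scale L (a k) (e k)) = (\<Sum>k\<in>A. vscale (a k) (\<phi> (e k)))"
  using assms
proof (induction A rule: finite_induct)
  case (insert x A)
  have "lsa_scale L (a x) (e x) \<in> lsa_carrier L" "(\<Sum>k\<in>A. lsa_scale L (a k) (e k)) \<in> lsa_carrier L"
    using insert by (auto intro!: L.subspace_sum L.subspace_scale carrier_subspace basis_carrier)
  thus ?case using insert basis_carrier[of x] by (simp add: hom_add hom_scale)
qed (simp add: hom_zero)

lemma carrier_combination:
  assumes "x \<in> lsa_carrier L"
  obtains a where "x = (\<Sum>k\<in>{1..n}. lsa_scale L (a k) (e k))"
proof -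
  have inj: "inj_on e {1..n}" using basis by (simp add: family_basis_def)
  have "x \<in> L.span (e ` {1..n})" using assms carrier_span by simp
  then obtain u where "x = (\<Sum>v\<in>e ` {1..n}. lsa_scale L (u v) v)" by (auto simp: L.span_finite)
  hence "x = (\<Sum>k\<in>{1..n}. lsa_scale L (u (e k)) (e k))" by (simp add: sum.reindex[OF inj])
  thus thesis by (rule that)
qed

lemma part_Int:
  assumes "x \<in> lsa_part L False" "x \<in> lsa_part L True" shows "x = 0"
proof -
  have "lsa_part L False \<inter> lsa_part L True = {0}"
    using lie unfolding lie_superalgebra_def by (elim conjE) assumption
  thus ?thesis using assms by blast
qed

lemma bracket_part:
  assumes "x \<in> lsa_part L a" "y \<in> lsa_part L b" shows "lsa_bracket L x y \<in> lsa_part L (a \<noteq> b)"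
proof -
  have "\<forall>a b. \<forall>x\<in>lsa_part L a. \<forall>y\<in>lsa_part L b. lsa_bracket L x y \<in> lsa_part L (a \<noteq> b)"
    using lie unfolding lie_superalgebra_def by (elim conjE) assumption
  thus ?thesis using assms by blast
qed

lemma bracket_add:
  assumes "x \<in> lsa_carrier L" "y \<in> lsa_carrier L" "z \<in> lsa_carrier L"
  shows "lsa_bracket L (x + y) z = lsa_bracket L x z + lsa_bracket L y z"
    "lsa_bracket L x (y + z) = lsa_bracket L x y + lsa_bracket L x z"
proof -
  have "\<forall>x\<in>lsa_carrier L. \<forall>y\<in>lsa_carrier L. \<forall>z\<in>lsa_carrier L. \<forall>c.
        lsa_bracket L (x + y) z = lsa_bracket L x z + lsa_bracket L y z \<and>
        lsa_bracket L x (y + z) = lsa_bracket L x y + lsa_bracket L x z \<and>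
        lsa_bracket L (lsa_scale L c x) y = lsa_scale L c (lsa_bracket L x y) \<and>
        lsa_bracket L x (lsa_scale L c y) = lsa_scale L c (lsa_bracket L x y)"
    using lie unfolding lie_superalgebra_def by (elim conjE) assumption
  thus "lsa_bracket L (x + y) z = lsa_bracket L x z + lsa_bracket L y z"
    "lsa_bracket L x (y + z) = lsa_bracket L x y + lsa_bracket L x z"
    using assms by blast+
qed

lemma square_part:
  assumes "CHAR('k) = 2" "x \<in> lsa_part L True" shows "lsa_square L x \<in> lsa_part L False"
proof -
  have "\<forall>x\<in>lsa_part L True. lsa_square L x \<in> lsa_part L False"
    using lie unfolding lie_superalgebra_def
    by (elim conjE) (erule impE[where P = "CHAR('k) = 2"], rule assms(1), elim conjE, assumption)
  thus ?thesis using assms(2) by blast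
qed

text \<open>Abstract generation speaks of subalgebras of \<open>L\<close>. The elements whose parity
  components are mapped into \<open>Q\<close> form such a subalgebra \<open>h\<close>; it contains
  \<open>S\<close>, hence everything.\<close>

lemma hom_generated:
  assumes gen: "lsa_generated_by L S" and S: "S = L.span (e ` I)" and I: "I \<subseteq> {1..n}"
    and Qs: "\<And>b. vs.subspace (Q b)" and Qe: "\<And>i. i \<in> I \<Longrightarrow> \<phi> (e i) \<in> Q (p i)"
    and Qb: "\<And>a b x y. x \<in> Q a \<Longrightarrow> y \<in> Q b \<Longrightarrow> vbracket p x y \<in> Q (a \<noteq> b)"
    and Qq: "\<And>x. CHAR('k) = 2 \<Longrightarrow> x \<in> Q True \<Longrightarrow> vcomp p x x \<in> Q False"
    and i: "i \<in> {1..n}"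
  shows "\<phi> (e i) \<in> Q (p i)"
proof -
  define K where "K a = {x \<in> lsa_part L a. \<phi> x \<in> Q a}" for a
  define h where "h = {x + y |x y. x \<in> K False \<and> y \<in> K True}"
  have Kc: "x \<in> lsa_carrier L" if "x \<in> K a" for x a using that part_carrier by (auto simp: K_def)
  have Ks: "L.subspace (K a)" for a
    by (rule L.subspaceI)
      (auto simp: K_def hom_zero hom_add hom_scale part_carrier L.subspace_0[OF part_subspace] vs.subspace_0[OF Qs]
        intro: L.subspace_add[OF part_subspace] L.subspace_scale[OF part_subspace] vs.subspace_add[OF Qs] vs.subspace_scale[OF Qs])
  have hs: "L.subspace h"
  proof (rule L.subspaceI)
    show "0 \<in> h" using L.subspace_0[OF Ks] unfolding h_def mem_Collect_eq
      by (intro exI[of _ 0]) simp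
  next
    fix x y assume "x \<in> h" "y \<in> h"
    then obtain a b a' b' where ab: "x = a + b" "y = a' + b'" "a \<in> K False" "b \<in> K True" "a' \<in> K False" "b' \<in> K True"
      by (auto simp: h_def)
    hence "x + y = (a + a') + (b + b')" by (simp add: algebra_simps)
    moreover have "a + a' \<in> K False" "b + b' \<in> K True" using ab by (auto intro: L.subspace_add[OF Ks])
    ultimately show "x + y \<in> h" unfolding h_def by blast
  next
    fix x r assume "x \<in> h"
    then obtain a b where ab: "x = a + b" "a \<in> K False" "b \<in> K True" by (auto simp: h_def)
    hence "lsa_scale L r x = lsa_scale L r a + lsa_scale L r b" by (simp add: L.scale_right_distrib)
    moreover have "lsa_scale L r a \<in> K False" "lsa_scale L r b \<in> K True"
      using ab by (auto intro: L.subspace_scale[OF Ks])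
    ultimately show "lsa_scale L r x \<in> h" unfolding h_def by blast
  qed
  have K0: "0 \<in> K a" for a by (rule L.subspace_0[OF Ks])
  have Kh: "K a \<subseteq> h" for a
  proof
    fix x assume x: "x \<in> K a"
    have "x = x + 0" "x = 0 + x" by simp_all
    thus "x \<in> h" using x K0 unfolding h_def mem_Collect_eq
      by (cases a) (rule exI[of _ 0], rule exI[of _ x], simp, rule exI[of _ x], rule exI[of _ 0], simp)
  qed
  \<comment> \<open>Uniqueness of the parity decomposition: a homogeneous element of
    \<open>h\<close> lies in the corresponding \<open>K a\<close>. Closure under squares needs this,
    as does the final conclusion about \<open>e i\<close>.\<close>
  have hK: "x \<in> K a" if xh: "x \<in> h" and xa: "x \<in> lsa_part L a" for x a
  proof -
    obtain u v where uv: "x = u + v" "u \<in> K False" "v \<in> K True" using xh by (auto simp: h_def)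
    have uv': "u \<in> lsa_part L False" "v \<in> lsa_part L True" using uv by (auto simp: K_def)
    show ?thesis
    proof (cases a)
      case True
      hence "x - v \<in> lsa_part L True" using xa uv' by (auto intro: L.subspace_diff[OF part_subspace])
      hence "u = 0" using uv(1) uv'(1) part_Int by simp
      thus ?thesis using uv True by simp
    next
      case False
      hence "x - u \<in> lsa_part L False" using xa uv' by (auto intro: L.subspace_diff[OF part_subspace])
      hence "v = 0" using uv(1) uv'(2) part_Int by simp
      thus ?thesis using uv False by simp
    qed
  qed
  have Kb: "lsa_bracket L x y \<in> K (a \<noteq> b)" if "x \<in> K a" "y \<in> K b" for x y a b
    using that bracket_part[of x a y b] Qb[of "\<phi> x" a "\<phi> y" b] hom_bracket[OF Kc Kc, of x a y b]
    by (simp add: K_def)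
  have "lsa_subalgebra L h"
    unfolding lsa_subalgebra_def super_subspace_def
  proof (intro conjI hs ballI impI)
    show "h = {x + y |x y. x \<in> h \<inter> lsa_part L False \<and> y \<in> h \<inter> lsa_part L True}"
    proof (intro equalityI subsetI)
      fix x assume "x \<in> h"
      then obtain u v where uv: "x = u + v" "u \<in> K False" "v \<in> K True" by (auto simp: h_def)
      moreover have "u \<in> h \<inter> lsa_part L False" "v \<in> h \<inter> lsa_part L True"
        using uv Kh by (auto simp: K_def)
      ultimately show "x \<in> {x + y |x y. x \<in> h \<inter> lsa_part L False \<and> y \<in> h \<inter> lsa_part L True}" by blast
    qed (use L.subspace_add[OF hs] in auto)
  next
    fix x y assume "x \<in> h" "y \<in> h"
    then obtain a b a' b' where ab: "x = a + b" "y = a' + b'" "a \<in> K False" "b \<in> K True" "a' \<in> K False" "b' \<in> K True"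
      by (auto simp: h_def)
    note c = Kc[OF ab(3)] Kc[OF ab(4)] Kc[OF ab(5)] Kc[OF ab(6)]
    have "lsa_bracket L x y = (lsa_bracket L a a' + lsa_bracket L b a') + (lsa_bracket L a b' + lsa_bracket L b b')"
      using c L.subspace_add[OF carrier_subspace c(1,2)] L.subspace_add[OF carrier_subspace c(3,4)]
      by (simp add: ab(1,2) bracket_add add_ac)
    moreover have "lsa_bracket L a a' \<in> h" "lsa_bracket L b a' \<in> h" "lsa_bracket L a b' \<in> h" "lsa_bracket L b b' \<in> h"
      using Kb Kh ab by blast+
    ultimately show "lsa_bracket L x y \<in> h" by (auto intro!: L.subspace_add[OF hs])
  next
    fix x assume c: "CHAR('k) = 2" and "x \<in> h \<inter> lsa_part L True"
    hence "x \<in> K True" using hK by blast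
    hence "lsa_square L x \<in> K False"
      using square_part[OF c] hom_square[OF c] Qq[OF c] by (simp add: K_def)
    thus "lsa_square L x \<in> h" using Kh by blast
  qed
  moreover have "S \<subseteq> h"
    unfolding S
  proof (rule L.span_minimal[OF image_subsetI hs])
    fix j assume "j \<in> I"
    hence "e j \<in> K (p j)" using Qe basis_parity I by (auto simp: K_def)
    thus "e j \<in> h" using Kh by blast
  qed
  ultimately have "lsa_carrier L \<subseteq> h" using gen by (simp add: lsa_generated_by_def)
  hence "e i \<in> K (p i)" using hK[OF _ basis_parity[OF i]] basis_carrier[OF i] by blast
  thus ?thesis by (simp add: K_def)
qed

text \<open>Transposition reverses the sign of brackets, and composing it with negation makes it a
  homomorphism. Squares are compared only in characteristic 2, where the sign disappears.\<close>

lemma transpose_isomorphic: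
  assumes f: "super_lie_frame n p w (\<lambda>i. \<phi> (e i)) c s"
  shows "lsa_isomorphic L (lsa_restrict (vect n p) (centralized n p (\<lambda>i. \<phi> (e i))))"
proof -
  interpret f: super_lie_frame n p w "\<lambda>i. \<phi> (e i)" c s by (rule f)
  let ?C = "centralized n p (\<lambda>i. \<phi> (e i))"
  let ?M = "lsa_restrict (vect n p) ?C"
  let ?T = f.transpose_field
  let ?\<psi> = "\<lambda>x. - ?T (\<phi> x)"
  have M: "lsa_part ?M a = vpart n p a \<inter> ?C" "lsa_bracket ?M = vbracket p" "lsa_scale ?M = vscale"
    "lsa_square ?M = (\<lambda>X. vcomp p X X)" for a
    by (simp_all add: lsa_restrict_def vect_def)
  have g: "\<phi> x \<in> centralized n p f.dual_frame" if x: "x \<in> lsa_carrier L" for x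
  proof -
    obtain a where "x = (\<Sum>k\<in>{1..n}. lsa_scale L (a k) (e k))" using x by (rule carrier_combination)
    hence "\<phi> x = (\<Sum>k\<in>{1..n}. vscale (a k) (\<phi> (e k)))" by (simp add: hom_combination)
    also have "\<dots> \<in> centralized n p f.dual_frame"
      by (intro vs.subspace_sum vs.subspace_scale f.dual.centralized_subspace f.frame_centralized)
    finally show ?thesis .
  qed
  have MC: "lsa_carrier ?M = ?C"
  proof (intro equalityI subsetI)
    fix Z assume Z: "Z \<in> ?C"
    hence "Z \<in> vfields n p" by (simp add: centralized_def)
    thus "Z \<in> lsa_carrier ?M"
      unfolding lsa_carrier_def M
      using f.centralized_vparity_part[OF Z] vparity_part_in[of Z n p] vparity_part_sum[of Z p] by blast
  qed (auto simp: lsa_carrier_def M intro: vs.subspace_add[OF f.centralized_subspace])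
  have "lsa_hom L ?M ?\<psi>"
    unfolding lsa_hom_def M
  proof (intro conjI allI ballI impI IntI)
    fix a x assume x: "x \<in> lsa_part L a"
    show "?\<psi> x \<in> vpart n p a"
      by (intro vs.subspace_neg vpart_subspace f.transpose_field_vpart hom_part x)
    show "?\<psi> x \<in> ?C"
      by (intro vs.subspace_neg f.centralized_subspace f.transpose_field_centralized)
  next
    fix x y assume xy: "x \<in> lsa_carrier L" "y \<in> lsa_carrier L"
    show "?\<psi> (x + y) = ?\<psi> x + ?\<psi> y" by (simp add: hom_add xy f.transpose_field_add)
    show "?\<psi> (lsa_bracket L x y) = vbracket p (?\<psi> x) (?\<psi> y)"
      using f.transpose_field_vbracket_centralized[OF g g] xy
      by (simp add: hom_bracket vbracket_minus_left vbracket_minus_right)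
  next
    fix x a assume "x \<in> lsa_carrier L"
    thus "?\<psi> (lsa_scale L a x) = vscale a (?\<psi> x)" by (simp add: hom_scale f.transpose_field_vscale)
  next
    fix x assume c: "CHAR('k) = 2" and x: "x \<in> lsa_part L True"
    have neg: "- Z = Z" for Z :: "'k vfield"
    proof -
      have "- Z = vscale (- 1) Z" by simp
      also have "(- 1 :: 'k) = 1" by (rule uminus_CHAR_2[OF c])
      finally show ?thesis by simp
    qed
    show "?\<psi> (lsa_square L x) = vcomp p (?\<psi> x) (?\<psi> x)"
      unfolding neg hom_square[OF c x]
      by (rule f.transpose_field_square[OF c g[OF part_carrier[OF x]] hom_part[OF x], symmetric])
  qed
  moreover have "bij_betw ?\<psi> (lsa_carrier L) (lsa_carrier ?M)"
    unfolding MC bij_betw_def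
  proof (intro conjI inj_onI equalityI subsetI)
    fix x y assume xy: "x \<in> lsa_carrier L" "y \<in> lsa_carrier L" "?\<psi> x = ?\<psi> y"
    hence T: "?T (\<phi> x) = ?T (\<phi> y)" by simp
    have "\<phi> x = \<phi> y"
    proof (rule f.dual.centralized_eqI[OF g g])
      fix k
      have "\<phi> x \<in> vfields n p" "\<phi> y \<in> vfields n p" using g xy by (auto simp: centralized_def)
      thus "lookup (lookup (\<phi> x) k) 0 = lookup (lookup (\<phi> y) k) 0"
        using f.transpose_field_value[of "\<phi> x" k] f.transpose_field_value[of "\<phi> y" k] by (simp add: T)
    qed (use xy in auto)
    thus "x = y" using hom_inj xy by (auto dest: inj_onD)
  next
    fix Z assume "Z \<in> ?\<psi> ` lsa_carrier L"
    thus "Z \<in> ?C" by (auto intro!: vs.subspace_neg f.centralized_subspace f.transpose_field_centralized)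
  next
    fix Z assume Z: "Z \<in> ?C"
    \<comment> \<open>The preimage has the negated values at the origin as coordinates; this sign
      compensates the one in \<open>?\<psi>\<close>.\<close>
    define a where "a k = - lookup (lookup Z k) 0" for k
    let ?x = "\<Sum>k\<in>{1..n}. lsa_scale L (a k) (e k)"
    have x: "?x \<in> lsa_carrier L"
      by (intro L.subspace_sum L.subspace_scale carrier_subspace basis_carrier)
    have add: "additive ?T" by unfold_locales (rule f.transpose_field_add)
    have "?T (\<phi> ?x) = (\<Sum>k\<in>{1..n}. vscale (a k) (f.dual_frame k))"
      by (simp add: hom_combination additive.sum[OF add] f.transpose_field_vscale f.transpose_field_frame)
    hence "?\<psi> ?x = (\<Sum>k\<in>{1..n}. vscale (lookup (lookup Z k) 0) (f.dual_frame k))"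
      by (simp add: a_def sum_negf)
    also have "\<dots> = Z" using f.dual.frame_span_value[of Z] Z by (simp add: f.span_dual_frame)
    finally show "Z \<in> ?\<psi> ` lsa_carrier L" using x by (rule image_eqI[OF sym])
  qed
  ultimately show ?thesis unfolding lsa_isomorphic_def by blast
qed

end

theorem mainTheorem2:
  fixes \<nn> :: "('k::field, 'v::ab_group_add) lsa"
    and G :: "int \<Rightarrow> 'v set"
    and n n\<^sub>1 d :: nat
    and e :: "nat \<Rightarrow> 'v"
    and c :: "nat \<Rightarrow> nat \<Rightarrow> nat \<Rightarrow> 'k"
    and p :: "nat \<Rightarrow> bool"
    and w :: "nat \<Rightarrow> nat"
    and \<phi> :: "'v \<Rightarrow> 'k vfield"
    and X :: "nat \<Rightarrow> 'k vfield"
    and \<gg> C :: "'k vfield set"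
  assumes ground_field:
      "CHAR('k) > 0 \<or> (\<exists>f :: 'k \<Rightarrow> real. field_iso f) \<or> (\<exists>f :: 'k \<Rightarrow> complex. field_iso f)"
    and lie: "lie_superalgebra \<nn>"
    and grading: "lsa_grading \<nn> G"
    and negative: "\<And>k. k \<ge> 0 \<Longrightarrow> G k = {0}"
    and depth: "d > 1" "G (- int d) \<noteq> {0}" "\<And>k. k < - int d \<Longrightarrow> G k = {0}"
    and generated: "lsa_generated_by \<nn> (G (-1))"
    and basis: "family_basis (lsa_scale \<nn>) {1..n} e (lsa_carrier \<nn>)"
    and basis_graded:
      "\<And>s. family_basis (lsa_scale \<nn>) {i \<in> {1..n}. w i = s} e (G (- int s))"
    and basis_ordered: "mono_on {1..n} w"
    and basis_parity: "\<And>i. i \<in> {1..n} \<Longrightarrow> e i \<in> lsa_part \<nn> (p i)"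
    and structure_constants: "\<And>i j. i \<in> {1..n} \<Longrightarrow> j \<in> {1..n} \<Longrightarrow>
      lsa_bracket \<nn> (e i) (e j) = (\<Sum>k = 1..n. lsa_scale \<nn> (c i j k) (e k))"
    and n1: "n\<^sub>1 = vector_space.dim (lsa_scale \<nn>) (G (-1))"
    and embedding: "lsa_embedding \<nn> (vect n p) \<phi>"
    and X: "\<And>i. i \<in> {1..n} \<Longrightarrow> X i = \<phi> (e i)"
    and X_degree: "\<And>i. i \<in> {1..n} \<Longrightarrow> X i \<in> vgrade n p w (- int (w i))"
    and X_at_0: "\<And>i. i \<in> {1..n} \<Longrightarrow> value_at_0 (X i) = vpartial i"
    and g_minus: "\<gg> = module.span vscale (X ` {1..n})"
    and centralizer: "C = lsa_centralizer (vect n p) (vneg n p w) \<gg>"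
  shows
    "(\<exists>!Y. Y \<in> extensional {1..n} \<and> normalized_basis n C Y) \<and>
     (\<forall>Y. normalized_basis n C Y \<longrightarrow>
        (\<forall>i\<in>{1..n}. Y i \<in> lsa_part (vect n p) (p i)) \<and>
        (\<forall>i\<in>{1..n}. \<forall>j\<in>{1..n}.
           vbracket p (Y i) (Y j) = - (\<Sum>k = 1..n. vscale (c i j k) (Y k))) \<and>
        lsa_subalgebra (vect n p) C \<and>
        lsa_isomorphic \<nn> (lsa_restrict (vect n p) C) \<and>
        (\<exists>\<theta>. dual_forms n p Y \<theta>) \<and>
        (\<forall>\<theta>. dual_forms n p Y \<theta> \<longrightarrow>
           (\<forall>Z\<in>vfields n p. Z = (\<Sum>i = 1..n. fsmult p (\<theta> i Z) (Y i))) \<and>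
           complete_prolong n p w \<gg> = preserving n p (distribution n p n\<^sub>1 \<theta>) \<and>
           complete_prolong n p w \<gg> =
             {Z \<in> vfields n p. \<forall>i\<in>{1..n\<^sub>1}. \<forall>k\<in>{n\<^sub>1 + 1..n}. \<theta> k (vbracket p Z (Y i)) = 0} \<and>
           complete_prolong n p w \<gg> =
             {Z \<in> vfields n p. \<forall>i\<in>{1..n\<^sub>1}. \<forall>k\<in>{n\<^sub>1 + 1..n}.
                vact p (Y i) (\<theta> k Z) -
                (\<Sum>j = 1..n. fscale (c i j k) (parity_twist p (p i) (\<theta> j Z))) = 0})) \<and>
     graded_subalgebra n p w (complete_prolong n p w \<gg>) \<and>
     complete_prolong n p w \<gg> \<inter> vneg n p w = \<gg> \<and>
     (\<forall>h. graded_subalgebra n p w h \<and> h \<inter> vneg n p w = \<gg> \<longrightarrow>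
        h \<subseteq> complete_prolong n p w \<gg>)"
proof -
  interpret e: embedded_superalgebra \<nn> n p \<phi> e
    using lie embedding basis basis_parity by unfold_locales
  have ind: "\<not> e.L.dependent (e ` {1..n})" and inj_e: "inj_on e {1..n}"
    using basis by (simp_all add: family_basis_def)
  \<comment> \<open>A basis vector of weight 0 would lie in \<open>G 0\<close>, which is zero,
    contradicting independence.\<close>
  have w_pos: "0 < w i" if i: "i \<in> {1..n}" for i
  proof (rule ccontr)
    assume "\<not> 0 < w i"
    hence "e i \<in> G (- int 0)"
      using basis_graded[of 0] i e.L.span_base[of "e i" "e ` {i \<in> {1..n}. w i = 0}"]
      by (auto simp: family_basis_def)
    hence "e i = 0" using negative[of 0] by simp
    thus False using ind i e.L.dependent_zero by (metis image_eqI)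
  qed
  let ?I = "{i \<in> {1..n}. w i = 1}"
  have G1: "G (- 1) = e.L.span (e ` ?I)" and ind1: "\<not> e.L.dependent (e ` ?I)" and inj1: "inj_on e ?I"
    using basis_graded[of 1] by (simp_all add: family_basis_def)
  have "n\<^sub>1 = card ?I"
    unfolding n1 G1 e.L.dim_span_eq_card_independent[OF ind1] by (rule card_image[OF inj1])
  moreover have "?I = {1..card ?I}"
  proof (rule initial_segment_card)
    fix i j assume ij: "i \<in> ?I" "1 \<le> j" "j \<le> i"
    hence j: "j \<in> {1..n}" by auto
    have "w j \<le> w i" by (rule mono_onD[OF basis_ordered j]) (use ij in auto)
    thus "j \<in> ?I" using w_pos[OF j] j ij by auto
  qed auto
  ultimately have I: "?I = {1..n\<^sub>1}" by simp
  have Xe: "\<phi> (e i) = X i" if "i \<in> {1..n}" for i using X that by simp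
  have frame: "super_frame n p w (\<lambda>i. \<phi> (e i))"
    by unfold_locales (use e.hom_part basis_parity X X_degree X_at_0 basis_ordered w_pos in auto)
  \<comment> \<open>The square of an odd basis vector lies in the carrier and is expanded in the
    basis. The guards make the statement hold for every \<open>i\<close>, so that a single function
    \<open>s\<close> can be chosen.\<close>
  have "\<exists>a. CHAR('k) = 2 \<longrightarrow> i \<in> {1..n} \<longrightarrow> p i \<longrightarrow>
      vcomp p (\<phi> (e i)) (\<phi> (e i)) = (\<Sum>k\<in>{1..n}. vscale (a k) (\<phi> (e k)))" for i
  proof (cases "CHAR('k) = 2 \<and> i \<in> {1..n} \<and> p i")
    case True
    hence ei: "e i \<in> lsa_part \<nn> True" using basis_parity[of i] by simp
    obtain a where "lsa_square \<nn> (e i) = (\<Sum>k\<in>{1..n}. lsa_scale \<nn> (a k) (e k))"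
      using e.carrier_combination[OF e.part_carrier[OF e.square_part[OF _ ei]]] True by blast
    hence "vcomp p (\<phi> (e i)) (\<phi> (e i)) = (\<Sum>k\<in>{1..n}. vscale (a k) (\<phi> (e k)))"
      using e.hom_square[OF _ ei] True e.hom_combination[of "{1..n}" a] by simp
    thus ?thesis by blast
  qed auto
  then obtain s where s: "CHAR('k) = 2 \<Longrightarrow> i \<in> {1..n} \<Longrightarrow> p i \<Longrightarrow>
      vcomp p (\<phi> (e i)) (\<phi> (e i)) = (\<Sum>k\<in>{1..n}. vscale (s i k) (\<phi> (e k)))" for i by metis
  have brk: "vbracket p (\<phi> (e i)) (\<phi> (e j)) = (\<Sum>k\<in>{1..n}. vscale (c i j k) (\<phi> (e k)))"
    if ij: "i \<in> {1..n}" "j \<in> {1..n}" for i j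
  proof -
    have "vbracket p (\<phi> (e i)) (\<phi> (e j)) = \<phi> (\<Sum>k = 1..n. lsa_scale \<nn> (c i j k) (e k))"
      using e.hom_bracket[OF e.basis_carrier[OF ij(1)] e.basis_carrier[OF ij(2)]]
      by (simp only: structure_constants[OF ij])
    thus ?thesis by (simp add: e.hom_combination)
  qed
  have lie_frame: "super_lie_frame n p w (\<lambda>i. \<phi> (e i)) c s"
    by (intro super_lie_frame.intro super_lie_frame_axioms.intro frame brk s)
  interpret f: generated_super_lie_frame n p w "\<lambda>i. \<phi> (e i)" c s n\<^sub>1
  proof (intro generated_super_lie_frame.intro generated_super_lie_frame_axioms.intro lie_frame)
    show "w i = 1 \<longleftrightarrow> i \<le> n\<^sub>1" if "i \<in> {1..n}" for i
    proof -
      have "i \<in> ?I \<longleftrightarrow> i \<in> {1..n\<^sub>1}" by (simp only: I)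
      thus ?thesis using that by auto
    qed
    show "n\<^sub>1 \<le> n"
    proof (cases "n\<^sub>1 = 0")
      case False
      hence "n\<^sub>1 \<in> {1..n\<^sub>1}" by simp
      hence "n\<^sub>1 \<in> ?I" by (simp only: I)
      thus ?thesis by simp
    qed simp
    fix Q :: "bool \<Rightarrow> 'k vfield set" and i
    assume Q: "\<And>b. vs.subspace (Q b)" "\<And>i. i \<in> {1..n\<^sub>1} \<Longrightarrow> \<phi> (e i) \<in> Q (p i)"
      "\<And>a b x y. x \<in> Q a \<Longrightarrow> y \<in> Q b \<Longrightarrow> vbracket p x y \<in> Q (a \<noteq> b)"
      "\<And>x. CHAR('k) = 2 \<Longrightarrow> x \<in> Q True \<Longrightarrow> vcomp p x x \<in> Q False" "i \<in> {1..n}"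
    show "\<phi> (e i) \<in> Q (p i)"
    proof (rule e.hom_generated[OF generated G1 _ Q(1) _ Q(3) Q(4) Q(5)])
      show "\<phi> (e i) \<in> Q (p i)" if "i \<in> ?I" for i
        using that unfolding I by (rule Q(2))
    qed auto
  qed
  let ?F = "\<lambda>i. \<phi> (e i)"
  have g: "\<gg> = vs.span (?F ` {1..n})"
    unfolding g_minus by (rule arg_cong[where f = vs.span]) (simp add: Xe)
  have C: "C = centralized n p ?F" unfolding centralizer g by (rule f.centralizer_eq)
  have prolong: "complete_prolong n p w \<gg> = f.stabilizer" unfolding g by (rule f.complete_prolong_eq)
  \<comment> \<open>A basis is a function on all natural numbers; fixing it outside
    \<open>{1..n}\<close> turns uniqueness of the fields into uniqueness of the function.\<close>
  have ex1: "\<exists>!Y. Y \<in> extensional {1..n} \<and> normalized_basis n C Y"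
  proof (rule ex1I[of _ "restrict f.dual_frame {1..n}"])
    have im: "restrict f.dual_frame {1..n} ` {1..n} = f.dual_frame ` {1..n}" by auto
    have "value_at_0 (restrict f.dual_frame {1..n} i) = vpartial i" if "i \<in> {1..n}" for i
      unfolding restrict_apply'[OF that] by (rule f.dual_frame(3)[OF that])
    moreover have "family_basis vscale {1..n} (restrict f.dual_frame {1..n}) C"
      using f.dual.frame_family_basis unfolding C family_basis_def im inj_on_restrict_eq f.span_dual_frame .
    ultimately have "normalized_basis n C (restrict f.dual_frame {1..n})"
      unfolding normalized_basis_def by blast
    thus "restrict f.dual_frame {1..n} \<in> extensional {1..n} \<and> normalized_basis n C (restrict f.dual_frame {1..n})"
      by simp
    fix Y assume Y: "Y \<in> extensional {1..n} \<and> normalized_basis n C Y"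
    show "Y = restrict f.dual_frame {1..n}"
      by (rule extensionalityI[of _ "{1..n}"]) (use Y f.normalized_basis_unique[of Y] C in auto)
  qed
  have dual: "(\<forall>Z\<in>vfields n p. Z = (\<Sum>i = 1..n. fsmult p (\<theta> i Z) (Y i))) \<and>
      f.stabilizer = preserving n p (distribution n p n\<^sub>1 \<theta>) \<and>
      f.stabilizer = {Z \<in> vfields n p. \<forall>i\<in>{1..n\<^sub>1}. \<forall>k\<in>{n\<^sub>1 + 1..n}. \<theta> k (vbracket p Z (Y i)) = 0} \<and>
      f.stabilizer = {Z \<in> vfields n p. \<forall>i\<in>{1..n\<^sub>1}. \<forall>k\<in>{n\<^sub>1 + 1..n}.
        vact p (Y i) (\<theta> k Z) - (\<Sum>j = 1..n. fscale (c i j k) (parity_twist p (p i) (\<theta> j Z))) = 0}"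
    if Y: "\<And>i. i \<in> {1..n} \<Longrightarrow> Y i = f.dual_frame i" and \<theta>: "dual_forms n p Y \<theta>" for Y \<theta>
  proof -
    have "dual_forms n p f.dual_frame \<theta>" using \<theta> Y by (simp add: dual_forms_def)
    hence \<theta>': "\<theta> k Z = f.coef Z k" if "k \<in> {1..n}" "Z \<in> vfields n p" for k Z
      using f.dual.dual_forms_eq_coef that by blast
    have br: "vbracket p Z (f.dual_frame i) \<in> vfields n p" if "Z \<in> vfields n p" "i \<in> {1..n}" for Z i
      using that by (intro vbracket_vfields f.dual.frame_vfields)
    have d: "distribution n p n\<^sub>1 \<theta> = f.horizontal"
      unfolding distribution_def f.horizontal_def using \<theta>' f.high by auto
    have 1: "Z = (\<Sum>i = 1..n. fsmult p (\<theta> i Z) (Y i))" if "Z \<in> vfields n p" for Z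
      using f.dual.frame_expansion[OF that] that by (simp add: \<theta>' Y)
    have 2: "f.stabilizer = {Z \<in> vfields n p. \<forall>i\<in>{1..n\<^sub>1}. \<forall>k\<in>{n\<^sub>1 + 1..n}. \<theta> k (vbracket p Z (Y i)) = 0}"
      unfolding f.stabilizer_iff_coef
      by (intro Collect_cong conj_cong refl ball_cong)
        (simp only: Y[OF f.low] \<theta>'[OF f.high br[OF _ f.low]])
    have 3: "f.stabilizer = {Z \<in> vfields n p. \<forall>i\<in>{1..n\<^sub>1}. \<forall>k\<in>{n\<^sub>1 + 1..n}.
        vact p (Y i) (\<theta> k Z) - (\<Sum>j = 1..n. fscale (c i j k) (parity_twist p (p i) (\<theta> j Z))) = 0}"
      unfolding f.stabilizer_iff_equations
      by (intro Collect_cong conj_cong refl ball_cong)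
        (simp only: Y[OF f.low] \<theta>'[OF f.high] \<theta>' cong: sum.cong)
    show ?thesis
    proof (intro conjI)
      show "f.stabilizer = preserving n p (distribution n p n\<^sub>1 \<theta>)"
        unfolding d by (rule f.stabilizer_eq_preserving)
    qed (use 1 in blast, fact 2, fact 3)
  qed
  have part1: "(\<forall>i\<in>{1..n}. Y i \<in> lsa_part (vect n p) (p i)) \<and>
        (\<forall>i\<in>{1..n}. \<forall>j\<in>{1..n}. vbracket p (Y i) (Y j) = - (\<Sum>k = 1..n. vscale (c i j k) (Y k))) \<and>
        lsa_subalgebra (vect n p) C \<and> lsa_isomorphic \<nn> (lsa_restrict (vect n p) C) \<and>
        (\<exists>\<theta>. dual_forms n p Y \<theta>)"
    if Y: "\<And>i. i \<in> {1..n} \<Longrightarrow> Y i = f.dual_frame i" for Y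
  proof (intro conjI ballI)
    show "Y i \<in> lsa_part (vect n p) (p i)" if "i \<in> {1..n}" for i
      unfolding Y[OF that] by (rule f.dual.frame_part[OF that])
    show "vbracket p (Y i) (Y j) = - (\<Sum>k = 1..n. vscale (c i j k) (Y k))" if "i \<in> {1..n}" "j \<in> {1..n}" for i j
      using f.dual_frame_vbracket[OF that] that by (simp add: Y)
    show "lsa_subalgebra (vect n p) C" unfolding C by (rule f.centralized_subalgebra)
    show "lsa_isomorphic \<nn> (lsa_restrict (vect n p) C)"
      unfolding C by (rule e.transpose_isomorphic[OF lie_frame])
    show "\<exists>\<theta>. dual_forms n p Y \<theta>"
      using f.dual.dual_forms_coef Y by (intro exI[of _ "\<lambda>i Z. f.coef Z i"]) (simp add: dual_forms_def)
  qed
  \<comment> \<open>This reduces the claims about an arbitrary normalized basis to the constructed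
    \<open>f.dual_frame\<close>.\<close>
  have uniq: "Y i = f.dual_frame i" if "normalized_basis n C Y" "i \<in> {1..n}" for Y i
    using f.normalized_basis_unique that unfolding C by blast
  show ?thesis
    unfolding prolong
  proof (intro conjI ex1 allI impI)
    show "graded_subalgebra n p w f.stabilizer" by (rule f.stabilizer_graded_subalgebra)
    show "f.stabilizer \<inter> vneg n p w = \<gg>" unfolding g by (rule f.stabilizer_vneg)
    show "h \<subseteq> f.stabilizer" if "graded_subalgebra n p w h \<and> h \<inter> vneg n p w = \<gg>" for h
      using f.stabilizer_maximal[of h] that unfolding g by blast
  qed (use part1 dual uniq in blast)+
qed

end
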